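(* There is an absolute constant $C>0$ such that the following holds. Fix $\delta\in(0,1)$, positive integers $L,\Lambda$, and $d$. Let $G$ be a $d$-regular graph on $n$ vertices that is bicycle-free at some radius $R\ge C\log\log n/\delta$. Let $\mathcal C$ be any consistent family of even cycles of $G$, each of length at most $L$, let $W=\operatorname{span}_{\mathbb F_2}\{\chi_C: C\in\mathcal C\}$, and suppose $\Lambda_W:=\max_{z\in W}|z|\le\Lambda$. Then some signing $\sigma$ in the solution family $\mathcal F$ of $\mathcal C$ (that is, some signing for which every cycle in $\mathcal C$ is unbalanced) satisfies $$\rho(A_\sigma)\le 2\sqrt{d-1}\,\bigl(1+C\delta\log(1/\delta)\bigr)(1+o(1)),$$ where $o(1)\to0$ as $n\to\infty$ with $d,\delta,L,\Lambda$ fixed.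
   Context: $G=(V,E)$ is a finite simple connected graph. A signing is $\sigma\in\{\pm1\}^E$, encoded by $s\in\mathbb F_2^E$ with $\sigma_e=(-1)^{s_e}$; $A_\sigma$ is the signed adjacency matrix, with $uv$ entry $\sigma_{uv}$ if $uv\in E$ and $0$ otherwise; $\rho(A_\sigma)=\max_i|\lambda_i(A_\sigma)|$. For a cycle $C$, $\chi_C\in\mathbb F_2^E$ is the indicator vector of its edge set; $C$ is unbalanced under $\sigma$ if $s\cdot\chi_C=1$ in $\mathbb F_2$ (equivalently the product of the signs of its edges is $-1$). A family $\mathcal C$ of even cycles (cycles of even length) is consistent if the linear system $s\cdot\chi_C=1$ $(C\in\mathcal C)$ over $\mathbb F_2$ has a solution $s$. The empty family is allowed, giving $W=\{0\}$. For $z\in\mathbb F_2^E$, $|z|$ is the number of nonzero coordinates. A graph is bicycle-free at radius $R$ if for every vertex $v$ the ball of radius $R$ around $v$ (the subgraph induced on the vertices at distance at most $R$ from $v$) contains at most one cycle. Logarithms are natural. *)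

theory Defs
  imports
    "HOL-Analysis.Analysis"
    "HOL-Library.Z2"
    "HOL-Library.Function_Algebras"
    "Jordan_Normal_Form.Spectral_Radius"
begin

section \<open>Graphs\<close>

text \<open>
  A simple graph on \<open>n\<close> vertices has vertex set \<open>{..<n}\<close> and is given by its set of edges,
  each edge being a two-element set of vertices.  Concrete vertices are used so that a constant
  quantified inside a statement can serve all graphs at once.
\<close>

type_synonym edge = "nat set"

definition simple_graph :: "nat \<Rightarrow> edge set \<Rightarrow> bool" where
  "simple_graph n E \<longleftrightarrow> (\<forall>e\<in>E. \<exists>u v. u < n \<and> v < n \<and> u \<noteq> v \<and> e = {u, v})"

definition adj_rel :: "edge set \<Rightarrow> (nat \<times> nat) set" where
  "adj_rel E = {(u, v). {u, v} \<in> E}"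

definition connected_graph :: "nat \<Rightarrow> edge set \<Rightarrow> bool" where
  "connected_graph n E \<longleftrightarrow> (\<forall>u<n. \<forall>v<n. (u, v) \<in> (adj_rel E)\<^sup>*)"

definition regular_graph :: "nat \<Rightarrow> edge set \<Rightarrow> nat \<Rightarrow> bool" where
  "regular_graph n E d \<longleftrightarrow> (\<forall>v<n. card {u. {v, u} \<in> E} = d)"

text \<open>
  The length of a shortest walk.  This is arbitrary for vertices in different components;
  \<open>graph_ball\<close> excludes these explicitly.
\<close>

definition graph_dist :: "edge set \<Rightarrow> nat \<Rightarrow> nat \<Rightarrow> nat" where
  "graph_dist E u v = (LEAST k. (u, v) \<in> adj_rel E ^^ k)"

definition graph_ball :: "edge set \<Rightarrow> nat \<Rightarrow> real \<Rightarrow> nat set" where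
  "graph_ball E v R = {u. (v, u) \<in> (adj_rel E)\<^sup>* \<and> real (graph_dist E v u) \<le> R}"

definition induced_edges :: "edge set \<Rightarrow> nat set \<Rightarrow> edge set" where
  "induced_edges E U = {e \<in> E. e \<subseteq> U}"


section \<open>Cycles\<close>

text \<open>
  A cycle is a subgraph, hence determined by its edge set: neither the starting vertex nor the
  orientation matters when cycles are counted.  Its length is the cardinality of this set.
\<close>

definition cycle_edges :: "nat list \<Rightarrow> edge set" where
  "cycle_edges p = {{p ! i, p ! (Suc i mod length p)} | i. i < length p}"

definition graph_cycle :: "edge set \<Rightarrow> edge set \<Rightarrow> bool" where
  "graph_cycle E C \<longleftrightarrow>
     (\<exists>p. distinct p \<and> 3 \<le> length p \<and> C = cycle_edges p \<and> C \<subseteq> E)"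

definition even_cycle :: "edge set \<Rightarrow> edge set \<Rightarrow> bool" where
  "even_cycle E C \<longleftrightarrow> graph_cycle E C \<and> even (card C)"

definition bicycle_free :: "nat \<Rightarrow> edge set \<Rightarrow> real \<Rightarrow> bool" where
  "bicycle_free n E R \<longleftrightarrow>
     (\<forall>v<n. \<forall>C D. graph_cycle (induced_edges E (graph_ball E v R)) C \<longrightarrow>
                  graph_cycle (induced_edges E (graph_ball E v R)) D \<longrightarrow> C = D)"


section \<open>The edge space over the field with two elements\<close>

text \<open>
  A vector indexed by \<open>E\<close> is a function that vanishes outside \<open>E\<close>.
\<close>

type_synonym edge_vec = "edge \<Rightarrow> bit"

definition edge_space :: "edge set \<Rightarrow> edge_vec set" where
  "edge_space E = {s. \<forall>e. e \<notin> E \<longrightarrow> s e = 0}"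

definition edge_dot :: "edge set \<Rightarrow> edge_vec \<Rightarrow> edge_vec \<Rightarrow> bit" where
  "edge_dot E s z = (\<Sum>e\<in>E. s e * z e)"

definition char_vec :: "edge set \<Rightarrow> edge_vec" where
  "char_vec C = (\<lambda>e. if e \<in> C then 1 else 0)"

definition vec_weight :: "edge set \<Rightarrow> edge_vec \<Rightarrow> nat" where
  "vec_weight E z = card {e \<in> E. z e \<noteq> 0}"

global_interpretation F2: vector_space "\<lambda>(c::bit) (z::edge_vec) e. c * z e"
  defines F2_span = F2.span
  by unfold_locales (auto simp: fun_eq_iff algebra_simps)

definition cycle_span :: "edge set set \<Rightarrow> edge_vec set" where
  "cycle_span \<C> = F2_span (char_vec ` \<C>)"

definition max_weight :: "edge set \<Rightarrow> edge set set \<Rightarrow> nat" where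
  "max_weight E \<C> = Max (vec_weight E ` cycle_span \<C>)"


section \<open>Signings\<close>

text \<open>The sign \<open>(-1)\<close> to the power \<open>s e\<close>.\<close>

definition signing :: "edge_vec \<Rightarrow> edge \<Rightarrow> real" where
  "signing s e = (if s e = 0 then 1 else - 1)"

definition unbalanced :: "edge set \<Rightarrow> edge_vec \<Rightarrow> edge set \<Rightarrow> bool" where
  "unbalanced E s C \<longleftrightarrow> edge_dot E s (char_vec C) = 1"

lemma unbalanced_iff_prod_signing:
  assumes "finite E" "C \<subseteq> E"
  shows "unbalanced E s C \<longleftrightarrow> (\<Prod>e\<in>C. signing s e) = - 1"
proof -
  have "finite C" using assms finite_subset by blast
  then have "(\<Prod>e\<in>C. signing s e) = (if (\<Sum>e\<in>C. s e) = 0 then 1 else - 1)"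
    by (induction C) (auto simp: signing_def)
  moreover have "edge_dot E s (char_vec C) = (\<Sum>e\<in>C. s e)"
    unfolding edge_dot_def char_vec_def using assms
    by (intro sum.mono_neutral_cong_right) auto
  ultimately show ?thesis by (auto simp: unbalanced_def)
qed

definition solutions :: "edge set \<Rightarrow> edge set set \<Rightarrow> edge_vec set" where
  "solutions E \<C> = {s \<in> edge_space E. \<forall>C\<in>\<C>. unbalanced E s C}"

definition consistent :: "edge set \<Rightarrow> edge set set \<Rightarrow> bool" where
  "consistent E \<C> \<longleftrightarrow> solutions E \<C> \<noteq> {}"

definition solution_family :: "edge set \<Rightarrow> edge set set \<Rightarrow> (edge \<Rightarrow> real) set" where
  "solution_family E \<C> = signing ` solutions E \<C>"

text \<open>
  The entries are real, but the matrix is complex because \<^const>\<open>spectral_radius\<close> is defined for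
  complex matrices; being Hermitian, it has the same eigenvalues over both fields.
\<close>

definition signed_adjacency :: "nat \<Rightarrow> edge set \<Rightarrow> (edge \<Rightarrow> real) \<Rightarrow> complex mat" where
  "signed_adjacency n E \<sigma> =
     mat n n (\<lambda>(u, v). if {u, v} \<in> E then complex_of_real (\<sigma> {u, v}) else 0)"

end

theory Submission
  imports Defs "HOL-Real_Asymp.Real_Asymp"
begin

text \<open>
  For an eigenvalue \<open>sqrt (d - 1) * (r + 1 / r)\<close> with \<open>r \<ge> 1\<close>, the nonbacktracking polynomial of degree
  \<open>m\<close> is at least \<open>(d - 1) powr (m / 2) * r ^ m\<close>; by Cauchy-Schwarz its square is at most the sum over
  pairs of nonbacktracking walks of length \<open>m\<close> with common endpoints of the product of their signs.
  Averaging over the solutions \<open>s\<close>, a pair cancels unless its parity vector lies in the span of the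
  cycles, and then it has at most \<open>\<Lambda>\<close> edges of odd multiplicity.  Hence it is enough to show that there
  are at most \<open>(d - 1) powr (m * (1 + o(1)))\<close> such pairs, or, after removing the common end, to count
  nonbacktracking walks of length \<open>T = 2 * m\<close> with few odd edges.

  Such a walk discovers at most about \<open>T / 2\<close> new vertices.  It is encoded by cutting it into segments
  that are new, repeat earlier stretches, or are short hops between known vertices.  Every cut costs a
  factor polynomial in \<open>m\<close>.  In a graph that is bicycle-free at radius of order \<open>a\<close>, many cuts force
  shortcuts each saving about \<open>a\<close> free steps, so that the cuts are paid for as soon as
  \<open>(d - 1) ^ a\<close> exceeds a fixed power of \<open>m\<close>.  With \<open>m\<close> about \<open>(ln n)\<^sup>2\<close>, an \<open>a\<close> of order
  \<open>ln (ln n)\<close> is enough.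
\<close>

section \<open>Nonbacktracking walks and short cycles\<close>

text \<open>The difficulty is to pay for the cuts. A cut costs at most a factor
  \<open>(d - 1) ^ h\<close> with \<open>h\<close> of order \<open>ln (ln n)\<close>, so
  \<open>h\<close> times the number of segments must be covered by what the cost saves below about
  \<open>T / 2\<close>. Savings come from shortcuts at good times (\<open>a\<close> each), from new
  runs too short to count, and from steps that are neither discoveries nor their matched returns
  (\<open>excess_times\<close>). Each of two segmentations of the walk profits from one of the first
  two sources, and both profit from the third; on average they satisfy the estimate, so the cheaper
  one does. It remains to see that many pieces force savings: before a bad time the walk is
  discovering, wasting steps or retracing an old strand. When it leaves a strand, it soon meets
  another one, which gives a shortcut because small cycles are excluded there, or it spends
  \<open>a\<close> steps among vertices whose first visits are not rich, and there are few such
  steps. Vertices on short cycles count as known from the start: bicycle-freeness leaves few of them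
  within reach of any vertex, and away from them the graph looks like a tree at scale
  \<open>10 * a\<close>.\<close>

definition nbwalk :: "edge set \<Rightarrow> (nat \<Rightarrow> nat) \<Rightarrow> nat \<Rightarrow> bool" where
  "nbwalk E w T \<longleftrightarrow> (\<forall>t<T. {w t, w (Suc t)} \<in> E) \<and> (\<forall>t. Suc (Suc t) \<le> T \<longrightarrow> w (Suc (Suc t)) \<noteq> w t)"

definition short_cycle_verts :: "edge set \<Rightarrow> nat \<Rightarrow> nat set" where
  "short_cycle_verts E l = {v. \<exists>p. distinct p \<and> 3 \<le> length p \<and> length p \<le> l \<and> v \<in> set p \<and>
     (\<forall>i<length p. {p ! i, p ! (Suc i mod length p)} \<in> E)}"

definition dist_le :: "edge set \<Rightarrow> nat \<Rightarrow> nat \<Rightarrow> nat \<Rightarrow> bool" where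
  "dist_le E k x y \<longleftrightarrow> (\<exists>j\<le>k. (x, y) \<in> adj_rel E ^^ j)"

definition near :: "edge set \<Rightarrow> nat set \<Rightarrow> nat \<Rightarrow> nat \<Rightarrow> bool" where
  "near E A k v \<longleftrightarrow> (\<exists>y\<in>A. dist_le E k y v)"

lemma dist_le_refl [simp]: "dist_le E k x x"
  unfolding dist_le_def by (rule exI[of _ 0]) simp

lemma dist_le_mono: "dist_le E k x y \<Longrightarrow> k \<le> l \<Longrightarrow> dist_le E l x y"
  unfolding dist_le_def by (meson le_trans)

lemma dist_le_trans: "dist_le E k x y \<Longrightarrow> dist_le E l y z \<Longrightarrow> dist_le E (k + l) x z"
  unfolding dist_le_def by (metis add_mono relcompI relpow_add)

lemma dist_le_edge: "{x, y} \<in> E \<Longrightarrow> dist_le E 1 x y"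
  unfolding dist_le_def adj_rel_def by (rule exI[of _ 1]) simp

lemma sym_adj_rel: "sym (adj_rel E)"
  unfolding adj_rel_def sym_def by (simp add: insert_commute)

lemma adj_rel_sym_relpow: "(x, y) \<in> adj_rel E ^^ j \<Longrightarrow> (y, x) \<in> adj_rel E ^^ j"
proof (induction j arbitrary: y)
  case (Suc j)
  then obtain z where z: "(x, z) \<in> adj_rel E ^^ j" "(z, y) \<in> adj_rel E" by auto
  then have "(y, z) \<in> adj_rel E" using sym_adj_rel by (meson symE)
  then show ?case using Suc.IH[OF z(1)] by (meson relpow_Suc_I2)
qed auto

lemma dist_le_sym: "dist_le E k x y \<Longrightarrow> dist_le E k y x"
  unfolding dist_le_def using adj_rel_sym_relpow by blast

lemma path_relpow:
  assumes "i \<le> j" "\<And>t. i \<le> t \<Longrightarrow> t < j \<Longrightarrow> {w t, w (Suc t)} \<in> E"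
  shows "(w i, w j) \<in> adj_rel E ^^ (j - i)"
  using assms
proof (induction j)
  case (Suc j)
  show ?case
  proof (cases "i = Suc j")
    case False
    then have "(w i, w j) \<in> adj_rel E ^^ (j - i)" using Suc by simp
    moreover have "(w j, w (Suc j)) \<in> adj_rel E" using Suc False by (simp add: adj_rel_def)
    moreover have "Suc j - i = Suc (j - i)" using Suc False by simp
    ultimately show ?thesis by auto
  qed simp
qed simp

lemma dist_le_path:
  assumes "i \<le> j" "\<And>t. i \<le> t \<Longrightarrow> t < j \<Longrightarrow> {w t, w (Suc t)} \<in> E"
  shows "dist_le E (j - i) (w i) (w j)"
  using path_relpow[of i j w E] assms unfolding dist_le_def by blast

lemma short_cycle_vertsI:
  assumes "distinct p" "3 \<le> length p" "length p \<le> l" "v \<in> set p"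
    and "\<And>i. i < length p \<Longrightarrow> {p ! i, p ! (Suc i mod length p)} \<in> E"
  shows "v \<in> short_cycle_verts E l"
  unfolding short_cycle_verts_def using assms by (intro CollectI exI[of _ p]) simp

lemma closed_path_cycle:
  assumes inj: "inj_on w {i..<j}" and "w i = w j" "i + 3 \<le> j" "j - i \<le> l"
    and e: "\<And>t. i \<le> t \<Longrightarrow> t < j \<Longrightarrow> {w t, w (Suc t)} \<in> E" and k: "i \<le> k" "k < j"
  shows "w k \<in> short_cycle_verts E l"
proof (rule short_cycle_vertsI[of "map w [i..<j]"])
  show "distinct (map w [i..<j])" using inj by (simp add: distinct_map)
  show "w k \<in> set (map w [i..<j])" using k by auto
  fix t assume t: "t < length (map w [i..<j])"
  show "{map w [i..<j] ! t, map w [i..<j] ! (Suc t mod length (map w [i..<j]))} \<in> E"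
  proof (cases "Suc t = j - i")
    case True
    then have "Suc (i + t) = j" using assms by simp
    then have "{w (i + t), w i} \<in> E" using e[of "i + t"] assms(2) by auto
    then show ?thesis using True assms by simp
  next
    case False
    then have "Suc t < j - i" using t by simp
    then show ?thesis using e[of "i + t"] by simp
  qed
qed (use assms in auto)

text \<open>Induction on \<open>j - i\<close>: an inner repetition gives a shorter closed stretch,
  and without one the stretch is itself a cycle. Lengths 1 and 2 are excluded by the absence of
  loops and by nonbacktracking.\<close>

lemma nbwalk_repeat_short_cycle:
  assumes "nbwalk E w T" "\<forall>v. {v} \<notin> E" "i < j" "j \<le> T" "w i = w j" "j - i \<le> l"
  shows "\<exists>k. i \<le> k \<and> k \<le> j \<and> w k \<in> short_cycle_verts E l"
  using assms(3-)
proof (induction "j - i" arbitrary: i j rule: less_induct)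
  case less
  show ?case
  proof (cases "inj_on w {i..<j}")
    case False
    then obtain i' j' where ij: "i' \<in> {i..<j}" "j' \<in> {i..<j}" "i' < j'" "w i' = w j'"
      unfolding inj_on_def by (metis linorder_neqE_nat)
    then have "\<exists>k. i' \<le> k \<and> k \<le> j' \<and> w k \<in> short_cycle_verts E l"
      using less.hyps[of j' i'] less.prems by auto
    then show ?thesis using ij by (meson atLeastLessThan_iff le_trans less_imp_le)
  next
    case True
    have e: "{w t, w (Suc t)} \<in> E" if "i \<le> t" "t < j" for t
      using assms(1) that less.prems unfolding nbwalk_def by auto
    have "j \<noteq> Suc i" using e[of i] less.prems assms(2) by auto
    moreover have "j \<noteq> Suc (Suc i)" using assms(1) less.prems unfolding nbwalk_def by metis
    ultimately have "i + 3 \<le> j" using less.prems by simp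
    then have "w i \<in> short_cycle_verts E l"
      using closed_path_cycle[OF True, where k = i and l = l and E = E] e less.prems by auto
    then show ?thesis using less.prems by (intro exI[of _ i]) auto
  qed
qed

text \<open>A shortest walk from \<open>x\<close> to \<open>y\<close> that avoids the edge is a
  path, and the edge closes it to a cycle. The given walk may therefore backtrack and repeat
  vertices; only its length matters.\<close>

lemma bridge_short_cycle:
  assumes xy: "{x, y} \<in> E" "x \<noteq> y" and "(x, y) \<in> adj_rel (E - {{x, y}}) ^^ k" "Suc k \<le> l"
  shows "x \<in> short_cycle_verts E l"
proof -
  let ?R = "adj_rel (E - {{x, y}})"
  define m where "m = (LEAST k. (x, y) \<in> ?R ^^ k)"
  have m: "(x, y) \<in> ?R ^^ m" unfolding m_def by (rule LeastI[of _ k]) (rule assms)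
  have mk: "m \<le> k" unfolding m_def by (rule Least_le) (rule assms)
  obtain f where f: "f 0 = x" "f m = y" "\<And>i. i < m \<Longrightarrow> (f i, f (Suc i)) \<in> ?R"
    using m unfolding relpow_fun_conv by blast
  have fE: "{f i, f (Suc i)} \<in> E - {{x, y}}" if "i < m" for i
    using f(3)[OF that] unfolding adj_rel_def by simp
  have inj: "inj_on f {..m}"
  proof (rule ccontr)
    assume "\<not> inj_on f {..m}"
    then obtain i j where ij: "i < j" "j \<le> m" "f i = f j"
      unfolding inj_on_def by (metis atMost_iff linorder_neqE_nat)
    have "(f 0, f i) \<in> ?R ^^ (i - 0)" by (rule path_relpow) (use fE ij in auto)
    moreover have "(f j, f m) \<in> ?R ^^ (m - j)" by (rule path_relpow) (use fE ij in auto)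
    ultimately have "(x, y) \<in> ?R ^^ (i + (m - j))"
      using ij f unfolding relpow_add by auto
    then have "m \<le> i + (m - j)" unfolding m_def by (rule Least_le)
    then show False using ij by simp
  qed
  have "m \<noteq> 0" using f(1,2) xy(2) by metis
  moreover have "m \<noteq> 1" using fE[of 0] f(1,2) by auto
  ultimately have m2: "2 \<le> m" by simp
  define g where "g i = (if i = Suc m then x else f i)" for i
  have "g 0 \<in> short_cycle_verts E l"
  proof (rule closed_path_cycle[where w = g and i = 0 and j = "Suc m" and k = 0])
    show "inj_on g {0..<Suc m}" using inj unfolding g_def inj_on_def by auto
    show "g 0 = g (Suc m)" using f m2 unfolding g_def by simp
    fix t assume "t < Suc m"
    then show "{g t, g (Suc t)} \<in> E"
      using fE[of t] f xy unfolding g_def by (cases "t = m") (auto simp: insert_commute)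
  qed (use m2 mk assms in auto)
  then show ?thesis using f unfolding g_def by simp
qed

text \<open>
  The stretch from \<open>s\<close> to \<open>t\<close> repeats an earlier one, forwards or backwards.
\<close>

definition repeats :: "(nat \<Rightarrow> nat) \<Rightarrow> nat \<Rightarrow> nat \<Rightarrow> bool" where
  "repeats w s t \<longleftrightarrow> (\<exists>j<s. \<forall>i\<le>t - s. w (s + i) = w (j + i)) \<or>
     (\<exists>j\<le>s. t - s \<le> j \<and> (\<forall>i\<le>t - s. w (s + i) = w (j - i)))"

section \<open>New times, copies and bad times of a single walk\<close>

locale nb_walk =
  fixes E :: "edge set" and w :: "nat \<Rightarrow> nat" and T a :: nat
  assumes nb: "nbwalk E w T" and loopfree: "\<forall>v. {v} \<notin> E" and a: "1 \<le> a"
begin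

text \<open>
  A time is new if it is the first visit to a vertex off the short cycles, and a copy if the walk
  runs along a stretch that it has already seen.  Between two consecutive bad times all times are
  new or all are copies.
\<close>

definition S :: "nat set" where "S = short_cycle_verts E (10 * a)"
definition first_visit :: "nat \<Rightarrow> nat" where "first_visit v = (LEAST i. w i = v)"
definition new :: "nat \<Rightarrow> bool" where "new t \<longleftrightarrow> first_visit (w t) = t \<and> w t \<notin> S"
definition copy :: "nat \<Rightarrow> bool" where
  "copy t \<longleftrightarrow> first_visit (w t) < t \<and> (first_visit (w t) = Suc (first_visit (w (t - 1))) \<or> first_visit (w (t - 1)) = Suc (first_visit (w t)))"
definition bad :: "nat \<Rightarrow> bool" where
  "bad t \<longleftrightarrow> 1 \<le> t \<and> t \<le> T \<and> (new t \<and> \<not> new (t - 1) \<or> \<not> new t \<and> \<not> copy t)"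

lemma first_visit_le: "first_visit (w t) \<le> t"
  unfolding first_visit_def by (rule Least_le) simp

lemma w_first_visit [simp]: "w (first_visit (w t)) = w t"
  unfolding first_visit_def by (rule LeastI[of _ t]) simp

lemma first_visit_le': "w i = w t \<Longrightarrow> first_visit (w t) \<le> i"
  unfolding first_visit_def by (rule Least_le)

lemma new_first: "new t \<Longrightarrow> w i = w t \<Longrightarrow> t \<le> i"
  unfolding new_def using first_visit_le' by metis

lemma new_notin: "new t \<Longrightarrow> w t \<notin> S"
  unfolding new_def by simp

lemma new_first_visit: "new t \<Longrightarrow> first_visit (w t) = t"
  unfolding new_def by simp

lemma walk_edge: "t < T \<Longrightarrow> {w t, w (Suc t)} \<in> E"
  using nb unfolding nbwalk_def by simp

lemma walk_edge': "1 \<le> t \<Longrightarrow> t \<le> T \<Longrightarrow> {w (t - 1), w t} \<in> E"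
  using walk_edge[of "t - 1"] by simp

lemma walk_nonbacktracking: "Suc (Suc t) \<le> T \<Longrightarrow> w (Suc (Suc t)) \<noteq> w t"
  using nb unfolding nbwalk_def by simp

lemma step_neq: "t < T \<Longrightarrow> w (Suc t) \<noteq> w t"
  using walk_edge[of t] loopfree by (metis insert_absorb2)

lemma dist_le_w: "i \<le> j \<Longrightarrow> j \<le> T \<Longrightarrow> dist_le E (j - i) (w i) (w j)"
  by (rule dist_le_path) (auto intro: walk_edge)

lemma dist_le_w': "i \<le> T \<Longrightarrow> j \<le> T \<Longrightarrow> j \<le> i + k \<Longrightarrow> i \<le> j + k \<Longrightarrow> dist_le E k (w i) (w j)"
  using dist_le_w[of i j] dist_le_w[of j i] dist_le_sym
  by (metis diff_le_self le_diff_conv le_cases dist_le_mono add.commute)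

text \<open>At a new time \<open>t\<close> the vertex \<open>w t\<close> is seen for the first time,
  so the edge from \<open>t\<close> to \<open>Suc t\<close> has not been used since the first visit
  of \<open>w (Suc t)\<close>, except by a backtracking step. If that visit were recent, the stretch
  in between and this edge would give a short cycle through \<open>w (Suc t)\<close>.\<close>

lemma arrival:
  assumes "new t" "Suc t \<le> T" "\<not> new (Suc t)"
  shows "w (Suc t) \<in> S \<or> first_visit (w (Suc t)) + 10 * a \<le> t"
proof (rule ccontr)
  assume c: "\<not> ?thesis"
  define x where "x = first_visit (w (Suc t))"
  have x: "w x = w (Suc t)" unfolding x_def by simp
  have "x \<noteq> Suc t" using c assms(3) unfolding x_def new_def by auto
  moreover have "x \<noteq> t" using x step_neq[of t] assms by auto
  moreover have "x \<le> Suc t" unfolding x_def by (rule first_visit_le)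
  ultimately have xt: "x < t" by simp
  let ?E = "E - {{w t, w (Suc t)}}"
  have e: "{w u, w (Suc u)} \<in> ?E" if u: "x \<le> u" "u < t" for u
  proof -
    have "{w u, w (Suc u)} \<noteq> {w t, w (Suc t)}"
    proof
      assume eq: "{w u, w (Suc u)} = {w t, w (Suc t)}"
      have "w u \<noteq> w t" using new_first[OF assms(1), of u] u by auto
      then have "w u = w (Suc t)" "w (Suc u) = w t" using eq by (auto simp: doubleton_eq_iff)
      then have "Suc u = t" using new_first[OF assms(1), of "Suc u"] u by auto
      then show False using walk_nonbacktracking[of u] \<open>w u = w (Suc t)\<close> assms by auto
    qed
    then show ?thesis using walk_edge[of u] u assms by auto
  qed
  have "(w x, w t) \<in> adj_rel ?E ^^ (t - x)" by (rule path_relpow) (use e xt in auto)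
  then have "w (Suc t) \<in> short_cycle_verts E (10 * a)"
    using bridge_short_cycle[of "w (Suc t)" "w t" E "t - x" "10 * a"] x xt c walk_edge[of t] assms step_neq[of t]
    unfolding x_def[symmetric] by (auto simp: insert_commute)
  then show False using c unfolding S_def by simp
qed

text \<open>A copy right after a new time \<open>t\<close> would have first visit
  \<open>t - 1\<close>, so the walk would backtrack.\<close>

lemma not_bad_after_new:
  assumes "new t" "Suc t \<le> T" "\<not> bad (Suc t)"
  shows "new (Suc t)"
proof (rule ccontr)
  assume n: "\<not> new (Suc t)"
  then have "copy (Suc t)" using assms unfolding bad_def by auto
  then have c: "first_visit (w (Suc t)) < Suc t" "first_visit (w (Suc t)) = Suc t \<or> t = Suc (first_visit (w (Suc t)))"
    using new_first_visit[OF assms(1)] unfolding copy_def by auto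
  then have eq: "t = Suc (first_visit (w (Suc t)))" by simp
  have "w (first_visit (w (Suc t))) = w (Suc t)" by simp
  then show False using walk_nonbacktracking[of "first_visit (w (Suc t))"] eq assms by metis
qed

lemma not_bad_after_copy:
  assumes "copy t" "Suc t \<le> T" "\<not> bad (Suc t)"
  shows "copy (Suc t)"
proof -
  have "\<not> new t" using assms(1) unfolding copy_def new_def by auto
  then show ?thesis using assms unfolding bad_def by auto
qed

text \<open>At a copy the first visit changes by exactly one. A change of direction would lead back
  to the vertex of two steps before, so the walk runs monotonically through the list of first
  visits.\<close>

lemma copy_stretch:
  assumes "copy (Suc s)" "\<And>u. Suc s < u \<Longrightarrow> u \<le> t \<Longrightarrow> \<not> bad u" "t \<le> T" "Suc s \<le> t"
  shows "(\<forall>i\<le>t - s. first_visit (w (s + i)) = first_visit (w s) + i) \<or>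
    (t - s \<le> first_visit (w s) \<and> (\<forall>i\<le>t - s. first_visit (w (s + i)) = first_visit (w s) - i))"
proof -
  have cp: "copy (s + Suc i)" if "s + Suc i \<le> t" for i
    using that
  proof (induction i)
    case (Suc i)
    then show ?case using not_bad_after_copy[of "s + Suc i"] assms by auto
  qed (use assms in simp)
  have nb': "first_visit (w (s + Suc (Suc i))) \<noteq> first_visit (w (s + i))" if "s + Suc (Suc i) \<le> t" for i
  proof
    assume "first_visit (w (s + Suc (Suc i))) = first_visit (w (s + i))"
    then have "w (s + Suc (Suc i)) = w (s + i)" by (metis w_first_visit)
    then show False using walk_nonbacktracking[of "s + i"] that assms by auto
  qed
  have "first_visit (w (Suc s)) = Suc (first_visit (w s)) \<or> first_visit (w s) = Suc (first_visit (w (Suc s)))"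
    using assms(1) unfolding copy_def by auto
  then show ?thesis
  proof
    assume u: "first_visit (w (Suc s)) = Suc (first_visit (w s))"
    have "first_visit (w (s + i)) = first_visit (w s) + i" if "s + i \<le> t" for i
      using that
    proof (induction i rule: less_induct)
      case (less i)
      show ?case
      proof (cases "i = 0 \<or> i = 1")
        case False
        then obtain j where j: "i = Suc (Suc j)" by (metis One_nat_def not0_implies_Suc)
        have "first_visit (w (s + j)) = first_visit (w s) + j" "first_visit (w (s + Suc j)) = first_visit (w s) + Suc j"
          using less.IH[of j] less.IH[of "Suc j"] less.prems j by auto
        then show ?thesis using nb'[of j] cp[of "Suc j"] less.prems j unfolding copy_def by auto
      qed (use u in auto)
    qed
    then show ?thesis using assms(4) by auto
  next
    assume u: "first_visit (w s) = Suc (first_visit (w (Suc s)))"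
    have "first_visit (w (s + i)) + i = first_visit (w s)" if "s + i \<le> t" for i
      using that
    proof (induction i rule: less_induct)
      case (less i)
      show ?case
      proof (cases "i = 0 \<or> i = 1")
        case False
        then obtain j where j: "i = Suc (Suc j)" by (metis One_nat_def not0_implies_Suc)
        have "first_visit (w (s + j)) + j = first_visit (w s)" "first_visit (w (s + Suc j)) + Suc j = first_visit (w s)"
          using less.IH[of j] less.IH[of "Suc j"] less.prems j by auto
        then show ?thesis using nb'[of j] cp[of "Suc j"] less.prems j unfolding copy_def by auto
      qed (use u in auto)
    qed
    then have *: "first_visit (w (s + i)) + i = first_visit (w s)" if "i \<le> t - s" for i using that assms(4) by auto
    have "t - s \<le> first_visit (w s)" using *[of "t - s"] by simp
    moreover have "\<forall>i\<le>t - s. first_visit (w (s + i)) = first_visit (w s) - i" using * by (metis add_diff_cancel_right')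
    ultimately show ?thesis by blast
  qed
qed

lemma homogeneous:
  assumes "s < t" "t \<le> T" "\<And>u. s < u \<Longrightarrow> u \<le> t \<Longrightarrow> \<not> bad u"
  shows "(\<forall>u. s < u \<and> u \<le> t \<longrightarrow> new u) \<or> repeats w s t"
proof (cases "new (Suc s)")
  case True
  have *: "new (s + Suc i)" if "s + Suc i \<le> t" for i
    using that
  proof (induction i)
    case (Suc i)
    then show ?case using not_bad_after_new[of "s + Suc i"] assms by auto
  qed (use True in simp)
  then have "new u" if "s < u" "u \<le> t" for u
    using that *[of "u - Suc s"] by simp
  then show ?thesis by blast
next
  case False
  have cp: "copy (Suc s)" using False assms(1,2) assms(3)[of "Suc s"] unfolding bad_def by auto
  have st: "(\<forall>i\<le>t - s. first_visit (w (s + i)) = first_visit (w s) + i) \<or>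
    (t - s \<le> first_visit (w s) \<and> (\<forall>i\<le>t - s. first_visit (w (s + i)) = first_visit (w s) - i))"
    by (rule copy_stretch[OF cp]) (use assms in auto)
  then show ?thesis
  proof
    assume u: "\<forall>i\<le>t - s. first_visit (w (s + i)) = first_visit (w s) + i"
    then have "first_visit (w (Suc s)) = Suc (first_visit (w s))" using assms(1) u[rule_format, of 1] by simp
    \<comment> \<open>The strict inequality matters: it makes the stretch determined by its past
      even if it overlaps the stretch that it repeats.\<close>
    then have "first_visit (w s) < s" using cp unfolding copy_def by auto
    moreover have "\<forall>i\<le>t - s. w (s + i) = w (first_visit (w s) + i)" using u by (metis w_first_visit)
    ultimately show ?thesis unfolding repeats_def by blast
  next
    assume u: "t - s \<le> first_visit (w s) \<and> (\<forall>i\<le>t - s. first_visit (w (s + i)) = first_visit (w s) - i)"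
    then have "\<forall>i\<le>t - s. w (s + i) = w (first_visit (w s) - i)" by (metis w_first_visit)
    then show ?thesis using u first_visit_le[of s] unfolding repeats_def by blast
  qed
qed

text \<open>Go from \<open>t\<close> to the first visit of \<open>w t\<close> and then one step back
  along the walk. Each such move uses up one new time and one edge, while everything between a first
  visit and a later return is skipped.\<close>

lemma near_new_count:
  "s \<le> t \<Longrightarrow> t \<le> T \<Longrightarrow> near E (w ` {..s} \<union> S) (card {u. s < u \<and> u \<le> t \<and> new u}) (w t)"
proof (induction t rule: less_induct)
  case (less t)
  show ?case
  proof (cases "w t \<in> w ` {..s} \<union> S")
    case True
    then show ?thesis unfolding near_def using dist_le_refl by blast
  next
    case False
    define x where "x = first_visit (w t)"
    have x: "w x = w t" "x \<le> t" unfolding x_def using first_visit_le by auto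
    have sx: "s < x" using False x by (metis UnI1 atMost_iff image_eqI not_less)
    have nx: "new x" using False x unfolding new_def x_def by auto
    define m where "m = x - 1"
    have xm: "x = Suc m" using sx unfolding m_def by simp
    have IH: "near E (w ` {..s} \<union> S) (card {u. s < u \<and> u \<le> m \<and> new u}) (w m)"
      by (rule less.IH) (use xm sx x less.prems in auto)
    have "Suc (card {u. s < u \<and> u \<le> m \<and> new u}) = card (insert x {u. s < u \<and> u \<le> m \<and> new u})"
      using xm by simp
    also have "\<dots> \<le> card {u. s < u \<and> u \<le> t \<and> new u}"
      by (rule card_mono) (use xm sx nx x in auto)
    finally have c: "card {u. s < u \<and> u \<le> m \<and> new u} + 1 \<le> card {u. s < u \<and> u \<le> t \<and> new u}" by simp
    have e: "dist_le E 1 (w m) (w t)"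
      using dist_le_edge[OF walk_edge, of m] xm x less.prems by auto
    obtain y where y: "y \<in> w ` {..s} \<union> S" "dist_le E (card {u. s < u \<and> u \<le> m \<and> new u}) y (w m)"
      using IH unfolding near_def by blast
    show ?thesis using dist_le_mono[OF dist_le_trans[OF y(2) e] c] y(1) unfolding near_def by blast
  qed
qed

end

section \<open>Segmentations of a walk\<close>

text \<open>
  A segment of cost \<open>c\<close> has about \<open>(d - 1) ^ c\<close> possible continuations once the walk up to time
  \<open>s\<close> is known, up to polynomial factors: all steps are free (\<open>c = t - s\<close>), or an earlier stretch is
  repeated, or the segment is short and its endpoint is at distance \<open>c\<close> from a known vertex.  In the
  last case the walk to the endpoint is nearly determined, because balls contain at most one cycle.
\<close>

definition seg :: "edge set \<Rightarrow> nat set \<Rightarrow> nat \<Rightarrow> (nat \<Rightarrow> nat) \<Rightarrow> nat \<Rightarrow> nat \<Rightarrow> nat \<Rightarrow> bool" where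
  "seg E S L w s t c \<longleftrightarrow> s < t \<and> (c = t - s \<or> c = 0 \<and> repeats w s t \<or>
     t - s \<le> L \<and> c \<le> L \<and> near E (w ` {..s} \<union> S) c (w t))"

inductive segs :: "edge set \<Rightarrow> nat set \<Rightarrow> nat \<Rightarrow> (nat \<Rightarrow> nat) \<Rightarrow> nat \<Rightarrow> nat \<Rightarrow> nat \<Rightarrow> bool"
  for E S L w where
  segs_0: "segs E S L w 0 0 0"
| segs_Suc: "segs E S L w s q B \<Longrightarrow> seg E S L w s t c \<Longrightarrow> segs E S L w t (Suc q) (B + c)"

text \<open>Measuring costs by a weight \<open>\<phi>\<close> on times turns the total cost of the
  segments into one sum, so that each segmentation below only has to exhibit a suitable
  weight.\<close>

lemma segs_cuts:
  assumes fin: "finite Cut" and "0 \<in> Cut"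
    and ok: "\<And>s t. s \<in> Cut \<Longrightarrow> t \<in> Cut \<Longrightarrow> s < t \<Longrightarrow> (\<And>u. u \<in> Cut \<Longrightarrow> u \<le> s \<or> t \<le> u) \<Longrightarrow>
        \<exists>c\<le>sum \<phi> {s<..t}. seg E S L w s t c"
  shows "t \<in> Cut \<Longrightarrow> \<exists>B\<le>sum \<phi> {0<..t}. segs E S L w t (card (Cut \<inter> {0<..t})) B"
proof (induction t rule: less_induct)
  case (less t)
  show ?case
  proof (cases "t = 0")
    case True
    then show ?thesis using segs_0 by auto
  next
    case False
    define s where "s = Max (Cut \<inter> {..<t})"
    have ne: "finite (Cut \<inter> {..<t})" "Cut \<inter> {..<t} \<noteq> {}" using fin assms(2) False by auto
    have s: "s \<in> Cut" "s < t" using Max_in[OF ne] unfolding s_def by auto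
    have gap: "u \<le> s \<or> t \<le> u" if "u \<in> Cut" for u
      using Max_ge[OF ne(1), of u] that unfolding s_def by (cases "u < t") auto
    obtain c where c: "c \<le> sum \<phi> {s<..t}" "seg E S L w s t c" using ok[OF s(1) less.prems s(2) gap] by blast
    obtain B where B: "B \<le> sum \<phi> {0<..s}" "segs E S L w s (card (Cut \<inter> {0<..s})) B"
      using less.IH[OF s(2) s(1)] by blast
    have "u \<in> insert t (Cut \<inter> {0<..s})" if u: "u \<in> Cut" "0 < u" "u \<le> t" for u
      using gap[OF u(1)] u by (cases "u = t") simp_all
    moreover have "0 < t" using False by simp
    ultimately have "Cut \<inter> {0<..t} = insert t (Cut \<inter> {0<..s})" using less.prems s(2) by fastforce
    then have "card (Cut \<inter> {0<..t}) = Suc (card (Cut \<inter> {0<..s}))" using fin s by simp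
    moreover have "{0<..t} = {0<..s} \<union> {s<..t}" using s by auto
    then have "sum \<phi> {0<..t} = sum \<phi> {0<..s} + sum \<phi> {s<..t}"
      by (simp add: sum.union_disjoint)
    ultimately show ?thesis using segs_Suc[OF B(2) c(2)] B(1) c(1) by (metis add_mono)
  qed
qed

lemma card_UN_bound: "finite I \<Longrightarrow> (\<And>i. i \<in> I \<Longrightarrow> card (A i) \<le> c) \<Longrightarrow> card (\<Union>i\<in>I. A i) \<le> card I * c"
  using card_UN_le[of I A] sum_bounded_above[of I "\<lambda>i. card (A i)" c] by (simp add: order_trans)

lemma card_Un3_le: "card (A \<union> B \<union> C) \<le> card A + card B + card C"
  using card_Un_le[of "A \<union> B" C] card_Un_le[of A B] by linarith

lemma card_Un4_le: "card (A \<union> B \<union> C \<union> D) \<le> card A + card B + card C + card D"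
  using card_Un_le[of "A \<union> B \<union> C" D] card_Un3_le[of A B C] by linarith

text \<open>Choose the least element, discard all that its interval covers, and continue with the
  rest.\<close>

lemma greedy_cover:
  fixes Bd :: "nat set"
  assumes "finite Bd" "\<And>\<beta>. \<beta> \<le> piece_end \<beta>"
  shows "\<exists>P\<subseteq>Bd. (\<forall>\<beta>\<in>P. \<forall>\<beta>'\<in>P. \<beta> < \<beta>' \<longrightarrow> piece_end \<beta> < \<beta>') \<and> (\<forall>t\<in>Bd. \<exists>\<beta>\<in>P. \<beta> \<le> t \<and> t \<le> piece_end \<beta>)"
  using assms(1)
proof (induction "card Bd" arbitrary: Bd rule: less_induct)
  case less
  show ?case
  proof (cases "Bd = {}")
    case False
    define \<beta> where "\<beta> = Min Bd"
    have \<beta>: "\<beta> \<in> Bd" "\<And>t. t \<in> Bd \<Longrightarrow> \<beta> \<le> t" using less.prems False unfolding \<beta>_def by auto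
    define Bd' where "Bd' = {t \<in> Bd. piece_end \<beta> < t}"
    have "\<beta> \<notin> Bd'" using assms(2)[of \<beta>] unfolding Bd'_def by simp
    then have "Bd' \<subset> Bd" using \<beta>(1) unfolding Bd'_def by blast
    then have "card Bd' < card Bd" "finite Bd'" using less.prems psubset_card_mono finite_subset by blast+
    then obtain P where P: "P \<subseteq> Bd'" "\<forall>\<beta>\<in>P. \<forall>\<beta>'\<in>P. \<beta> < \<beta>' \<longrightarrow> piece_end \<beta> < \<beta>'"
        "\<forall>t\<in>Bd'. \<exists>\<beta>\<in>P. \<beta> \<le> t \<and> t \<le> piece_end \<beta>"
      using less.hyps[of Bd'] by blast
    have "\<not> x < \<beta>" if "x \<in> P" for x
    proof -
      have "x \<in> Bd" using that P(1) unfolding Bd'_def by blast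
      then show ?thesis using \<beta>(2)[of x] by simp
    qed
    have lt: "piece_end \<beta> < x" if "x \<in> P" for x using that P(1) unfolding Bd'_def by auto
    have "\<exists>\<gamma>\<in>insert \<beta> P. \<gamma> \<le> t \<and> t \<le> piece_end \<gamma>" if "t \<in> Bd" for t
      using that P(3) \<beta>(2)[OF that] unfolding Bd'_def by (cases "piece_end \<beta> < t") auto
    moreover have "\<forall>x\<in>insert \<beta> P. \<forall>y\<in>insert \<beta> P. x < y \<longrightarrow> piece_end x < y"
      using P(2) lt \<open>\<And>x. x \<in> P \<Longrightarrow> \<not> x < \<beta>\<close> by auto
    moreover have "insert \<beta> P \<subseteq> Bd" using P(1) \<beta>(1) unfolding Bd'_def by auto
    ultimately show ?thesis by blast
  qed auto
qed

section \<open>Two segmentations of the same walk\<close>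

context nb_walk
begin

definition new_times :: "nat set" where "new_times = {t. 1 \<le> t \<and> t \<le> T \<and> new t}"
text \<open>
  At a good time the last \<open>4 * a\<close> steps, all to new vertices, end at distance at most \<open>3 * a\<close> from
  the older part of the walk, so that \<open>a\<close> units of cost are saved there.  Runs of new times shorter
  than \<open>4 * a\<close> (those satisfying \<open>in_short_run\<close>) lead back to known vertices and cost nothing.
\<close>

definition rich :: "nat \<Rightarrow> bool" where
  "rich x \<longleftrightarrow> 4 * a \<le> x \<and> x \<le> T \<and> (\<forall>u. x - 4 * a < u \<and> u \<le> x \<longrightarrow> new u)"
definition good :: "nat \<Rightarrow> bool" where
  "good x \<longleftrightarrow> rich x \<and> near E (w ` {..x - 4 * a} \<union> S) (3 * a) (w x)"
definition in_short_run :: "nat \<Rightarrow> bool" where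
  "in_short_run t \<longleftrightarrow> (\<exists>p r. 1 \<le> p \<and> p \<le> t \<and> t \<le> r \<and> r < T \<and> Suc r < p + 4 * a \<and>
     (\<forall>u. p \<le> u \<and> u \<le> r \<longrightarrow> new u) \<and> \<not> new (p - 1) \<and> \<not> new (Suc r))"
text \<open>A piece begins one step before a bad time. It lasts at least \<open>4 * a\<close> steps
  and is prolonged until it no longer ends within a short run; as short runs have fewer than
  \<open>4 * a\<close> times, it stays shorter than \<open>8 * a\<close>.\<close>

definition piece_end :: "nat \<Rightarrow> nat" where "piece_end \<beta> = (LEAST t. \<beta> - 1 + 4 * a \<le> t \<and> \<not> in_short_run t)"

lemma finite_new_times [simp]: "finite new_times" unfolding new_times_def by simp

lemma in_short_run_new: "in_short_run t \<Longrightarrow> new t" unfolding in_short_run_def by blast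

lemma in_short_runI: "1 \<le> p \<Longrightarrow> p \<le> t \<Longrightarrow> t \<le> r \<Longrightarrow> r < T \<Longrightarrow> Suc r < p + 4 * a \<Longrightarrow>
    (\<And>u. p \<le> u \<Longrightarrow> u \<le> r \<Longrightarrow> new u) \<Longrightarrow> \<not> new (p - 1) \<Longrightarrow> \<not> new (Suc r) \<Longrightarrow> in_short_run t"
  unfolding in_short_run_def by (intro exI[of _ p] exI[of _ r]) simp

lemma piece_end_props: "\<beta> - 1 + 4 * a \<le> piece_end \<beta>" "\<not> in_short_run (piece_end \<beta>)" "piece_end \<beta> < \<beta> - 1 + 8 * a"
proof -
  let ?t = "\<beta> - 1 + 4 * a"
  have "\<exists>t. ?t \<le> t \<and> \<not> in_short_run t \<and> t < \<beta> - 1 + 8 * a"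
  proof (cases "in_short_run ?t")
    case True
    then obtain p r where pr: "p \<le> ?t" "?t \<le> r" "Suc r < p + 4 * a" "\<not> new (Suc r)"
      unfolding in_short_run_def by blast
    then show ?thesis using in_short_run_new by (intro exI[of _ "Suc r"]) auto
  next
    case False
    then show ?thesis using a by (intro exI[of _ ?t]) auto
  qed
  then obtain t where t: "?t \<le> t \<and> \<not> in_short_run t" "t < \<beta> - 1 + 8 * a" by blast
  have "?t \<le> piece_end \<beta> \<and> \<not> in_short_run (piece_end \<beta>)" unfolding piece_end_def by (rule LeastI[of _ t]) (rule t(1))
  moreover have "piece_end \<beta> \<le> t" unfolding piece_end_def by (rule Least_le) (rule t(1))
  ultimately show "?t \<le> piece_end \<beta>" "\<not> in_short_run (piece_end \<beta>)" "piece_end \<beta> < \<beta> - 1 + 8 * a" using t(2) by auto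
qed

lemma piece_end_ge: "\<beta> \<le> piece_end \<beta>" using piece_end_props(1)[of \<beta>] a by linarith

lemma card_new_times_Suc: "sum (\<lambda>u. of_bool (Q u)) A = card {u \<in> A. Q u}" if "finite A"
  using that by (simp add: of_bool_def sum.If_cases Int_def)

definition pieces :: "nat set \<Rightarrow> bool" where
  "pieces P \<longleftrightarrow> finite P \<and> (\<forall>\<beta>\<in>P. bad \<beta>) \<and> (\<forall>\<beta>\<in>P. \<forall>\<beta>'\<in>P. \<beta> < \<beta>' \<longrightarrow> piece_end \<beta> < \<beta>') \<and>
     (\<forall>t. bad t \<longrightarrow> (\<exists>\<beta>\<in>P. \<beta> \<le> t \<and> t \<le> piece_end \<beta>))"

lemma pieces_exist: "\<exists>P. pieces P"
proof -
  have fin: "finite {t. bad t}" by (rule finite_subset[of _ "{..T}"]) (auto simp: bad_def)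
  from greedy_cover[OF fin, of piece_end] piece_end_ge
  obtain P where P: "P \<subseteq> {t. bad t}" "\<forall>\<beta>\<in>P. \<forall>\<beta>'\<in>P. \<beta> < \<beta>' \<longrightarrow> piece_end \<beta> < \<beta>'"
      "\<forall>t\<in>{t. bad t}. \<exists>\<beta>\<in>P. \<beta> \<le> t \<and> t \<le> piece_end \<beta>" by blast
  have "finite P" using finite_subset[OF P(1) fin] .
  then show ?thesis unfolding pieces_def using P by (intro exI[of _ P]) auto
qed

lemma bad_D: "bad t \<Longrightarrow> 1 \<le> t \<and> t \<le> T" unfolding bad_def by simp

text \<open>Cut at the ends of the pieces and around the window of \<open>4 * a\<close> steps before
  each time in \<open>G\<close>. A window consists of new times only, but its end is within
  \<open>3 * a\<close> of the old part, so it is traversed as one hop that saves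
  \<open>a\<close>.\<close>

lemma segs_good:
  assumes P: "pieces P" and G: "finite G" "\<And>x. x \<in> G \<Longrightarrow> good x"
    "\<And>x y. x \<in> G \<Longrightarrow> y \<in> G \<Longrightarrow> x < y \<Longrightarrow> x + 4 * a \<le> y"
  shows "\<exists>q B. segs E S (12 * a) w T q B \<and> q \<le> 2 * card P + 2 * card G + 1 \<and> B + a * card G \<le> card new_times"
proof -
  define ins where "ins = (\<Union>x\<in>G. {x - 4 * a<..<x})"
  define C0 where "C0 = {0, T} \<union> (\<lambda>\<beta>. \<beta> - 1) ` P \<union> (\<lambda>\<beta>. min (piece_end \<beta>) T) ` P"
  define Cut where "Cut = (C0 - ins) \<union> (G \<union> (\<lambda>x. x - 4 * a) ` G)"
  \<comment> \<open>The last \<open>a\<close> times of every window are exempt, which leaves the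
    window with the weight \<open>3 * a\<close> of its hop.\<close>
  define Q where "Q u \<longleftrightarrow> new u \<and> \<not> (\<exists>x\<in>G. x - a < u \<and> u \<le> x)" for u
  define \<phi> where "\<phi> u = (of_bool (Q u) :: nat)" for u
  have finP: "finite P" using P unfolding pieces_def by blast
  have GR: "4 * a \<le> x \<and> x \<le> T \<and> (\<forall>u. x - 4 * a < u \<and> u \<le> x \<longrightarrow> new u)" if "x \<in> G" for x
    using G(2)[OF that] unfolding good_def rich_def by blast
  have fin0: "finite C0" unfolding C0_def using finP by simp
  have finC: "finite Cut" unfolding Cut_def using fin0 G(1) by simp
  have 0: "0 \<in> Cut" unfolding Cut_def C0_def ins_def by auto
  have TC: "T \<in> Cut" 
  proof -
    have "T \<notin> ins"
    proof
      assume "T \<in> ins"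
      then obtain x where "x \<in> G" "T < x" unfolding ins_def by auto
      then show False using GR[of x] by simp
    qed
    then show ?thesis unfolding Cut_def C0_def by blast
  qed
  have PT: "\<beta> \<le> T" if "\<beta> \<in> P" for \<beta> using P that bad_D unfolding pieces_def by blast
  have CutT: "u \<le> T" if u: "u \<in> Cut" for u
  proof -
    consider "u \<in> C0" | x where "x \<in> G" "u = x \<or> u = x - 4 * a" using u unfolding Cut_def by blast
    then show ?thesis
    proof cases
      case 1
      then consider "u = 0" | "u = T" | \<beta> where "\<beta> \<in> P" "u = \<beta> - 1 \<or> u = min (piece_end \<beta>) T" unfolding C0_def by blast
      then show ?thesis
      proof cases
        case 3 then show ?thesis using PT[OF 3(1)] by auto
      qed auto
    next
      case 2 then show ?thesis using GR[OF 2(1)] by auto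
    qed
  qed
  have noins: "u \<notin> ins" if uC: "u \<in> Cut" for u
  proof
    assume "u \<in> ins"
    then obtain x where x: "x \<in> G" "x - 4 * a < u" "u < x" unfolding ins_def by auto
    obtain y where y: "y \<in> G" "u = y \<or> u = y - 4 * a" using uC \<open>u \<in> ins\<close> unfolding Cut_def by blast
    show False
    proof (cases x y rule: linorder_cases)
      case less then show False using G(3)[OF x(1) y(1)] x y GR[OF y(1)] GR[OF x(1)] by linarith
    next
      case equal then show False using x y by auto
    next
      case greater then show False using G(3)[OF y(1) x(1)] x y GR[OF y(1)] GR[OF x(1)] by linarith
    qed
  qed
  have step: "\<exists>c\<le>sum \<phi> {s<..t}. seg E S (12 * a) w s t c"
    if s: "s \<in> Cut" and t: "t \<in> Cut" and st: "s < t" and gap: "\<And>u. u \<in> Cut \<Longrightarrow> u \<le> s \<or> t \<le> u" for s t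
  proof -
    have tT: "t \<le> T" using CutT[OF t] .
    show ?thesis
    proof (cases "\<exists>x\<in>G. x - 4 * a \<le> s \<and> t \<le> x")
      case True
      then obtain x where x: "x \<in> G" "x - 4 * a \<le> s" "t \<le> x" by blast
      have noi: "\<not> (x - 4 * a < u \<and> u < x)" if "u \<in> Cut" for u
        using noins[OF that] x(1) unfolding ins_def by auto
      have tx: "t = x" using noi[OF t] x(2,3) st by linarith
      have sx: "s = x - 4 * a" using noi[OF s] x(2,3) st by linarith
      have xx: "4 * a \<le> x" "\<And>u. x - 4 * a < u \<Longrightarrow> u \<le> x \<Longrightarrow> new u" using GR[OF x(1)] by auto
      have "seg E S (12 * a) w s t (3 * a)"
      proof -
        have "near E (w ` {..s} \<union> S) (3 * a) (w t)" using G(2)[OF x(1)] unfolding good_def tx sx by blast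
        moreover have "t - s \<le> 12 * a" "3 * a \<le> 12 * a" unfolding tx sx by auto
        ultimately show ?thesis unfolding seg_def using st by blast
      qed
      moreover have "3 * a \<le> sum \<phi> {s<..t}"
      proof -
        have "u \<le> x - a \<Longrightarrow> x - 4 * a < u \<Longrightarrow> Q u" for u
        proof -
          assume u: "u \<le> x - a" "x - 4 * a < u"
          have "\<not> (y - a < u \<and> u \<le> y)" if y: "y \<in> G" for y
          proof (cases x y rule: linorder_cases)
            case less
            then have "x + 4 * a \<le> y" using G(3)[OF x(1) y] by blast
            then show ?thesis using u xx(1) a by linarith
          next
            case equal
            then show ?thesis using u xx(1) a by linarith
          next
            case greater
            then have "y + 4 * a \<le> x" using G(3)[OF y x(1)] by blast
            then show ?thesis using u xx(1) a by linarith
          qed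
          moreover have "new u" using xx(2)[of u] u by linarith
          ultimately show "Q u" unfolding Q_def by blast
        qed
        then have "{x - 4 * a<..x - a} \<subseteq> {u \<in> {s<..t}. Q u}" unfolding tx sx by auto
        then have "card {x - 4 * a<..x - a} \<le> card {u \<in> {s<..t}. Q u}" by (intro card_mono) auto
        then show ?thesis unfolding \<phi>_def by (subst card_new_times_Suc) (use xx(1) in auto)
      qed
      ultimately show ?thesis by blast
    next
      case False
      have out: "\<not> (\<exists>x\<in>G. x - 4 * a < u \<and> u \<le> x)" if u: "s < u" "u \<le> t" for u
      proof
        assume "\<exists>x\<in>G. x - 4 * a < u \<and> u \<le> x"
        then obtain x where x: "x \<in> G" "x - 4 * a < u" "u \<le> x" by blast
        have "x \<in> Cut" "x - 4 * a \<in> Cut" using x(1) unfolding Cut_def by blast+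
        then have "x \<le> s \<or> t \<le> x" "x - 4 * a \<le> s \<or> t \<le> x - 4 * a" using gap by blast+
        then have "x - 4 * a \<le> s" "t \<le> x" using x(2,3) u by linarith+
        then show False using False x by blast
      qed
      have Qn: "Q u \<longleftrightarrow> new u" if "s < u" "u \<le> t" for u
      proof -
        have "\<not> (x - a < u \<and> u \<le> x)" if "x \<in> G" for x
        proof
          assume "x - a < u \<and> u \<le> x"
          then have "x - 4 * a < u \<and> u \<le> x" by auto
          then show False using out[OF \<open>s < u\<close> \<open>u \<le> t\<close>] \<open>x \<in> G\<close> by blast
        qed
        then show ?thesis unfolding Q_def by blast
      qed
      have sum: "sum \<phi> {s<..t} = card {u. s < u \<and> u \<le> t \<and> new u}"
      proof -
        have "{u \<in> {s<..t}. Q u} = {u. s < u \<and> u \<le> t \<and> new u}" using Qn by auto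
        then show ?thesis unfolding \<phi>_def by (subst card_new_times_Suc) simp_all
      qed
      show ?thesis
      proof (cases "\<exists>u. s < u \<and> u \<le> t \<and> bad u")
        case True
        then obtain u where u: "s < u" "u \<le> t" "bad u" by blast
        then obtain \<beta> where \<beta>: "\<beta> \<in> P" "\<beta> \<le> u" "u \<le> piece_end \<beta>" using P unfolding pieces_def by blast
        have b\<beta>: "bad \<beta>" using P \<beta> unfolding pieces_def by blast
        \<comment> \<open>Inside a window two consecutive times are both new, so the second is not
          bad and no piece starts there.\<close>
        have "\<beta> - 1 \<notin> ins"
        proof
          assume "\<beta> - 1 \<in> ins"
          then obtain x where x: "x \<in> G" "x - 4 * a < \<beta> - 1" "\<beta> - 1 < x" unfolding ins_def by auto
          then have "x - 4 * a < \<beta>" "\<beta> \<le> x" by linarith+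
          then have "new (\<beta> - 1)" "new \<beta>" using GR[OF x(1)] x(2,3) by (blast intro: less_imp_le)+
          then show False using b\<beta> unfolding bad_def by auto
        qed
        then have "\<beta> - 1 \<in> Cut" using \<beta>(1) unfolding Cut_def C0_def by blast
        then have s1: "\<beta> - 1 \<le> s" using gap[of "\<beta> - 1"] \<beta> u bad_D[OF b\<beta>] by auto
        \<comment> \<open>If the cut at the end of the piece was dropped because it falls inside a
          window, the next cut is at most the end of that window. Hence the length bound
          \<open>12 * a\<close>, namely \<open>8 * a\<close> for the piece and \<open>4 * a\<close>
          for the window.\<close>
        have t1: "t \<le> piece_end \<beta> + 4 * a"
        proof (cases "min (piece_end \<beta>) T \<in> ins")
          case True
          then obtain x where x: "x \<in> G" "x - 4 * a < min (piece_end \<beta>) T" "min (piece_end \<beta>) T < x" unfolding ins_def by auto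
          have "x \<in> Cut" using x(1) unfolding Cut_def by blast
          moreover have "s < x" using x \<beta> u bad_D[OF u(3)] by auto
          ultimately have "t \<le> x" using gap[of x] by auto
          then show ?thesis using x by auto
        next
          case False
          then have "min (piece_end \<beta>) T \<in> Cut" using \<beta>(1) unfolding Cut_def C0_def by blast
          then have "t \<le> min (piece_end \<beta>) T" using gap[of "min (piece_end \<beta>) T"] \<beta> u bad_D[OF u(3)] by auto
          then show ?thesis by auto
        qed
        have len: "t - s \<le> 12 * a" using s1 t1 piece_end_props(3)[of \<beta>] bad_D[OF b\<beta>] by linarith
        let ?c = "card {u. s < u \<and> u \<le> t \<and> new u}"
        have "?c \<le> card {s<..t}" by (rule card_mono) auto
        then have "?c \<le> 12 * a" using len by simp
        moreover have "near E (w ` {..s} \<union> S) ?c (w t)" using near_new_count[of s t] st tT by simp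
        ultimately have "seg E S (12 * a) w s t ?c" unfolding seg_def using st len by blast
        then show ?thesis using sum by auto
      next
        case False
        then have "(\<forall>u. s < u \<and> u \<le> t \<longrightarrow> new u) \<or> repeats w s t"
          using homogeneous[OF st tT] by blast
        then show ?thesis
        proof
          assume "\<forall>u. s < u \<and> u \<le> t \<longrightarrow> new u"
          then have "{u. s < u \<and> u \<le> t \<and> new u} = {s<..t}" by auto
          then have "sum \<phi> {s<..t} = t - s" using sum by simp
          then show ?thesis unfolding seg_def using st by auto
        next
          assume "repeats w s t"
          then show ?thesis unfolding seg_def using st by auto
        qed
      qed
    qed
  qed
  have TT: "\<exists>B\<le>sum \<phi> {0<..T}. segs E S (12 * a) w T (card (Cut \<inter> {0<..T})) B"
    by (rule segs_cuts[OF finC 0 step TC])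
  have "Cut \<inter> {0<..T} \<subseteq> ({T} \<union> (\<lambda>\<beta>. \<beta> - 1) ` P \<union> (\<lambda>\<beta>. min (piece_end \<beta>) T) ` P) \<union> (G \<union> (\<lambda>x. x - 4 * a) ` G)"
    unfolding Cut_def C0_def by auto
  then have "card (Cut \<inter> {0<..T}) \<le> card (({T} \<union> (\<lambda>\<beta>. \<beta> - 1) ` P \<union> (\<lambda>\<beta>. min (piece_end \<beta>) T) ` P) \<union> (G \<union> (\<lambda>x. x - 4 * a) ` G))"
    by (intro card_mono) (use finP G(1) in auto)
  also have "\<dots> \<le> (card {T} + card ((\<lambda>\<beta>. \<beta> - 1) ` P) + card ((\<lambda>\<beta>. min (piece_end \<beta>) T) ` P)) + (card G + card ((\<lambda>x. x - 4 * a) ` G))"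
    by (rule order_trans[OF card_Un_le]) (intro add_mono card_Un3_le card_Un_le)
  also have "\<dots> \<le> 2 * card P + 2 * card G + 1"
    using card_image_le[OF finP, of "\<lambda>\<beta>. \<beta> - 1"] card_image_le[OF finP, of "\<lambda>\<beta>. min (piece_end \<beta>) T"]
      card_image_le[OF G(1), of "\<lambda>x. x - 4 * a"] by simp
  finally have q: "card (Cut \<inter> {0<..T}) \<le> 2 * card P + 2 * card G + 1" .
  have disj: "disjoint_family_on (\<lambda>x. {x - a<..x}) G"
    unfolding disjoint_family_on_def
  proof (intro ballI impI)
    fix x y assume xy: "x \<in> G" "y \<in> G" "x \<noteq> y"
    show "{x - a<..x} \<inter> {y - a<..y} = {}"
    proof (cases x y rule: linorder_cases)
      case less
      then have "x + 4 * a \<le> y" using G(3) xy by blast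
      then show ?thesis by auto
    next
      case greater
      then have "y + 4 * a \<le> x" using G(3) xy by blast
      then show ?thesis by auto
    qed (use xy in simp)
  qed
  have "card (\<Union>x\<in>G. {x - a<..x}) = (\<Sum>x\<in>G. card {x - a<..x})"
    by (rule card_UN_disjoint'[OF disj _ G(1)]) simp
  also have "\<dots> = (\<Sum>x\<in>G. a)"
  proof (rule sum.cong)
    fix x assume "x \<in> G"
    then have "4 * a \<le> x" using GR by blast
    then show "card {x - a<..x} = a" by simp
  qed simp
  finally have cU: "card (\<Union>x\<in>G. {x - a<..x}) = a * card G" by simp
  have sub: "(\<Union>x\<in>G. {x - a<..x}) \<subseteq> new_times"
  proof
    fix u assume "u \<in> (\<Union>x\<in>G. {x - a<..x})"
    then obtain x where x: "x \<in> G" "x - a < u" "u \<le> x" by auto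
    then have "x - 4 * a < u" "x \<le> T" "1 \<le> u" using GR[OF x(1)] a by linarith+
    then show "u \<in> new_times" using GR[OF x(1)] x(3) unfolding new_times_def by simp
  qed
  have "sum \<phi> {0<..T} = card {u \<in> {0<..T}. Q u}" unfolding \<phi>_def by (rule card_new_times_Suc) simp
  also have "{u \<in> {0<..T}. Q u} = new_times - (\<Union>x\<in>G. {x - a<..x})" unfolding new_times_def Q_def by auto
  also have "card \<dots> = card new_times - a * card G" using cU sub by (subst card_Diff_subset) (use finite_subset[OF sub] in auto)
  finally have eq: "sum \<phi> {0<..T} + a * card G = card new_times"
    using card_mono[OF finite_new_times sub] cU by simp
  obtain B where B: "B \<le> sum \<phi> {0<..T}" "segs E S (12 * a) w T (card (Cut \<inter> {0<..T})) B" using TT by blast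
  have "B + a * card G \<le> card new_times" using B(1) eq by linarith
  then show ?thesis using B(2) q by (intro exI conjI)
qed

text \<open>Within a piece one more cut is made at \<open>tl \<beta>\<close>, the last time spent at
  a vertex known before the piece. The hop to that vertex costs nothing, and no time of a short run
  remains after it.\<close>

lemma segs_short:
  assumes P: "pieces P"
  shows "\<exists>q B. segs E S (12 * a) w T q B \<and> q \<le> 3 * card P + 1 \<and> B \<le> card {t \<in> new_times. \<not> in_short_run t}"
proof -
  define piece_end' where "piece_end' \<beta> = min (piece_end \<beta>) T" for \<beta>
  define A where "A \<beta> = w ` {..\<beta> - 1} \<union> S" for \<beta>
  define tl where "tl \<beta> = Max {t. \<beta> - 1 \<le> t \<and> t \<le> piece_end' \<beta> \<and> w t \<in> A \<beta>}" for \<beta>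
  define Cut where "Cut = {0, T} \<union> (\<lambda>\<beta>. \<beta> - 1) ` P \<union> tl ` P \<union> piece_end' ` P"
  define \<phi> where "\<phi> u = (of_bool (new u \<and> \<not> in_short_run u) :: nat)" for u
  have finP: "finite P" and Pbad: "\<And>\<beta>. \<beta> \<in> P \<Longrightarrow> bad \<beta>"
    and Pdis: "\<And>\<beta> \<gamma>. \<beta> \<in> P \<Longrightarrow> \<gamma> \<in> P \<Longrightarrow> \<beta> < \<gamma> \<Longrightarrow> piece_end \<beta> < \<gamma>"
    and Pcov: "\<And>t. bad t \<Longrightarrow> \<exists>\<beta>\<in>P. \<beta> \<le> t \<and> t \<le> piece_end \<beta>"
    using P unfolding pieces_def by blast+
  have PT: "1 \<le> \<beta>" "\<beta> \<le> T" "\<beta> \<le> piece_end' \<beta>" "piece_end' \<beta> \<le> T" "piece_end' \<beta> \<le> piece_end \<beta>" if "\<beta> \<in> P" for \<beta>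
    using bad_D[OF Pbad[OF that]] piece_end_ge[of \<beta>] unfolding piece_end'_def by auto
  have tl: "\<beta> - 1 \<le> tl \<beta>" "tl \<beta> \<le> piece_end' \<beta>" "w (tl \<beta>) \<in> A \<beta>" if "\<beta> \<in> P" for \<beta>
  proof -
    have "\<beta> - 1 \<in> {t. \<beta> - 1 \<le> t \<and> t \<le> piece_end' \<beta> \<and> w t \<in> A \<beta>}" using PT[OF that] unfolding A_def by auto
    moreover have "finite {t. \<beta> - 1 \<le> t \<and> t \<le> piece_end' \<beta> \<and> w t \<in> A \<beta>}" by (rule finite_subset[of _ "{..piece_end' \<beta>}"]) auto
    ultimately have "tl \<beta> \<in> {t. \<beta> - 1 \<le> t \<and> t \<le> piece_end' \<beta> \<and> w t \<in> A \<beta>}" unfolding tl_def using Max_in by blast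
    then show "\<beta> - 1 \<le> tl \<beta>" "tl \<beta> \<le> piece_end' \<beta>" "w (tl \<beta>) \<in> A \<beta>" by auto
  qed
  have tl_max: "w u \<notin> A \<beta>" if "\<beta> \<in> P" "tl \<beta> < u" "u \<le> piece_end' \<beta>" for u \<beta>
  proof
    assume "w u \<in> A \<beta>"
    moreover have "finite {t. \<beta> - 1 \<le> t \<and> t \<le> piece_end' \<beta> \<and> w t \<in> A \<beta>}" by (rule finite_subset[of _ "{..piece_end' \<beta>}"]) auto
    ultimately have "u \<le> tl \<beta>" unfolding tl_def using that tl(1)[OF that(1)] by (intro Max_ge) auto
    then show False using that by simp
  qed
  \<comment> \<open>A short run met after \<open>tl \<beta>\<close> ends within the piece. By
    \<open>arrival\<close> it leads into \<open>S\<close> or to a vertex first visited at least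
    \<open>10 * a\<close> steps earlier, hence before the piece, which is shorter than
    \<open>8 * a\<close>. Either way \<open>tl \<beta>\<close> would not be the last such
    time.\<close>
  have nsh: "\<not> in_short_run u" if \<beta>: "\<beta> \<in> P" "tl \<beta> < u" "u \<le> piece_end' \<beta>" for u \<beta>
  proof
    assume "in_short_run u"
    then obtain p r where pr: "1 \<le> p" "p \<le> u" "u \<le> r" "r < T" "Suc r < p + 4 * a"
      "\<And>v. p \<le> v \<Longrightarrow> v \<le> r \<Longrightarrow> new v" "\<not> new (p - 1)" "\<not> new (Suc r)" unfolding in_short_run_def by blast
    have "\<not> piece_end \<beta> \<le> r"
    proof
      assume "piece_end \<beta> \<le> r"
      moreover have "p \<le> piece_end \<beta>" using pr \<beta> PT(5)[OF \<beta>(1)] by linarith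
      ultimately have "in_short_run (piece_end \<beta>)" using pr(1,4-8) by (intro in_short_runI[of p _ r])
      then show False using piece_end_props(2) by blast
    qed
    then have "Suc r \<le> piece_end' \<beta>" using pr unfolding piece_end'_def by auto
    then have nA: "w (Suc r) \<notin> A \<beta>" using tl_max[OF \<beta>(1), of "Suc r"] pr \<beta> by auto
    have "w (Suc r) \<in> S \<or> first_visit (w (Suc r)) + 10 * a \<le> r" using arrival[of r] pr by auto
    moreover have "w (Suc r) \<notin> S" using nA unfolding A_def by blast
    ultimately have "first_visit (w (Suc r)) + 10 * a \<le> r" by blast
    then have "first_visit (w (Suc r)) \<le> \<beta> - 1" using \<open>Suc r \<le> piece_end' \<beta>\<close> PT(5)[OF \<beta>(1)] piece_end_props(3)[of \<beta>] by linarith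
    then have "w (first_visit (w (Suc r))) \<in> A \<beta>" unfolding A_def by (intro UnI1 imageI) simp
    then show False using nA by simp
  qed
  have finC: "finite Cut" unfolding Cut_def using finP by simp
  have 0: "0 \<in> Cut" and TC: "T \<in> Cut" unfolding Cut_def by auto
  have mem: "\<beta> - 1 \<in> Cut" "tl \<beta> \<in> Cut" "piece_end' \<beta> \<in> Cut" if "\<beta> \<in> P" for \<beta> using that unfolding Cut_def by auto
  have CutT: "u \<le> T" if uC: "u \<in> Cut" for u
  proof -
    consider "u = 0" | "u = T" | \<beta> where "\<beta> \<in> P" "u = \<beta> - 1 \<or> u = tl \<beta> \<or> u = piece_end' \<beta>" using uC unfolding Cut_def by blast
    then show ?thesis
    proof cases
      case 3 then show ?thesis using PT[OF 3(1)] tl[OF 3(1)] by linarith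
    qed auto
  qed
  have inner: "u = tl \<beta>" if \<beta>: "\<beta> \<in> P" and u: "u \<in> Cut" "\<beta> - 1 < u" "u < piece_end' \<beta>" for u \<beta>
  proof -
    consider "u = 0" | "u = T" | \<gamma> where "\<gamma> \<in> P" "u = \<gamma> - 1 \<or> u = tl \<gamma> \<or> u = piece_end' \<gamma>" using u(1) unfolding Cut_def by blast
    then show ?thesis
    proof cases
      case 3
      show ?thesis
      proof (cases \<gamma> \<beta> rule: linorder_cases)
        case less
        then show ?thesis using Pdis[OF 3(1) \<beta>] PT[OF 3(1)] tl[OF 3(1)] 3 u by linarith
      next
        case equal then show ?thesis using 3 u by auto
      next
        case greater
        then show ?thesis using Pdis[OF \<beta> 3(1)] PT[OF 3(1)] PT[OF \<beta>] tl[OF 3(1)] 3 u by linarith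
      qed
    qed (use u PT[OF \<beta>] in auto)
  qed
  have step: "\<exists>c\<le>sum \<phi> {s<..t}. seg E S (12 * a) w s t c"
    if s: "s \<in> Cut" and t: "t \<in> Cut" and st: "s < t" and gap: "\<And>u. u \<in> Cut \<Longrightarrow> u \<le> s \<or> t \<le> u" for s t
  proof (cases "\<exists>\<beta>\<in>P. \<beta> - 1 \<le> s \<and> t \<le> piece_end' \<beta>")
    case True
    then obtain \<beta> where \<beta>: "\<beta> \<in> P" "\<beta> - 1 \<le> s" "t \<le> piece_end' \<beta>" by blast
    have len: "t - s \<le> 12 * a" using \<beta> PT[OF \<beta>(1)] piece_end_props(3)[of \<beta>] by linarith
    show ?thesis
    proof (cases "tl \<beta> \<le> s")
      case True
      let ?c = "card {u. s < u \<and> u \<le> t \<and> new u}"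
      have eq: "{u \<in> {s<..t}. new u \<and> \<not> in_short_run u} = {u. s < u \<and> u \<le> t \<and> new u}"
        using nsh[OF \<beta>(1)] True \<beta> by auto
      have c: "?c = sum \<phi> {s<..t}" unfolding \<phi>_def by (subst card_new_times_Suc) (simp_all only: eq finite_greaterThanAtMost)
      have "?c \<le> card {s<..t}" by (rule card_mono) auto
      then have "?c \<le> 12 * a" using len by simp
      moreover have "near E (w ` {..s} \<union> S) ?c (w t)" using near_new_count[of s t] st CutT[OF t] by simp
      ultimately have "seg E S (12 * a) w s t ?c" unfolding seg_def using st len by simp
      then show ?thesis using c by (intro exI[of _ ?c]) simp
    next
      case False
      then have tt: "t \<le> tl \<beta>" using gap[OF mem(2)[OF \<beta>(1)]] by auto
      have ss: "s = \<beta> - 1"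
      proof (rule ccontr)
        assume "s \<noteq> \<beta> - 1"
        then have "s = tl \<beta>" using inner[OF \<beta>(1) s] \<beta> st by auto
        then show False using tt st by simp
      qed
      have "t = tl \<beta>" using inner[OF \<beta>(1) t] ss st tt tl[OF \<beta>(1)] \<beta> by (cases "t < piece_end' \<beta>") auto
      then have "w t \<in> w ` {..s} \<union> S" using tl(3)[OF \<beta>(1)] ss unfolding A_def by simp
      then have "near E (w ` {..s} \<union> S) 0 (w t)" unfolding near_def using dist_le_refl by blast
      then have "seg E S (12 * a) w s t 0" unfolding seg_def using st len by blast
      then show ?thesis by blast
    qed
  next
    case False
    have nobad: "\<not> bad u" if u: "s < u" "u \<le> t" for u
    proof
      assume b: "bad u"
      then obtain \<beta> where \<beta>: "\<beta> \<in> P" "\<beta> \<le> u" "u \<le> piece_end \<beta>" using Pcov by blast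
      have "\<beta> - 1 \<le> s" using gap[OF mem(1)[OF \<beta>(1)]] \<beta> u PT[OF \<beta>(1)] by linarith
      moreover have "u \<le> piece_end' \<beta>" using bad_D[OF b] \<beta> unfolding piece_end'_def by auto
      then have "t \<le> piece_end' \<beta>" using gap[OF mem(3)[OF \<beta>(1)]] u by linarith
      ultimately show False using False \<beta> by blast
    qed
    then have "(\<forall>u. s < u \<and> u \<le> t \<longrightarrow> new u) \<or> repeats w s t"
      using homogeneous[OF st CutT[OF t]] by blast
    then show ?thesis
    proof
      assume n: "\<forall>u. s < u \<and> u \<le> t \<longrightarrow> new u"
      \<comment> \<open>A short run starts with a bad time, which some piece covers. As that piece
        does not contain the whole segment, it would end inside the run, and
        \<open>piece_end\<close> is chosen to avoid this.\<close>
      have "\<not> in_short_run u" if u: "s < u" "u \<le> t" for u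
      proof
        assume "in_short_run u"
        then obtain p r where pr: "1 \<le> p" "p \<le> u" "u \<le> r" "r < T" "Suc r < p + 4 * a"
          "\<And>v. p \<le> v \<Longrightarrow> v \<le> r \<Longrightarrow> new v" "\<not> new (p - 1)" "\<not> new (Suc r)" unfolding in_short_run_def by blast
        have "bad p" unfolding bad_def using pr(6)[of p] pr by auto
        then obtain \<beta> where \<beta>: "\<beta> \<in> P" "\<beta> \<le> p" "p \<le> piece_end \<beta>" using Pcov by blast
        have "\<not> u \<le> piece_end \<beta>"
        proof
          assume "u \<le> piece_end \<beta>"
          then have "u \<le> piece_end' \<beta>" using pr unfolding piece_end'_def by auto
          then have "t \<le> piece_end' \<beta>" using gap[OF mem(3)[OF \<beta>(1)]] u by linarith
          moreover have "\<beta> - 1 \<le> s" using gap[OF mem(1)[OF \<beta>(1)]] \<beta> u pr PT[OF \<beta>(1)] by linarith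
          ultimately show False using False \<beta> by blast
        qed
        then have "piece_end \<beta> \<le> r" using pr(3) by simp
        then have "in_short_run (piece_end \<beta>)" using pr(1,4-8) \<beta>(3) by (intro in_short_runI[of p _ r])
        then show False using piece_end_props(2) by blast
      qed
      then have eq: "{u \<in> {s<..t}. new u \<and> \<not> in_short_run u} = {s<..t}" using n by auto
      have "sum \<phi> {s<..t} = t - s"
        unfolding \<phi>_def by (subst card_new_times_Suc) (simp_all only: eq finite_greaterThanAtMost card_greaterThanAtMost)
      then show ?thesis unfolding seg_def using st by auto
    next
      assume "repeats w s t"
      then have "seg E S (12 * a) w s t 0" unfolding seg_def using st by blast
      then show ?thesis by blast
    qed
  qed
  have TT: "\<exists>B\<le>sum \<phi> {0<..T}. segs E S (12 * a) w T (card (Cut \<inter> {0<..T})) B"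
    by (rule segs_cuts[OF finC 0 step TC])
  have "Cut \<inter> {0<..T} \<subseteq> {T} \<union> (\<lambda>\<beta>. \<beta> - 1) ` P \<union> tl ` P \<union> piece_end' ` P" unfolding Cut_def by auto
  then have "card (Cut \<inter> {0<..T}) \<le> card ({T} \<union> (\<lambda>\<beta>. \<beta> - 1) ` P \<union> tl ` P \<union> piece_end' ` P)"
    by (intro card_mono) (use finP in auto)
  also have "\<dots> \<le> card {T} + card ((\<lambda>\<beta>. \<beta> - 1) ` P) + card (tl ` P) + card (piece_end' ` P)"
    by (rule card_Un4_le)
  also have "\<dots> \<le> 3 * card P + 1"
    using card_image_le[OF finP, of "\<lambda>\<beta>. \<beta> - 1"] card_image_le[OF finP, of tl] card_image_le[OF finP, of piece_end'] by simp
  finally have q: "card (Cut \<inter> {0<..T}) \<le> 3 * card P + 1" .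
  have "sum \<phi> {0<..T} = card {u \<in> {0<..T}. new u \<and> \<not> in_short_run u}" unfolding \<phi>_def by (rule card_new_times_Suc) simp
  also have "{u \<in> {0<..T}. new u \<and> \<not> in_short_run u} = {t \<in> new_times. \<not> in_short_run t}" unfolding new_times_def by auto
  finally have eq: "sum \<phi> {0<..T} = card {t \<in> new_times. \<not> in_short_run t}" .
  obtain B where "B \<le> sum \<phi> {0<..T}" "segs E S (12 * a) w T (card (Cut \<inter> {0<..T})) B" using TT by blast
  then show ?thesis using q unfolding eq by (intro exI conjI)
qed

section \<open>Traversals of an edge\<close>

definition step_edge :: "nat \<Rightarrow> nat set" where "step_edge t = {w (t - 1), w t}"
definition odd_edges :: "edge set" where "odd_edges = {e. odd (card {t \<in> {1..T}. step_edge t = e})}"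
text \<open>
  A new time \<open>k\<close> first traverses its edge.  If the edge is traversed an even number of times, some
  later time \<open>partner k\<close> traverses it again; \<open>first_traversal\<close> inverts \<open>partner\<close>.  The times in
  \<open>excess_times\<close> are the remaining ones, so that there are about \<open>T / 2\<close> new times unless \<open>excess_times\<close> is large.
\<close>

definition repeated_new :: "nat set" where "repeated_new = {k \<in> new_times. \<exists>t. k < t \<and> t \<le> T \<and> step_edge t = step_edge k}"
definition partner :: "nat \<Rightarrow> nat" where "partner k = (SOME t. k < t \<and> t \<le> T \<and> step_edge t = step_edge k)"
definition partner_times :: "nat set" where "partner_times = partner ` repeated_new"
definition excess_times :: "nat set" where "excess_times = {1..T} - new_times - partner_times"
definition first_traversal :: "nat \<Rightarrow> nat" where "first_traversal t = (SOME k. k \<in> repeated_new \<and> partner k = t)"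

lemma new_times_D: "k \<in> new_times \<Longrightarrow> 1 \<le> k \<and> k \<le> T \<and> new k" unfolding new_times_def by simp

lemma step_edge_neq: "k \<in> new_times \<Longrightarrow> k' \<in> new_times \<Longrightarrow> k < k' \<Longrightarrow> step_edge k \<noteq> step_edge k'"
proof
  assume k: "k \<in> new_times" "k' \<in> new_times" "k < k'" "step_edge k = step_edge k'"
  then have "w k' = w (k - 1) \<or> w k' = w k" unfolding step_edge_def by blast
  then show False using new_first[of k' "k - 1"] new_first[of k' k] new_times_D[OF k(2)] new_times_D[OF k(1)] k(3) by auto
qed

lemma step_edge_inj: "k \<in> new_times \<Longrightarrow> k' \<in> new_times \<Longrightarrow> step_edge k = step_edge k' \<Longrightarrow> k = k'"
  using step_edge_neq[of k k'] step_edge_neq[of k' k] by (cases k k' rule: linorder_cases) simp_all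

lemma step_edge_first: "k \<in> new_times \<Longrightarrow> t < k \<Longrightarrow> step_edge t \<noteq> step_edge k"
proof
  assume k: "k \<in> new_times" and t: "t < k" "step_edge t = step_edge k"
  have "w k = w (t - 1) \<or> w k = w t" using t(2) unfolding step_edge_def by blast
  then show False using new_first[of k t] new_first[of k "t - 1"] new_times_D[OF k] t(1) by auto
qed

lemma partner: "k \<in> repeated_new \<Longrightarrow> k < partner k \<and> partner k \<le> T \<and> step_edge (partner k) = step_edge k"
proof -
  assume "k \<in> repeated_new"
  then have "\<exists>t. k < t \<and> t \<le> T \<and> step_edge t = step_edge k" unfolding repeated_new_def by simp
  then show ?thesis unfolding partner_def by (rule someI_ex)
qed

lemma partner_inj: "inj_on partner repeated_new"
proof (rule inj_onI)
  fix x y assume xy: "x \<in> repeated_new" "y \<in> repeated_new" "partner x = partner y"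
  then have "step_edge x = step_edge y" using partner[OF xy(1)] partner[OF xy(2)] by simp
  moreover have "x \<in> new_times" "y \<in> new_times" using xy unfolding repeated_new_def by simp_all
  ultimately show "x = y" using step_edge_inj by simp
qed

lemma finite_repeated_new [simp]: "finite repeated_new" unfolding repeated_new_def by simp
lemma finite_partner_times [simp]: "finite partner_times" unfolding partner_times_def by simp
lemma finite_excess_times [simp]: "finite excess_times" unfolding excess_times_def by simp
lemma repeated_new_new_times: "k \<in> repeated_new \<Longrightarrow> k \<in> new_times" unfolding repeated_new_def by simp

lemma first_traversal: "t \<in> partner_times \<Longrightarrow> first_traversal t \<in> new_times \<and> first_traversal t < t \<and> t \<le> T \<and> step_edge t = step_edge (first_traversal t)"
proof -
  assume "t \<in> partner_times"
  then have "\<exists>k. k \<in> repeated_new \<and> partner k = t" unfolding partner_times_def by auto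
  then have "first_traversal t \<in> repeated_new \<and> partner (first_traversal t) = t" unfolding first_traversal_def by (rule someI_ex)
  then show ?thesis using partner[of "first_traversal t"] repeated_new_new_times[of "first_traversal t"] by auto
qed

lemma partner_times_range: "t \<in> partner_times \<Longrightarrow> 1 \<le> t \<and> t \<le> T"
  using first_traversal[of t] by linarith

lemma first_traversal_inj: "inj_on first_traversal partner_times" 
proof (rule inj_onI)
  fix s t assume "s \<in> partner_times" "t \<in> partner_times" "first_traversal s = first_traversal t"
  moreover have "partner (first_traversal t) = t" if t: "t \<in> partner_times" for t
  proof -
    have "first_traversal t \<in> repeated_new \<and> partner (first_traversal t) = t" unfolding first_traversal_def by (rule someI_ex) (use t in \<open>auto simp: partner_times_def\<close>)
    then show ?thesis by simp
  qed
  ultimately show "s = t" by metis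
qed

lemma partner_times_not_new_times: "t \<in> partner_times \<Longrightarrow> t \<notin> new_times"
proof
  assume "t \<in> partner_times" "t \<in> new_times"
  then show False using first_traversal[of t] step_edge_inj[of t "first_traversal t"] by auto
qed

lemma finite_odd_edges: "finite odd_edges"
proof -
  have "odd_edges \<subseteq> step_edge ` {1..T}"
  proof
    fix e assume "e \<in> odd_edges"
    then have "odd (card {t \<in> {1..T}. step_edge t = e})" unfolding odd_edges_def by simp
    then have "{t \<in> {1..T}. step_edge t = e} \<noteq> {}" by (metis card.empty even_zero)
    then show "e \<in> step_edge ` {1..T}" by auto
  qed
  then show ?thesis using finite_subset by blast
qed

text \<open>The edges of distinct new times are distinct. A new time without a partner has an edge
  traversed exactly once, hence an odd edge; every other new time occupies a second time through its
  partner.\<close>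

lemma card_excess_times: "card excess_times + 2 * card new_times \<le> T + card odd_edges"
proof -
  have "card (new_times - repeated_new) \<le> card odd_edges"
  proof (rule card_inj_on_le[of step_edge])
    show "inj_on step_edge (new_times - repeated_new)" by (rule inj_onI) (use step_edge_inj in blast)
    show "step_edge ` (new_times - repeated_new) \<subseteq> odd_edges"
    proof
      fix e assume "e \<in> step_edge ` (new_times - repeated_new)"
      then obtain k where k: "k \<in> new_times" "k \<notin> repeated_new" "e = step_edge k" by auto
      have "{t \<in> {1..T}. step_edge t = e} = {k}"
      proof
        show "{t \<in> {1..T}. step_edge t = e} \<subseteq> {k}"
        proof
          fix t assume "t \<in> {t \<in> {1..T}. step_edge t = e}"
          then have t: "t \<le> T" "step_edge t = step_edge k" using k by auto
          then have "\<not> k < t" using k unfolding repeated_new_def by auto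
          moreover have "\<not> t < k" using step_edge_first[OF k(1)] t by blast
          ultimately show "t \<in> {k}" by simp
        qed
        show "{k} \<subseteq> {t \<in> {1..T}. step_edge t = e}" using k new_times_D by auto
      qed
      then show "e \<in> odd_edges" unfolding odd_edges_def by simp
    qed
  qed (rule finite_odd_edges)
  moreover have "card (new_times - repeated_new) = card new_times - card repeated_new" by (rule card_Diff_subset) (auto simp: repeated_new_new_times)
  moreover have "card partner_times = card repeated_new" unfolding partner_times_def by (rule card_image[OF partner_inj])
  moreover have "card excess_times = T - card new_times - card partner_times"
  proof -
    have "excess_times = {1..T} - (new_times \<union> partner_times)" unfolding excess_times_def by auto
    moreover have "new_times \<union> partner_times \<subseteq> {1..T}" using partner_times_range new_times_D by auto
    moreover have "card (new_times \<union> partner_times) = card new_times + card partner_times" by (rule card_Un_disjoint) (use partner_times_not_new_times in auto)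
    ultimately show ?thesis by (simp add: card_Diff_subset)
  qed
  moreover have "card new_times + card partner_times \<le> T"
  proof -
    have "card (new_times \<union> partner_times) \<le> card {1..T}" by (rule card_mono) (use partner_times_range new_times_D in auto)
    moreover have "card (new_times \<union> partner_times) = card new_times + card partner_times" by (rule card_Un_disjoint) (use partner_times_not_new_times in auto)
    ultimately show ?thesis by simp
  qed
  moreover have "card repeated_new \<le> card new_times" by (rule card_mono) (auto simp: repeated_new_new_times)
  ultimately show ?thesis by linarith
qed

lemma rich_D: "rich x \<Longrightarrow> 4 * a \<le> x \<and> x \<le> T \<and> new x \<and> x \<in> new_times"
  unfolding rich_def new_times_def using a by auto

lemma good_finite: "finite {x. good x}"
  by (rule finite_subset[of _ "{..T}"]) (auto simp: good_def rich_def)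

section \<open>The cost of a segmentation\<close>

definition separated :: "nat set \<Rightarrow> bool" where "separated G \<longleftrightarrow> (\<forall>x\<in>G. \<forall>y\<in>G. x < y \<longrightarrow> x + 4 * a \<le> y)"

text \<open>A largest separated set leaves no good time at distance \<open>4 * a\<close> from it,
  otherwise it could be enlarged. Its size is also compared with that of
  \<open>long_run_ends\<close>, which is separated and good.\<close>

lemma max_separated:
  "\<exists>G. finite G \<and> (\<forall>x\<in>G. good x) \<and> separated G \<and> (\<forall>x. good x \<longrightarrow> (\<exists>y\<in>G. x < y + 4 * a \<and> y < x + 4 * a)) \<and>
    (\<forall>H. (\<forall>x\<in>H. good x) \<and> separated H \<longrightarrow> card H \<le> card G)"
proof -
  let ?P = "\<lambda>G. (\<forall>x\<in>G. good x) \<and> separated G"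
  have "card G \<le> card {x. good x}" if "?P G" for G
    by (rule card_mono[OF good_finite]) (use that in auto)
  then have "\<forall>G. ?P G \<longrightarrow> card G < Suc (card {x. good x})" by (simp add: less_Suc_eq_le)
  moreover have "?P {}" unfolding separated_def by simp
  ultimately obtain G where G: "?P G" "\<And>H. ?P H \<Longrightarrow> card H \<le> card G"
    using ex_has_greatest_nat[of ?P "{}" card "Suc (card {x. good x})"] by auto
  have fG: "finite G" using G(1) by (intro finite_subset[OF _ good_finite]) auto
  have "\<exists>y\<in>G. x < y + 4 * a \<and> y < x + 4 * a" if x: "good x" for x
  proof (rule ccontr)
    assume c: "\<not> ?thesis"
    then have "x \<notin> G" using a by auto
    have "?P (insert x G)" using G(1) c x unfolding separated_def by (auto simp: not_less)
    then have "card (insert x G) \<le> card G" by (rule G(2))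
    then show False using \<open>x \<notin> G\<close> fG by simp
  qed
  then show ?thesis using G fG by (intro exI[of _ G]) auto
qed

text \<open>
  Each piece of a segmentation contributes \<open>4 * a\<close> times to \<open>before_bad\<close>.  These are charged to good times,
  to short runs of new times and to \<open>excess_times\<close>, which bounds the number of pieces by the savings.
\<close>

definition long_run_ends :: "nat set" where "long_run_ends = {r. rich r \<and> r < T \<and> \<not> new (Suc r)}"
definition run_starts :: "nat set" where "run_starts = {x. rich x \<and> \<not> rich (x - 1)}"
definition poor_new :: "nat set" where "poor_new = {t \<in> new_times. \<not> rich t}"
definition before_bad :: "nat set" where
  "before_bad = {t. 1 \<le> t \<and> t \<le> T \<and> (\<exists>\<beta>. bad \<beta> \<and> t < \<beta> \<and> \<beta> \<le> t + 4 * a \<and> \<beta> + a \<le> T)}"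
definition next_bad :: "nat \<Rightarrow> nat" where "next_bad t = (LEAST \<beta>. bad \<beta> \<and> t < \<beta>)"
text \<open>The position, in terms of first visits, at which the walk stands immediately before the
  next bad time; for a walk that retraces a strand this is where it leaves the strand.\<close>

definition \<theta> :: "nat \<Rightarrow> nat" where "\<theta> t = first_visit (w (next_bad t - 1))"

lemma finite_rich: "finite {x. rich x}"
  by (rule finite_subset[of _ "{..T}"]) (auto simp: rich_def)
lemma finite_long_run_ends [simp]: "finite long_run_ends"
  by (rule finite_subset[OF _ finite_rich]) (auto simp: long_run_ends_def)
lemma finite_run_starts [simp]: "finite run_starts"
  by (rule finite_subset[OF _ finite_rich]) (auto simp: run_starts_def)
lemma finite_poor_new [simp]: "finite poor_new" unfolding poor_new_def by simp
lemma finite_before_bad [simp]: "finite before_bad"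
  by (rule finite_subset[of _ "{..T}"]) (auto simp: before_bad_def)

lemma run_end:
  assumes "new t" "t \<le> T"
  obtains r where "t \<le> r" "r \<le> T" "\<And>u. t \<le> u \<Longrightarrow> u \<le> r \<Longrightarrow> new u" "r = T \<or> r < T \<and> \<not> new (Suc r)"
proof -
  define r where "r = (LEAST r. t \<le> r \<and> (r = T \<or> \<not> new (Suc r)))"
  have r: "t \<le> r \<and> (r = T \<or> \<not> new (Suc r))" unfolding r_def by (rule LeastI[of _ T]) (use assms in simp)
  have le: "r \<le> s" if "t \<le> s" "s = T \<or> \<not> new (Suc s)" for s unfolding r_def by (rule Least_le) (use that in simp)
  have rT: "r \<le> T" using le[of T] assms by simp
  have "new (t + i)" if "t + i \<le> r" for i
    using that
  proof (induction i)
    case (Suc i)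
    then show ?case using le[of "t + i"] by auto
  qed (use assms in simp)
  then have "new u" if "t \<le> u" "u \<le> r" for u using that by (metis le_add_diff_inverse)
  moreover have "r = T \<or> r < T \<and> \<not> new (Suc r)" using r rT by linarith
  ultimately show ?thesis using that[of r] r rT by simp
qed

lemma run_start:
  assumes "new t"
  obtains "\<And>u. 1 \<le> u \<Longrightarrow> u \<le> t \<Longrightarrow> new u" | p where "2 \<le> p" "p \<le> t" "\<And>u. p \<le> u \<Longrightarrow> u \<le> t \<Longrightarrow> new u" "\<not> new (p - 1)"
proof (cases "\<forall>u. 1 \<le> u \<and> u \<le> t \<longrightarrow> new u")
  case False
  define q where "q = Max {u. 1 \<le> u \<and> u \<le> t \<and> \<not> new u}"
  have fin: "finite {u. 1 \<le> u \<and> u \<le> t \<and> \<not> new u}" by (rule finite_subset[of _ "{..t}"]) auto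
  have "q \<in> {u. 1 \<le> u \<and> u \<le> t \<and> \<not> new u}" unfolding q_def by (rule Max_in[OF fin]) (use False in auto)
  then have q: "1 \<le> q" "q \<le> t" "\<not> new q" by auto
  have qm: "new u" if "q < u" "u \<le> t" for u
  proof (rule ccontr)
    assume "\<not> new u"
    then have "u \<le> q" unfolding q_def using that q by (intro Max_ge[OF fin]) auto
    then show False using that by simp
  qed
  have "q \<noteq> t" using q assms by auto
  then show ?thesis using that(2)[of "Suc q"] q qm by auto
qed (use that in blast)

lemma rich_stretch: "rich x \<Longrightarrow> x \<le> r \<Longrightarrow> r \<le> T \<Longrightarrow> (\<And>u. x \<le> u \<Longrightarrow> u \<le> r \<Longrightarrow> new u) \<Longrightarrow> rich r"
proof -
  assume x: "rich x" and r: "x \<le> r" "r \<le> T" and n: "\<And>u. x \<le> u \<Longrightarrow> u \<le> r \<Longrightarrow> new u"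
  have "new u" if u: "r - 4 * a < u" "u \<le> r" for u
  proof (cases "x \<le> u")
    case False
    then have "x - 4 * a < u" "u \<le> x" using u r by auto
    then show ?thesis using x unfolding rich_def by simp
  qed (use n u in simp)
  then show "rich r" using x r unfolding rich_def by simp
qed

text \<open>By \<open>arrival\<close> the vertex after a long run lies in \<open>S\<close> or was
  already visited \<open>4 * a\<close> steps before the end of the run, and it is only one edge
  away.\<close>

lemma long_run_ends_good: "r \<in> long_run_ends \<Longrightarrow> good r"
proof -
  assume r: "r \<in> long_run_ends"
  then have rr: "rich r" "r < T" "\<not> new (Suc r)" unfolding long_run_ends_def by auto
  have d: "dist_le E (3 * a) (w (Suc r)) (w r)"
    by (rule dist_le_mono[of _ 1]) (use walk_edge[OF rr(2)] a in \<open>auto simp: insert_commute intro: dist_le_edge[unfolded One_nat_def]\<close>)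
  have "w (Suc r) \<in> S \<or> first_visit (w (Suc r)) + 10 * a \<le> r"
    using arrival[of r] rr rich_D[OF rr(1)] by auto
  then have "w (Suc r) \<in> w ` {..r - 4 * a} \<union> S"
  proof
    assume "first_visit (w (Suc r)) + 10 * a \<le> r"
    then have "first_visit (w (Suc r)) \<in> {..r - 4 * a}" by auto
    then show ?thesis using w_first_visit by (metis UnI1 image_eqI)
  qed simp
  then show "good r" unfolding good_def near_def using rr d by blast
qed

lemma long_run_ends_separated: "separated long_run_ends"
  unfolding separated_def
proof (intro ballI impI)
  fix x y assume xy: "x \<in> long_run_ends" "y \<in> long_run_ends" "x < y"
  show "x + 4 * a \<le> y"
  proof (rule ccontr)
    assume "\<not> ?thesis"
    then have "y - 4 * a < Suc x" "Suc x \<le> y" using xy by auto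
    then have "new (Suc x)" using xy(2) unfolding long_run_ends_def rich_def by blast
    then show False using xy(1) unfolding long_run_ends_def by blast
  qed
qed

text \<open>Send a start to the end of its run. Richness persists within a run, so different starts
  have different ends, and at most one run lasts until \<open>T\<close> instead of ending in
  \<open>long_run_ends\<close>.\<close>

lemma card_run_starts: "card run_starts \<le> card long_run_ends + 1"
proof -
  define f where "f x = (SOME r. x \<le> r \<and> r \<le> T \<and> (\<forall>u. x \<le> u \<and> u \<le> r \<longrightarrow> new u) \<and> (r = T \<or> r < T \<and> \<not> new (Suc r)))" for x
  have f: "x \<le> f x \<and> f x \<le> T \<and> (\<forall>u. x \<le> u \<and> u \<le> f x \<longrightarrow> new u) \<and> (f x = T \<or> f x < T \<and> \<not> new (Suc (f x)))" if "rich x" for x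
  proof -
    have "new x" "x \<le> T" using rich_D[OF that] by auto
    from run_end[OF this] obtain r where "x \<le> r" "r \<le> T" "\<And>u. x \<le> u \<Longrightarrow> u \<le> r \<Longrightarrow> new u" "r = T \<or> r < T \<and> \<not> new (Suc r)"
      by blast
    then have "\<exists>r. x \<le> r \<and> r \<le> T \<and> (\<forall>u. x \<le> u \<and> u \<le> r \<longrightarrow> new u) \<and> (r = T \<or> r < T \<and> \<not> new (Suc r))"
      by (intro exI[of _ r]) simp
    then show ?thesis unfolding f_def by (rule someI_ex)
  qed
  have "card run_starts \<le> card (insert T long_run_ends)"
  proof (rule card_inj_on_le[of f])
    show "inj_on f run_starts"
    proof (rule linorder_inj_onI)
      fix x y assume xy: "x < y" "x \<in> run_starts" "y \<in> run_starts"
      have rx: "rich x" and ny: "\<not> rich (y - 1)" "rich y" using xy unfolding run_starts_def by auto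
      have "\<not> y \<le> f x"
      proof
        assume y: "y \<le> f x"
        have "rich (y - 1)" by (rule rich_stretch[OF rx]) (use y xy f[OF rx] in auto)
        then show False using ny by simp
      qed
      then show "f x \<noteq> f y" using f[OF ny(2)] by auto
    qed auto
    show "f ` run_starts \<subseteq> insert T long_run_ends"
    proof
      fix r assume "r \<in> f ` run_starts"
      then obtain x where x: "rich x" "r = f x" unfolding run_starts_def by auto
      have "rich r" by (rule rich_stretch[OF x(1)]) (use f[OF x(1)] x(2) in auto)
      then show "r \<in> insert T long_run_ends" unfolding long_run_ends_def using f[OF x(1)] x(2) by auto
    qed
  qed simp
  then show ?thesis by (simp add: card_insert_if split: if_splits)
qed

text \<open>The cases near 0 and near \<open>T\<close> come from runs that touch an end of the walk.
  A run strictly inside is short, or it becomes rich at \<open>x = p + 4 * a - 1\<close>, where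
  \<open>p\<close> is its start, and stays rich until it ends.\<close>

lemma short_run_cases:
  assumes "new t" "1 \<le> t" "t \<le> T" "t \<le> r" "r \<le> T" "\<forall>u. t \<le> u \<and> u \<le> r \<longrightarrow> new u"
    "r = T \<or> \<not> new (Suc r)"
  shows "t \<le> 4 * a \<or> in_short_run t \<or> T < t + 4 * a \<or> rich r \<and> (\<exists>x\<in>run_starts. x \<le> r \<and> (\<forall>u. x \<le> u \<and> u \<le> r \<longrightarrow> rich u) \<and> (x \<le> t \<or> t < x \<and> x < t + 4 * a)) \<or> 
     rich t"
  using assms(1)
proof (cases rule: run_start)
  case 1
  show ?thesis
  proof (cases "4 * a \<le> t")
    case True
    have "rich t" unfolding rich_def using True 1 assms(3) by auto
    then show ?thesis by blast
  qed auto
next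
  case (2 p)
  have nw: "new u" if "p \<le> u" "u \<le> r" for u using 2(3)[of u] assms(6) that by (cases "u \<le> t") auto
  show ?thesis
  proof (cases "Suc r < p + 4 * a")
    case True
    show ?thesis
    proof (cases "r = T")
      case True
      then show ?thesis using \<open>Suc r < p + 4 * a\<close> 2 by auto
    next
      case False
      then have "in_short_run t" unfolding in_short_run_def using 2 True assms nw by (intro exI[of _ p] exI[of _ r]) auto
      then show ?thesis by blast
    qed
  next
    case False
    define x where "x = p + 4 * a - 1"
    have xr: "x \<le> r" "4 * a \<le> x" "x - 4 * a = p - 1" using False 2 unfolding x_def by auto
    have rx: "rich u" if "x \<le> u" "u \<le> r" for u
      unfolding rich_def using xr that nw assms(5) by auto
    have "\<not> rich (x - 1)"
    proof
      assume rr: "rich (x - 1)"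
      have "x - 1 - 4 * a < p - 1 \<and> p - 1 \<le> x - 1" using rich_D[OF rr] xr 2 a by auto
      then have "new (p - 1)" using rr unfolding rich_def by blast
      then show False using 2 by simp
    qed
    then have "x \<in> run_starts" unfolding run_starts_def using rx xr by auto
    moreover have "x \<le> t \<or> t < x \<and> x < t + 4 * a" using 2 unfolding x_def by auto
    ultimately have "\<exists>x\<in>run_starts. x \<le> r \<and> (\<forall>u. x \<le> u \<and> u \<le> r \<longrightarrow> rich u) \<and> (x \<le> t \<or> t < x \<and> x < t + 4 * a)"
      using rx xr(1) by (intro bexI[of _ x]) simp_all
    then show ?thesis using rx[of r] xr(1) by simp
  qed
qed

lemma poor_new_subset: "poor_new \<subseteq> {t \<in> new_times. in_short_run t} \<union> {1..4 * a} \<union> {T - 4 * a<..T} \<union> (\<Union>x\<in>run_starts. {x - 4 * a<..x})"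
proof
  fix t assume "t \<in> poor_new"
  then have t: "t \<in> new_times" "\<not> rich t" "1 \<le> t" "t \<le> T" "new t" unfolding poor_new_def new_times_def by auto
  obtain r where r: "t \<le> r" "r \<le> T" "\<And>u. t \<le> u \<Longrightarrow> u \<le> r \<Longrightarrow> new u" "r = T \<or> r < T \<and> \<not> new (Suc r)"
    using run_end[OF t(5,4)] by blast
  have "t \<le> 4 * a \<or> in_short_run t \<or> T < t + 4 * a \<or> (\<exists>x\<in>run_starts. t < x \<and> x < t + 4 * a)"
  proof -
    have r4: "r = T \<or> \<not> new (Suc r)" using r(4) by blast
    have r3: "\<forall>u. t \<le> u \<and> u \<le> r \<longrightarrow> new u" using r(3) by simp
    from short_run_cases[OF t(5,3,4) r(1,2) r3 r4] show ?thesis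
    proof (elim disjE)
      assume "rich r \<and> (\<exists>x\<in>run_starts. x \<le> r \<and> (\<forall>u. x \<le> u \<and> u \<le> r \<longrightarrow> rich u) \<and> (x \<le> t \<or> t < x \<and> x < t + 4 * a))"
      then obtain x where x: "x \<in> run_starts" "\<forall>u. x \<le> u \<and> u \<le> r \<longrightarrow> rich u" "x \<le> t \<or> t < x \<and> x < t + 4 * a" by blast
      then have "t < x \<and> x < t + 4 * a" using t(2) r(1) by blast
      then show ?thesis using x(1) by blast
    qed (use t(2) in simp_all)
  qed
  then show "t \<in> {t \<in> new_times. in_short_run t} \<union> {1..4 * a} \<union> {T - 4 * a<..T} \<union> (\<Union>x\<in>run_starts. {x - 4 * a<..x})"
  proof (elim disjE)
    assume "T < t + 4 * a"
    then have "t \<in> {T - 4 * a<..T}" using t by auto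
    then show ?thesis by blast
  next
    assume "\<exists>x\<in>run_starts. t < x \<and> x < t + 4 * a"
    then obtain x where x: "x \<in> run_starts" "t < x" "x < t + 4 * a" by blast
    moreover have "4 * a \<le> x" using x(1) rich_D unfolding run_starts_def by simp
    ultimately have "t \<in> {x - 4 * a<..x}" by auto
    then show ?thesis using x(1) by blast
  qed (use t in auto)
qed

lemma card_poor_new: "card poor_new \<le> card {t \<in> new_times. in_short_run t} + 8 * a + card run_starts * (4 * a)"
proof -
  have "card poor_new \<le> card ({t \<in> new_times. in_short_run t} \<union> {1..4 * a} \<union> {T - 4 * a<..T} \<union> (\<Union>x\<in>run_starts. {x - 4 * a<..x}))"
    by (rule card_mono[OF _ poor_new_subset]) simp
  also have "\<dots> \<le> card {t \<in> new_times. in_short_run t} + card {1..4 * a} + card {T - 4 * a<..T} + card (\<Union>x\<in>run_starts. {x - 4 * a<..x})"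
    by (rule card_Un4_le)
  finally have "card poor_new \<le> card {t \<in> new_times. in_short_run t} + card {1..4 * a} + card {T - 4 * a<..T} + card (\<Union>x\<in>run_starts. {x - 4 * a<..x})" .
  moreover have "card (\<Union>x\<in>run_starts. {x - 4 * a<..x}) \<le> card run_starts * (4 * a)"
    by (rule card_UN_bound) auto
  moreover have "card {T - 4 * a<..T} \<le> 4 * a" "card {1..4 * a} \<le> 4 * a" by simp_all
  ultimately show ?thesis by linarith
qed

text \<open>Pieces start at least \<open>4 * a\<close> apart, so the \<open>4 * a\<close> times
  before their starts are disjoint. The first and the last piece are omitted: one may begin too
  close to 0, the other too close to \<open>T\<close>.\<close>

lemma card_before_bad:
  assumes P: "pieces P"
  shows "4 * a * (card P - 2) \<le> card before_bad"
proof (cases "card P \<le> 2")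
  case False
  have finP: "finite P" and Pbad: "\<And>\<beta>. \<beta> \<in> P \<Longrightarrow> bad \<beta>"
    and Pdis: "\<And>\<beta> \<gamma>. \<beta> \<in> P \<Longrightarrow> \<gamma> \<in> P \<Longrightarrow> \<beta> < \<gamma> \<Longrightarrow> piece_end \<beta> < \<gamma>"
    using P unfolding pieces_def by blast+
  have ne: "P \<noteq> {}" using False by auto
  have gap: "\<beta> + 4 * a \<le> \<gamma>" if "\<beta> \<in> P" "\<gamma> \<in> P" "\<beta> < \<gamma>" for \<beta> \<gamma>
    using Pdis[OF that] piece_end_props(1)[of \<beta>] bad_D[OF Pbad[OF that(1)]] by linarith
  define P' where "P' = P - {Min P, Max P}"
  have mm: "Min P \<in> P" "Max P \<in> P" "\<And>x. x \<in> P \<Longrightarrow> Min P \<le> x" "\<And>x. x \<in> P \<Longrightarrow> x \<le> Max P"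
    using finP ne by simp_all
  have "card P - 2 \<le> card P - card {Min P, Max P}"
    using card_insert_le_m1[of 2 "{Max P}" "Min P"] by (simp add: card_insert_if)
  also have "\<dots> \<le> card P'" unfolding P'_def by (rule diff_card_le_card_Diff) simp
  finally have cP': "card P - 2 \<le> card P'" .
  have sub: "{\<beta> - 4 * a..<\<beta>} \<subseteq> before_bad" "4 * a \<le> \<beta>" if \<beta>: "\<beta> \<in> P'" for \<beta>
  proof -
    have b: "\<beta> \<in> P" "\<beta> \<noteq> Min P" "\<beta> \<noteq> Max P" using \<beta> unfolding P'_def by auto
    have "Min P < \<beta>" "\<beta> < Max P" using mm(3)[OF b(1)] mm(4)[OF b(1)] b by auto
    then have g: "Min P + 4 * a \<le> \<beta>" "\<beta> + 4 * a \<le> Max P" using gap mm b by auto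
    have "1 \<le> Min P" "Max P \<le> T" "bad \<beta>" using bad_D Pbad mm b by auto
    then show "{\<beta> - 4 * a..<\<beta>} \<subseteq> before_bad" unfolding before_bad_def using g by (auto intro!: exI[of _ \<beta>])
    show "4 * a \<le> \<beta>" using g by simp
  qed
  have disj: "disjoint_family_on (\<lambda>\<beta>. {\<beta> - 4 * a..<\<beta>}) P'"
    unfolding disjoint_family_on_def
  proof (intro ballI impI)
    fix x y assume xy: "x \<in> P'" "y \<in> P'" "x \<noteq> y"
    then have xyP: "x \<in> P" "y \<in> P" unfolding P'_def by auto
    show "{x - 4 * a..<x} \<inter> {y - 4 * a..<y} = {}"
    proof (cases x y rule: linorder_cases)
      case less
      then have "x + 4 * a \<le> y" using gap xyP by blast
      then show ?thesis by auto
    next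
      case greater
      then have "y + 4 * a \<le> x" using gap xyP by blast
      then show ?thesis by auto
    qed (use xy in simp)
  qed
  have finP': "finite P'" using finP unfolding P'_def by simp
  have "card (\<Union>\<beta>\<in>P'. {\<beta> - 4 * a..<\<beta>}) = (\<Sum>\<beta>\<in>P'. card {\<beta> - 4 * a..<\<beta>})"
    by (rule card_UN_disjoint'[OF disj _ finP']) simp
  also have "\<dots> = (\<Sum>\<beta>\<in>P'. 4 * a)"
  proof (rule sum.cong)
    fix x assume "x \<in> P'"
    then have "4 * a \<le> x" by (rule sub(2))
    then show "card {x - 4 * a..<x} = 4 * a" by simp
  qed simp
  finally have "4 * a * card P' = card (\<Union>\<beta>\<in>P'. {\<beta> - 4 * a..<\<beta>})" by simp
  also have "\<dots> \<le> card before_bad" by (rule card_mono) (use sub(1) in auto)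
  finally show ?thesis using cP' by (meson le_trans mult_le_mono2)
qed simp

lemma before_bad_next_bad:
  assumes "t \<in> before_bad"
  shows "bad (next_bad t)" "t < next_bad t" "next_bad t \<le> t + 4 * a" "next_bad t + a \<le> T" "\<And>u. t < u \<Longrightarrow> u < next_bad t \<Longrightarrow> \<not> bad u"
proof -
  obtain \<beta> where \<beta>: "bad \<beta>" "t < \<beta>" "\<beta> \<le> t + 4 * a" "\<beta> + a \<le> T" using assms unfolding before_bad_def by blast
  have "bad (next_bad t) \<and> t < next_bad t" unfolding next_bad_def by (rule LeastI[of _ \<beta>]) (use \<beta> in simp)
  moreover have le: "next_bad t \<le> u" if "bad u" "t < u" for u unfolding next_bad_def by (rule Least_le) (use that in simp)
  ultimately show "bad (next_bad t)" "t < next_bad t" "next_bad t \<le> t + 4 * a" "next_bad t + a \<le> T"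
    using le[OF \<beta>(1,2)] \<beta>(3,4) by auto
  show "\<not> bad u" if "t < u" "u < next_bad t" for u using le[of u] that by auto
qed

text \<open>A bad time does not continue a run of new times, so the run containing \<open>t\<close>
  ends before \<open>next_bad t\<close>, that is, within the next \<open>4 * a\<close> steps. Such a
  run is short, touches the start of the walk, or ends in \<open>long_run_ends\<close>.\<close>

lemma before_bad_new:
  assumes t: "t \<in> before_bad" "t \<in> new_times"
  shows "t \<in> {t \<in> new_times. in_short_run t} \<union> {1..4 * a} \<union> (\<Union>r\<in>long_run_ends. {r - 4 * a<..r})"
proof -
  note n = before_bad_next_bad[OF t(1)]
  have tt: "1 \<le> t" "t \<le> T" "new t" using new_times_D[OF t(2)] by auto
  obtain r where r: "t \<le> r" "r \<le> T" "\<And>u. t \<le> u \<Longrightarrow> u \<le> r \<Longrightarrow> new u" "r = T \<or> r < T \<and> \<not> new (Suc r)"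
    using run_end[OF tt(3,2)] by blast
  have rb: "r < next_bad t"
  proof (rule ccontr)
    assume "\<not> ?thesis"
    then have "new (next_bad t)" "new (next_bad t - 1)" using r(3) n(2) by auto
    then show False using n(1) unfolding bad_def by simp
  qed
  then have rT: "r < T" "\<not> new (Suc r)" using r(4) n(4) by auto
  have inr: ?thesis if "rich r"
  proof -
    have "r \<in> long_run_ends" using that rT unfolding long_run_ends_def by simp
    moreover have "t \<in> {r - 4 * a<..r}" using r(1) rb n(3) rich_D[OF that] by auto
    ultimately show ?thesis by blast
  qed
  have r4: "r = T \<or> \<not> new (Suc r)" using rT by blast
  have r3: "\<forall>u. t \<le> u \<and> u \<le> r \<longrightarrow> new u" using r(3) by simp
  from short_run_cases[OF tt(3,1,2) r(1,2) r3 r4] show ?thesis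
  proof (elim disjE)
    assume "t \<le> 4 * a" then show ?thesis using tt by simp
  next
    assume "in_short_run t" then show ?thesis using t by simp
  next
    assume c: "T < t + 4 * a"
    show ?thesis
    proof (cases "rich r")
      case False
      from tt(3) show ?thesis
      proof (cases rule: run_start)
        case 1
        have "\<not> 4 * a \<le> r"
        proof
          assume "4 * a \<le> r"
          moreover have "new u" if "r - 4 * a < u" "u \<le> r" for u using 1[of u] r(3)[of u] that by (cases "u \<le> t") auto
          ultimately have "rich r" unfolding rich_def using r(2) by simp
          then show False using False by simp
        qed
        then show ?thesis using r(1) tt by auto
      next
        case (2 p)
        have nw: "new u" if "p \<le> u" "u \<le> r" for u using 2(3)[of u] r(3)[of u] that by (cases "u \<le> t") auto
        have "Suc r < p + 4 * a"
        proof (rule ccontr)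
          assume c: "\<not> ?thesis"
          have "new u" if "r - 4 * a < u" "u \<le> r" for u using nw[of u] c that by auto
          then have "rich r" unfolding rich_def using r(2) c 2 by auto
          then show False using False by simp
        qed
        then have "in_short_run t" by (intro in_short_runI[of p _ r]) (use 2 r rT nw in auto)
        then show ?thesis using t by simp
      qed
    qed (rule inr)
  next
    assume "rich r \<and> (\<exists>x\<in>run_starts. x \<le> r \<and> (\<forall>u. x \<le> u \<and> u \<le> r \<longrightarrow> rich u) \<and> (x \<le> t \<or> t < x \<and> x < t + 4 * a))"
    then show ?thesis using inr by blast
  next
    assume "rich t"
    then have "rich r" using rich_stretch[of t r] r by simp
    then show ?thesis by (rule inr)
  qed
qed

text \<open>Traversing the edge discovered at \<open>k = first_traversal t\<close> makes
  \<open>t\<close> a copy, because richness of \<open>k\<close> makes \<open>k - 1\<close> new as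
  well. No bad time follows before \<open>next_bad t\<close>, so \<open>copy_stretch\<close> carries
  the walk along the first visits next to \<open>k\<close> for at most \<open>4 * a\<close>
  steps.\<close>

lemma strand:
  assumes t: "t \<in> before_bad" "t \<in> partner_times" "rich (first_traversal t)"
  shows "first_traversal t \<le> \<theta> t \<and> \<theta> t \<le> first_traversal t + 4 * a \<or> \<theta> t < first_traversal t \<and> first_traversal t \<le> \<theta> t + 4 * a"
proof -
  define k where "k = first_traversal t"
  note n = before_bad_next_bad[OF t(1)]
  have k: "k \<in> new_times" "k < t" "t \<le> T" "step_edge t = step_edge k" using first_traversal[OF t(2)] unfolding k_def by auto
  have rk: "rich k" using t(3) unfolding k_def .
  have k4: "4 * a \<le> k" "new k" using rich_D[OF rk] by auto
  have "k - 4 * a < k - 1" "k - 1 \<le> k" using k4 a by auto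
  then have "new (k - 1)" using rk unfolding rich_def by blast
  then have tk: "first_visit (w k) = k" "first_visit (w (k - 1)) = k - 1" using k4 new_first_visit by auto
  have e: "w (t - 1) = w (k - 1) \<and> w t = w k \<or> w (t - 1) = w k \<and> w t = w (k - 1)"
    using k(4) unfolding step_edge_def by (auto simp: doubleton_eq_iff)
  have t1: "Suc (t - 1) = t" "1 \<le> k" using k k4 a by auto
  have cp: "copy (Suc (t - 1))" unfolding copy_def t1 using e tk k t1 by auto
  have st: "(\<forall>i\<le>next_bad t - 1 - (t - 1). first_visit (w (t - 1 + i)) = first_visit (w (t - 1)) + i) \<or>
    (next_bad t - 1 - (t - 1) \<le> first_visit (w (t - 1)) \<and> (\<forall>i\<le>next_bad t - 1 - (t - 1). first_visit (w (t - 1 + i)) = first_visit (w (t - 1)) - i))"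
    by (rule copy_stretch[OF cp]) (use n t1 in auto)
  have idx: "t - 1 + (next_bad t - 1 - (t - 1)) = next_bad t - 1" "next_bad t - 1 - (t - 1) = next_bad t - t" "1 \<le> next_bad t - t" "next_bad t - t \<le> 4 * a"
    using n t1 by auto
  from st show ?thesis
  proof
    assume u: "\<forall>i\<le>next_bad t - 1 - (t - 1). first_visit (w (t - 1 + i)) = first_visit (w (t - 1)) + i"
    have "first_visit (w t) = first_visit (w (t - 1)) + 1" using u[rule_format, of 1] idx t1 by simp
    then have "first_visit (w (t - 1)) = k - 1" using e tk t1 by auto
    moreover have "\<theta> t = first_visit (w (t - 1)) + (next_bad t - t)"
      unfolding \<theta>_def using u[rule_format, of "next_bad t - 1 - (t - 1)"] idx by simp
    ultimately show ?thesis unfolding k_def[symmetric] using idx t1 by linarith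
  next
    assume u: "next_bad t - 1 - (t - 1) \<le> first_visit (w (t - 1)) \<and> (\<forall>i\<le>next_bad t - 1 - (t - 1). first_visit (w (t - 1 + i)) = first_visit (w (t - 1)) - i)"
    have "first_visit (w t) = first_visit (w (t - 1)) - 1" using u[THEN conjunct2, rule_format, of 1] idx t1 by simp
    then have "first_visit (w (t - 1)) = k" using e tk t1 by auto
    moreover have "\<theta> t = first_visit (w (t - 1)) - (next_bad t - t)"
      unfolding \<theta>_def using u[THEN conjunct2, rule_format, of "next_bad t - 1 - (t - 1)"] idx by simp
    ultimately show ?thesis unfolding k_def[symmetric] using idx u by linarith
  qed
qed

text \<open>Between \<open>first_traversal t\<close> and the nearby \<open>\<theta> t\<close>, which
  is not rich, a run must end or become rich, according to which of the two comes first.\<close>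

lemma strand_not_rich:
  assumes t: "t \<in> before_bad" "t \<in> partner_times" "rich (first_traversal t)" "\<not> rich (\<theta> t)"
  shows "first_traversal t \<in> (\<Union>r\<in>long_run_ends. {r - 4 * a<..r}) \<union> (\<Union>x\<in>run_starts. {x..x + 4 * a})"
  using strand[OF t(1-3)]
proof
  assume c: "first_traversal t \<le> \<theta> t \<and> \<theta> t \<le> first_traversal t + 4 * a"
  have k: "new (first_traversal t)" "first_traversal t \<le> T" using rich_D[OF t(3)] by auto
  obtain r where r: "first_traversal t \<le> r" "r \<le> T" "\<And>u. first_traversal t \<le> u \<Longrightarrow> u \<le> r \<Longrightarrow> new u" "r = T \<or> r < T \<and> \<not> new (Suc r)"
    using run_end[OF k] by blast
  have th: "\<theta> t \<le> T" unfolding \<theta>_def using first_visit_le[of "next_bad t - 1"] before_bad_next_bad[OF t(1)] by linarith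
  have "\<not> \<theta> t \<le> r"
  proof
    assume "\<theta> t \<le> r"
    then have "rich (\<theta> t)" using rich_stretch[OF t(3)] c r th by simp
    then show False using t(4) by simp
  qed
  then have r1: "r < T" "\<not> new (Suc r)" using r th by auto
  have "r < first_traversal t + 4 * a" "1 \<le> first_traversal t" using \<open>\<not> \<theta> t \<le> r\<close> c rich_D[OF t(3)] a by linarith+
  then have "first_traversal t \<in> {r - 4 * a<..r}" using r(1) by auto
  note r1 this
  moreover have "rich r" using rich_stretch[OF t(3) r(1,2)] r(3) by simp
  ultimately show ?thesis unfolding long_run_ends_def by blast
next
  assume c: "\<theta> t < first_traversal t \<and> first_traversal t \<le> \<theta> t + 4 * a"
  define x where "x = (LEAST x. \<theta> t < x \<and> rich x)"
  have x: "\<theta> t < x \<and> rich x" unfolding x_def by (rule LeastI[of _ "first_traversal t"]) (use c t in simp)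
  have le: "x \<le> y" if "\<theta> t < y" "rich y" for y unfolding x_def by (rule Least_le) (use that in simp)
  have "\<not> rich (x - 1)"
  proof
    assume r: "rich (x - 1)"
    then have "x - 1 \<noteq> \<theta> t" using t(4) by auto
    then have "\<theta> t < x - 1" using x by linarith
    then show False using le[OF _ r] x by linarith
  qed
  then have "x \<in> run_starts" unfolding run_starts_def using x by simp
  moreover have "first_traversal t \<in> {x..x + 4 * a}" using le[of "first_traversal t"] c t(3) x by auto
  ultimately show ?thesis by blast
qed

text \<open>The vertices first visited at \<open>\<phi>\<close> and \<open>\<psi>\<close> are within
  \<open>a\<close> of each other. If \<open>\<phi>\<close> and \<open>\<psi>\<close> are
  \<open>4 * a\<close> apart, the later one is good by this shortcut. If they are closer, the path
  taken after leaving the strand and the part of the strand between them would close a short cycle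
  through \<open>w \<phi>\<close>, unless that path itself meets a short cycle, which makes
  \<open>\<phi>\<close> good.\<close>

lemma off_strand_path:
  assumes b: "bad \<beta>" and l: "1 \<le> l" "l \<le> a" and T: "\<beta> + a \<le> T"
    and th: "\<phi> = first_visit (w (\<beta> - 1))" "rich \<phi>" and ps: "\<psi> = first_visit (w (\<beta> - 1 + l))" "rich \<psi>"
  shows "good \<phi> \<or> good \<psi> \<and> \<phi> + 4 * a \<le> \<psi>"
proof -
  have b1: "1 \<le> \<beta>" "\<beta> \<le> T" using bad_D[OF b] by auto
  have wv: "w \<phi> = w (\<beta> - 1)" and wy: "w \<psi> = w (\<beta> - 1 + l)" unfolding th(1) ps(1) by simp_all
  have d: "dist_le E a (w \<phi>) (w \<psi>)" unfolding wv wy by (rule dist_le_w') (use l T b1 in auto)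
  have d3: "dist_le E (3 * a) (w \<phi>) (w \<psi>)" by (rule dist_le_mono[OF d]) simp
  consider "\<psi> + 4 * a \<le> \<phi>" | "\<phi> + 4 * a \<le> \<psi>" | "\<phi> < \<psi> + 4 * a" "\<psi> < \<phi> + 4 * a" by linarith
  then show ?thesis
  proof cases
    case 1
    then have "w \<psi> \<in> w ` {..\<phi> - 4 * a} \<union> S" by auto
    then have "good \<phi>" unfolding good_def near_def using th(2) dist_le_sym[OF d3] by (intro conjI bexI[of _ "w \<psi>"])
    then show ?thesis ..
  next
    case 2
    then have "w \<phi> \<in> w ` {..\<psi> - 4 * a} \<union> S" by auto
    then have "good \<psi>" unfolding good_def near_def using ps(2) d3 by (intro conjI bexI[of _ "w \<phi>"])
    then show ?thesis using 2 by simp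
  next
    case 3
    have vS: "w \<phi> \<notin> S" using rich_D[OF th(2)] new_notin by blast
    show ?thesis
    proof (cases "inj_on w {\<beta> - 1..\<beta> - 1 + l}")
      case False
      then obtain i j where ij: "i \<in> {\<beta> - 1..\<beta> - 1 + l}" "j \<in> {\<beta> - 1..\<beta> - 1 + l}" "i < j" "w i = w j"
        unfolding inj_on_def by (metis linorder_neqE_nat)
      \<comment> \<open>A repetition on the path after \<open>\<beta> - 1\<close> yields a vertex of
        \<open>S\<close> within \<open>a\<close> steps of \<open>w \<phi>\<close>.\<close>
      have "\<exists>k. i \<le> k \<and> k \<le> j \<and> w k \<in> short_cycle_verts E (10 * a)"
        by (rule nbwalk_repeat_short_cycle[OF nb loopfree ij(3) _ ij(4)]) (use ij l T b1 in auto)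
      then obtain k where k: "i \<le> k" "k \<le> j" "w k \<in> S" unfolding S_def by blast
      have "dist_le E (3 * a) (w k) (w (\<beta> - 1))" by (rule dist_le_w') (use k ij l T b1 in auto)
      then have "dist_le E (3 * a) (w k) (w \<phi>)" unfolding wv .
      then have "good \<phi>" unfolding good_def near_def using th(2) k(3) by (intro conjI bexI[of _ "w k"]) simp_all
      then show ?thesis ..
    next
      case True
      define lo where "lo = min \<phi> \<psi>"
      define hi where "hi = max \<phi> \<psi>"
      have nw: "new u" if u: "lo \<le> u" "u \<le> hi" for u
      proof (cases "\<phi> \<le> \<psi>")
        case True
        show ?thesis
        proof (cases "u = \<phi>")
          case True then show ?thesis using rich_D[OF th(2)] by simp
        next
          case False
          then have "\<psi> - 4 * a < u" "u \<le> \<psi>" using True u 3 unfolding lo_def hi_def by auto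
          then show ?thesis using ps(2) unfolding rich_def by blast
        qed
      next
        case False
        show ?thesis
        proof (cases "u = \<psi>")
          case True then show ?thesis using rich_D[OF ps(2)] by simp
        next
          case uf: False
          then have "\<phi> - 4 * a < u" "u \<le> \<phi>" using False u 3 unfolding lo_def hi_def by auto
          then show ?thesis using th(2) unfolding rich_def by blast
        qed
      qed
      define y where "y = w \<beta>"
      have bne: "\<beta> - 1 \<noteq> \<beta>" "Suc (\<beta> - 1) = \<beta>" using b1 by auto
      have phi_le: "\<phi> \<le> \<beta> - 1" unfolding th(1) by (rule first_visit_le)
      have yv: "w \<phi> \<noteq> y"
      proof -
        have "\<beta> - 1 < T" using b1 by linarith
        then show ?thesis using step_neq[of "\<beta> - 1"] bne(2) unfolding wv y_def by metis
      qed
      \<comment> \<open>If the step at \<open>\<beta>\<close> went to a neighbour on this part of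
        the strand, it would be a copy or continue a run of new times; both contradict
        \<open>bad \<beta>\<close>. Hence the edge at \<open>\<beta>\<close> is not an edge of this
        part and can serve as the bridge.\<close>
      have nadj: "w u \<noteq> y" if u: "u = \<phi> + 1 \<or> u + 1 = \<phi>" "lo \<le> u" "u \<le> hi" for u
      proof
        assume wu: "w u = y"
        have nu: "new u" by (rule nw[OF u(2,3)])
        have tu: "first_visit (w \<beta>) = u" using wu new_first_visit[OF nu] unfolding y_def by simp
        have ub: "u \<le> \<beta>" using tu first_visit_le[of \<beta>] by simp
        show False
        proof (cases "u = \<beta>")
          case True
          then have ph: "\<phi> = \<beta> - 1" using u(1) phi_le by auto
          have "new (\<beta> - 1)" using rich_D[OF th(2)] ph by simp
          moreover have "new \<beta>" using nu True by simp
          ultimately show False using b unfolding bad_def by simp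
        next
          case False
          then have "copy \<beta>" unfolding copy_def using tu ub u(1) th(1) by auto
          moreover have "\<not> new \<beta>" using tu False unfolding new_def by auto
          ultimately show False using b unfolding bad_def by simp
        qed
      qed
      let ?E = "E - {{w \<phi>, y}}"
      have off: "{w u, w (Suc u)} \<in> ?E" if u: "\<beta> \<le> u" "u < \<beta> - 1 + l" for u
      proof -
        have "w (\<beta> - 1) \<noteq> w u'" if u': "u' = u \<or> u' = Suc u" for u'
        proof
          assume eq: "w (\<beta> - 1) = w u'"
          have "\<beta> - 1 = u'" by (rule inj_onD[OF True eq]) (use u u' b1 in auto)
          then show False using u u' b1 by auto
        qed
        then have "w (\<beta> - 1) \<notin> {w u, w (Suc u)}" by blast
        then have "w \<phi> \<notin> {w u, w (Suc u)}" unfolding wv .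
        then have "{w u, w (Suc u)} \<noteq> {w \<phi>, y}" by blast
        moreover have "u < T" using u T l by linarith
        ultimately show ?thesis using walk_edge[of u] by simp
      qed
      have tphi: "first_visit (w \<phi>) = \<phi>" using rich_D[OF th(2)] new_first_visit by simp
      have str: "{w u, w (Suc u)} \<in> ?E" if u: "lo \<le> u" "u < hi" for u
      proof -
        have "{w u, w (Suc u)} \<noteq> {w \<phi>, y}"
        proof
          assume "{w u, w (Suc u)} = {w \<phi>, y}"
          then consider "w u = w \<phi>" "w (Suc u) = y" | "w u = y" "w (Suc u) = w \<phi>" by (auto simp: doubleton_eq_iff)
          then show False
          proof cases
            case 1
            have "new u" by (rule nw) (use u in simp_all)
            then have "u = \<phi>" using 1(1) tphi new_first_visit[of u] by simp
            then show False using nadj[of "Suc u"] 1(2) u by simp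
          next
            case 2
            have "new (Suc u)" by (rule nw) (use u in simp_all)
            then have "Suc u = \<phi>" using 2(2) tphi new_first_visit[of "Suc u"] by simp
            then show False using nadj[of u] 2(1) u by simp
          qed
        qed
        moreover have "u < T"
        proof -
          have "\<phi> \<le> T" "\<psi> \<le> T" using rich_D[OF th(2)] rich_D[OF ps(2)] by simp_all
          then show ?thesis using u(2) unfolding hi_def by linarith
        qed
        ultimately show ?thesis using walk_edge[of u] by simp
      qed
      have "(w \<beta>, w (\<beta> - 1 + l)) \<in> adj_rel ?E ^^ (\<beta> - 1 + l - \<beta>)"
      proof (rule path_relpow)
        show "\<beta> \<le> \<beta> - 1 + l" using l b1 by linarith
        show "{w t, w (Suc t)} \<in> ?E" if "\<beta> \<le> t" "t < \<beta> - 1 + l" for t by (rule off[OF that])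
      qed
      moreover have "\<beta> - 1 + l - \<beta> \<le> l - 1" using b1 l by linarith
      ultimately have p1: "dist_le ?E (l - 1) (w \<beta>) (w \<psi>)"
        unfolding wy dist_le_def by (intro exI[of _ "\<beta> - 1 + l - \<beta>"] conjI)
      have p2: "dist_le ?E (hi - lo) (w lo) (w hi)"
      proof (rule dist_le_path)
        show "lo \<le> hi" unfolding lo_def hi_def by simp
        show "{w t, w (Suc t)} \<in> ?E" if "lo \<le> t" "t < hi" for t by (rule str[OF that])
      qed
      have p3: "dist_le ?E (hi - lo) (w \<psi>) (w \<phi>)"
      proof (cases "\<phi> \<le> \<psi>")
        case True
        then have "lo = \<phi>" "hi = \<psi>" unfolding lo_def hi_def by simp_all
        then show ?thesis using dist_le_sym[OF p2] by simp
      next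
        case False
        then have "lo = \<psi>" "hi = \<phi>" unfolding lo_def hi_def by simp_all
        then show ?thesis using p2 by simp
      qed
      have "dist_le ?E (l - 1 + (hi - lo)) y (w \<phi>)" using dist_le_trans[OF p1 p3] unfolding y_def .
      then obtain k where k: "k \<le> l - 1 + (hi - lo)" "(y, w \<phi>) \<in> adj_rel ?E ^^ k" unfolding dist_le_def by blast
      have hl: "hi - lo < 4 * a" using 3 unfolding hi_def lo_def by auto
      have "(w \<phi>, y) \<in> adj_rel ?E ^^ k" by (rule adj_rel_sym_relpow[OF k(2)])
      moreover have "{w \<phi>, y} \<in> E" using walk_edge'[of \<beta>] b1 unfolding wv y_def by simp
      moreover have "Suc k \<le> 10 * a" using k(1) hl l a by linarith
      ultimately have "w \<phi> \<in> short_cycle_verts E (10 * a)" using yv by (intro bridge_short_cycle)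
      then show ?thesis using vS unfolding S_def by simp
    qed
  qed
qed

text \<open>
  At a time in \<open>rich_partners\<close> the walk returns along an old strand and is about to leave it.  The continuation
  either starts from a good time, or reaches another rich strand, or stays at vertices whose first
  visits are not rich.
\<close>

definition rich_partners :: "nat set" where "rich_partners = {t \<in> before_bad \<inter> partner_times. rich (first_traversal t) \<and> rich (\<theta> t)}"
definition type1 :: "nat set" where "type1 = {t \<in> rich_partners. good (\<theta> t)}"
definition type3 :: "nat set" where "type3 = {t \<in> rich_partners. \<forall>l. 1 \<le> l \<and> l \<le> a \<longrightarrow> \<not> rich (first_visit (w (next_bad t - 1 + l)))}"
definition type2 :: "nat set" where "type2 = rich_partners - type1 - type3"
definition poor_times :: "nat set" where "poor_times = {s \<in> {1..T}. \<not> rich (first_visit (w s))}"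

lemma finite_rich_partners [simp]: "finite rich_partners" unfolding rich_partners_def by simp

lemma rich_partners_first_traversal: "A \<subseteq> rich_partners \<Longrightarrow> inj_on first_traversal A"
  by (rule inj_on_subset[OF first_traversal_inj]) (auto simp: rich_partners_def)

lemma rich_partners_close: "t \<in> rich_partners \<Longrightarrow> first_traversal t \<le> \<theta> t + 4 * a \<and> \<theta> t \<le> first_traversal t + 4 * a"
  using strand[of t] unfolding rich_partners_def by auto

text \<open>\<open>first_traversal\<close> is injective, and its value lies within
  \<open>4 * a\<close> of \<open>\<theta> t\<close>, which in turn lies within \<open>4 * a\<close>
  of \<open>G\<close>.\<close>

lemma card_type1:
  assumes G: "finite G" "\<And>x. good x \<Longrightarrow> \<exists>y\<in>G. x < y + 4 * a \<and> y < x + 4 * a"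
  shows "card type1 \<le> card G * (16 * a + 1)"
proof -
  have "card type1 \<le> card (\<Union>x\<in>G. {x - 8 * a..x + 8 * a})"
  proof (rule card_inj_on_le[of first_traversal])
    show "inj_on first_traversal type1" by (rule rich_partners_first_traversal) (auto simp: type1_def)
    show "first_traversal ` type1 \<subseteq> (\<Union>x\<in>G. {x - 8 * a..x + 8 * a})"
    proof
      fix k assume "k \<in> first_traversal ` type1"
      then obtain t where t: "t \<in> rich_partners" "good (\<theta> t)" "k = first_traversal t" unfolding type1_def by auto
      obtain x where x: "x \<in> G" "\<theta> t < x + 4 * a" "x < \<theta> t + 4 * a" using G(2)[OF t(2)] by blast
      have "k \<in> {x - 8 * a..x + 8 * a}" using rich_partners_close[OF t(1)] x t(3) by auto
      then show "k \<in> (\<Union>x\<in>G. {x - 8 * a..x + 8 * a})" using x(1) by blast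
    qed
  qed (use G(1) in simp)
  also have "\<dots> \<le> card G * (16 * a + 1)" by (rule card_UN_bound[OF G(1)]) auto
  finally show ?thesis .
qed

text \<open>Here \<open>\<psi> t\<close>, the first visit on the strand reached within
  \<open>a\<close> steps, is good by \<open>off_strand_path\<close>. Times with nearly equal
  \<open>\<psi> t\<close> must have nearby \<open>\<theta> t\<close>, so each of 8 blocks of length
  \<open>a\<close> around an element of \<open>G\<close> accounts for at most
  \<open>16 * a + 1\<close> times.\<close>

lemma card_type2:
  assumes G: "finite G" "\<And>x. good x \<Longrightarrow> \<exists>y\<in>G. x < y + 4 * a \<and> y < x + 4 * a"
  shows "card type2 \<le> card G * (8 * (16 * a + 1))"
proof -
  have "\<exists>l. 1 \<le> l \<and> l \<le> a \<and> rich (first_visit (w (next_bad t - 1 + l)))" if "t \<in> type2" for t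
    using that unfolding type2_def type3_def by auto
  then have "\<forall>t\<in>type2. \<exists>l. 1 \<le> l \<and> l \<le> a \<and> rich (first_visit (w (next_bad t - 1 + l)))" by simp
  from bchoice[OF this] obtain L where L: "\<And>t. t \<in> type2 \<Longrightarrow> 1 \<le> L t \<and> L t \<le> a \<and> rich (first_visit (w (next_bad t - 1 + L t)))" by blast
  define \<psi> where "\<psi> t = first_visit (w (next_bad t - 1 + L t))" for t
  have R: "t \<in> rich_partners" "\<not> good (\<theta> t)" if "t \<in> type2" for t using that unfolding type2_def type1_def by auto
  have g: "good (\<psi> t)" if t: "t \<in> type2" for t
  proof -
    have A: "t \<in> before_bad" "rich (\<theta> t)" using R(1)[OF t] unfolding rich_partners_def by auto
    have "good (\<theta> t) \<or> good (\<psi> t) \<and> \<theta> t + 4 * a \<le> \<psi> t"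
      by (rule off_strand_path[OF before_bad_next_bad(1)[OF A(1)] _ _ before_bad_next_bad(4)[OF A(1)] \<theta>_def A(2) \<psi>_def])
        (use L[OF t] in \<open>auto simp: \<psi>_def\<close>)
    then show ?thesis using R(2)[OF t] by blast
  qed
  have d: "dist_le E a (w (\<theta> t)) (w (\<psi> t))" if t: "t \<in> type2" for t
  proof -
    have A: "t \<in> before_bad" using R(1)[OF t] unfolding rich_partners_def by auto
    have "w (\<theta> t) = w (next_bad t - 1)" "w (\<psi> t) = w (next_bad t - 1 + L t)" unfolding \<theta>_def \<psi>_def by simp_all
    moreover have "next_bad t - 1 \<le> T" "next_bad t - 1 + L t \<le> T" "next_bad t - 1 + L t \<le> next_bad t - 1 + a" "next_bad t - 1 \<le> next_bad t - 1 + L t + a"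
      using L[OF t] before_bad_next_bad(2,4)[OF A] by linarith+
    ultimately show ?thesis using dist_le_w' by simp
  qed
  \<comment> \<open>Going from \<open>\<theta> t\<close> through \<open>\<psi> t\<close> and
    \<open>\<psi> t'\<close> to \<open>\<theta> t'\<close> takes at most three stretches of length
    \<open>a\<close>. If the two ends were \<open>4 * a\<close> apart in time, this shortcut would
    make \<open>\<theta> t'\<close> good, which type 1 has already taken care of.\<close>
  have separated: "\<not> \<theta> t + 4 * a \<le> \<theta> t'" if t: "t \<in> type2" "t' \<in> type2" "\<psi> t \<le> \<psi> t' + a" "\<psi> t' \<le> \<psi> t + a" for t t'
  proof
    assume le: "\<theta> t + 4 * a \<le> \<theta> t'"
    have "rich (\<psi> t)" "rich (\<psi> t')" using g[OF t(1)] g[OF t(2)] unfolding good_def by simp_all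
    then have "\<psi> t \<le> T" "\<psi> t' \<le> T" using rich_D by simp_all
    then have pp: "dist_le E a (w (\<psi> t)) (w (\<psi> t'))" by (rule dist_le_w'[OF _ _ t(4,3)])
    have "dist_le E (a + (a + a)) (w (\<theta> t)) (w (\<theta> t'))"
      by (rule dist_le_trans[OF d[OF t(1)] dist_le_trans[OF pp dist_le_sym[OF d[OF t(2)]]]])
    then have "dist_le E (3 * a) (w (\<theta> t)) (w (\<theta> t'))" by (rule dist_le_mono) simp
    moreover have "w (\<theta> t) \<in> w ` {..\<theta> t' - 4 * a} \<union> S" using le by auto
    moreover have "rich (\<theta> t')" using R(1)[OF t(2)] unfolding rich_partners_def by simp
    ultimately have "good (\<theta> t')" unfolding good_def near_def by (intro conjI bexI[of _ "w (\<theta> t)"])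
    then show False using R(2)[OF t(2)] by simp
  qed
  define D where "D x j = {t \<in> type2. x < \<psi> t + 4 * a \<and> \<psi> t < x + 4 * a \<and> (\<psi> t + 4 * a - x) div a = j}" for x j
  have cov: "type2 \<subseteq> (\<Union>x\<in>G. \<Union>j\<in>{..<8}. D x j)"
  proof
    fix t assume t: "t \<in> type2"
    obtain x where x: "x \<in> G" "\<psi> t < x + 4 * a" "x < \<psi> t + 4 * a" using G(2)[OF g[OF t]] by blast
    have "\<psi> t + 4 * a - x < 8 * a" using x by linarith
    then have "(\<psi> t + 4 * a - x) div a < 8" using less_mult_imp_div_less by blast
    then show "t \<in> (\<Union>x\<in>G. \<Union>j\<in>{..<8}. D x j)" using x t unfolding D_def by auto
  qed
  have cD: "card (D x j) \<le> 16 * a + 1" for x j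
  proof (cases "D x j = {}")
    case False
    then obtain t0 where t0: "t0 \<in> D x j" by blast
    have "card (D x j) \<le> card {\<theta> t0 - 8 * a..\<theta> t0 + 8 * a}"
    proof (rule card_inj_on_le[of first_traversal])
      show "inj_on first_traversal (D x j)" by (rule rich_partners_first_traversal) (use R in \<open>auto simp: D_def\<close>)
      show "first_traversal ` D x j \<subseteq> {\<theta> t0 - 8 * a..\<theta> t0 + 8 * a}"
      proof
        fix k assume "k \<in> first_traversal ` D x j"
        then obtain t where t: "t \<in> D x j" "k = first_traversal t" by auto
        have e: "t \<in> type2" "t0 \<in> type2" "(\<psi> t + 4 * a - x) div a = (\<psi> t0 + 4 * a - x) div a" "x < \<psi> t + 4 * a" "x < \<psi> t0 + 4 * a"
          using t t0 unfolding D_def by auto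
        define p where "p = \<psi> t + 4 * a - x"
        define p0 where "p0 = \<psi> t0 + 4 * a - x"
        have "p = a * (p div a) + p mod a" by simp
        then have "p = a * (p0 div a) + p mod a" using e(3) unfolding p_def[symmetric] p0_def[symmetric] by simp
        moreover have "p0 = a * (p0 div a) + p0 mod a" "p mod a < a" "p0 mod a < a" using a by simp_all
        ultimately have "p \<le> p0 + a" "p0 \<le> p + a" by linarith+
        then have "\<psi> t \<le> \<psi> t0 + a" "\<psi> t0 \<le> \<psi> t + a" using e(4,5) unfolding p_def p0_def by linarith+
        then have "\<not> \<theta> t + 4 * a \<le> \<theta> t0" "\<not> \<theta> t0 + 4 * a \<le> \<theta> t" using separated e(1,2) by blast+
        then show "k \<in> {\<theta> t0 - 8 * a..\<theta> t0 + 8 * a}" using rich_partners_close[OF R(1)[OF e(1)]] t(2) by auto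
      qed
    qed simp
    then show ?thesis by simp
  qed simp
  have fT2: "finite type2" unfolding type2_def by simp
  have fD: "finite (D x j)" for x j unfolding D_def using fT2 by simp
  have "card type2 \<le> card (\<Union>x\<in>G. \<Union>j\<in>{..<8}. D x j)" by (rule card_mono[OF _ cov]) (use G(1) fD in auto)
  also have "\<dots> \<le> card G * (8 * (16 * a + 1))"
  proof (rule card_UN_bound[OF G(1)])
    fix x
    have "card (\<Union>j\<in>{..<8::nat}. D x j) \<le> card {..<8::nat} * (16 * a + 1)" by (rule card_UN_bound) (use cD in auto)
    then show "card (\<Union>j\<in>{..<8}. D x j) \<le> 8 * (16 * a + 1)" by simp
  qed
  finally show ?thesis .
qed

text \<open>A partner time \<open>s\<close> ends at one of the two ends of the edge discovered at
  \<open>k = first_traversal s\<close>. If \<open>k\<close> is rich and \<open>w s\<close> has a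
  first visit that is not rich, this visit is \<open>k - 1\<close>, so \<open>k\<close> starts the
  rich part of a run.\<close>

lemma card_poor_times: "card poor_times \<le> card excess_times + 2 * card poor_new + card run_starts"
proof -
  have "poor_times \<subseteq> excess_times \<union> poor_new \<union> (poor_times \<inter> partner_times)"
  proof
    fix s assume s: "s \<in> poor_times"
    have "s \<in> new_times \<Longrightarrow> s \<in> poor_new" using s new_first_visit[of s] new_times_D[of s] unfolding poor_times_def poor_new_def by auto
    then show "s \<in> excess_times \<union> poor_new \<union> (poor_times \<inter> partner_times)" using s unfolding excess_times_def poor_times_def by auto
  qed
  then have "card poor_times \<le> card (excess_times \<union> poor_new \<union> (poor_times \<inter> partner_times))" by (intro card_mono) auto
  also have "\<dots> \<le> card excess_times + card poor_new + card (poor_times \<inter> partner_times)" by (rule card_Un3_le)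
  also have "card (poor_times \<inter> partner_times) \<le> card (poor_new \<union> run_starts)"
  proof (rule card_inj_on_le[of first_traversal])
    show "inj_on first_traversal (poor_times \<inter> partner_times)" by (rule inj_on_subset[OF first_traversal_inj]) auto
    show "first_traversal ` (poor_times \<inter> partner_times) \<subseteq> poor_new \<union> run_starts"
    proof
      fix k assume "k \<in> first_traversal ` (poor_times \<inter> partner_times)"
      then obtain s where s: "s \<in> poor_times" "s \<in> partner_times" "k = first_traversal s" by auto
      have k: "k \<in> new_times" "step_edge s = step_edge k" using first_traversal[OF s(2)] s(3) by auto
      have ws: "w s = w k \<or> w s = w (k - 1)" using k(2) unfolding step_edge_def by blast
      show "k \<in> poor_new \<union> run_starts"
      proof (cases "rich k")
        case True
        have "k - 4 * a < k - 1" "k - 1 \<le> k" using rich_D[OF True] a by auto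
        then have "new (k - 1)" using True unfolding rich_def by blast
        then have "first_visit (w (k - 1)) = k - 1" "first_visit (w k) = k" using new_first_visit rich_D[OF True] by auto
        then have "\<not> rich (k - 1)" using ws s(1) True unfolding poor_times_def by auto
        then show ?thesis using True unfolding run_starts_def by simp
      next
        case False
        then show ?thesis using k unfolding poor_new_def by simp
      qed
    qed
  qed simp
  also have "card (poor_new \<union> run_starts) \<le> card poor_new + card run_starts" by (rule card_Un_le)
  finally show ?thesis by simp
qed

text \<open>Each value \<open>\<beta>\<close> of \<open>next_bad\<close> is followed by
  \<open>a\<close> poor times. These windows are disjoint, since \<open>\<beta> - 1\<close> is not
  poor, and every \<open>\<beta>\<close> serves at most \<open>4 * a\<close> times
  \<open>t\<close>.\<close>

lemma card_type3: "card type3 \<le> 4 * card poor_times"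
proof -
  define M where "M = next_bad ` type3"
  have finM: "finite M" unfolding M_def type3_def by simp
  have M: "rich (first_visit (w (\<beta> - 1)))" "\<And>u. \<beta> \<le> u \<Longrightarrow> u < \<beta> + a \<Longrightarrow> u \<in> poor_times" "1 \<le> \<beta>" if bM: "\<beta> \<in> M" for \<beta>
  proof -
    obtain t where t: "t \<in> type3" "\<beta> = next_bad t" using bM unfolding M_def by auto
    have A: "t \<in> before_bad" "rich (\<theta> t)" using t(1) unfolding type3_def rich_partners_def by auto
    show "rich (first_visit (w (\<beta> - 1)))" using A(2) t(2) unfolding \<theta>_def by simp
    show b1: "1 \<le> \<beta>" using before_bad_next_bad[OF A(1)] t(2) by simp
    fix u assume u: "\<beta> \<le> u" "u < \<beta> + a"
    define l where "l = u - \<beta> + 1"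
    have l: "1 \<le> l" "l \<le> a" "next_bad t - 1 + l = u" using u b1 t(2) unfolding l_def by auto
    then have "\<not> rich (first_visit (w u))" using t(1) unfolding type3_def by auto
    moreover have "u \<le> T" using u before_bad_next_bad(4)[OF A(1)] t(2) by simp
    ultimately show "u \<in> poor_times" unfolding poor_times_def using b1 u by simp
  qed
  have gap: "\<beta> + a \<le> \<gamma> - 1" if "\<beta> \<in> M" "\<gamma> \<in> M" "\<beta> < \<gamma>" for \<beta> \<gamma>
  proof (rule ccontr)
    assume "\<not> ?thesis"
    then have "\<gamma> - 1 \<in> poor_times" using M(2)[OF that(1), of "\<gamma> - 1"] that(3) by auto
    then show False using M(1)[OF that(2)] unfolding poor_times_def by simp
  qed
  have disj: "disjoint_family_on (\<lambda>\<beta>. {\<beta>..<\<beta> + a}) M"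
    unfolding disjoint_family_on_def
  proof (intro ballI impI)
    fix x y assume xy: "x \<in> M" "y \<in> M" "x \<noteq> y"
    show "{x..<x + a} \<inter> {y..<y + a} = {}"
    proof (cases x y rule: linorder_cases)
      case less
      then have "x + a \<le> y - 1" using gap xy by blast
      then show ?thesis by auto
    next
      case greater
      then have "y + a \<le> x - 1" using gap xy by blast
      then show ?thesis by auto
    qed (use xy in simp)
  qed
  have "card (\<Union>\<beta>\<in>M. {\<beta>..<\<beta> + a}) = (\<Sum>\<beta>\<in>M. card {\<beta>..<\<beta> + a})"
    by (rule card_UN_disjoint'[OF disj _ finM]) simp
  also have "\<dots> = a * card M" by simp
  finally have "a * card M = card (\<Union>\<beta>\<in>M. {\<beta>..<\<beta> + a})" by simp
  also have "\<dots> \<le> card poor_times" by (rule card_mono) (use M(2) in \<open>auto simp: poor_times_def\<close>)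
  finally have aM: "a * card M \<le> card poor_times" .
  have "type3 \<subseteq> (\<Union>\<beta>\<in>M. {\<beta> - 4 * a..<\<beta>})"
  proof
    fix t assume t: "t \<in> type3"
    then have A: "t \<in> before_bad" unfolding type3_def rich_partners_def by auto
    have "t \<in> {next_bad t - 4 * a..<next_bad t}" using before_bad_next_bad[OF A] by auto
    then show "t \<in> (\<Union>\<beta>\<in>M. {\<beta> - 4 * a..<\<beta>})" unfolding M_def using t by blast
  qed
  then have "card type3 \<le> card (\<Union>\<beta>\<in>M. {\<beta> - 4 * a..<\<beta>})" by (intro card_mono) (use finM in auto)
  also have "\<dots> \<le> card M * (4 * a)" by (rule card_UN_bound[OF finM]) simp
  also have "\<dots> = 4 * (a * card M)" by simp
  finally show ?thesis using aM by linarith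
qed

text \<open>Partner times before a bad time are split by whether the retraced edge and the point of
  departure are rich, and the rich ones by their type; everything else is excess or new. The number
  of long runs never exceeds \<open>card G\<close>, up to one, so the boundary terms of runs are
  also charged to \<open>G\<close>.\<close>

lemma trichotomy:
  assumes P: "pieces P" and G: "finite G" "\<And>x. good x \<Longrightarrow> \<exists>y\<in>G. x < y + 4 * a \<and> y < x + 4 * a"
    and max: "card long_run_ends \<le> card G"
  shows "4 * a * card P \<le> 5 * card excess_times + 10 * card {t \<in> new_times. in_short_run t} + 206 * a * card G + 129 * a"
proof -
  define Z where "Z = (\<Union>r\<in>long_run_ends. {r - 4 * a<..r})"
  define Z' where "Z' = (\<Union>x\<in>run_starts. {x..x + 4 * a})"
  define R1 where "R1 = {t \<in> before_bad \<inter> partner_times. \<not> rich (first_traversal t)}"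
  define R2 where "R2 = {t \<in> before_bad \<inter> partner_times. rich (first_traversal t) \<and> \<not> rich (\<theta> t)}"
  have fin: "finite Z" "finite Z'" "finite R1" "finite R2" "finite type1" "finite type2" "finite type3"
    unfolding Z_def Z'_def R1_def R2_def type1_def type2_def type3_def by simp_all
  have sub: "before_bad \<subseteq> (excess_times \<union> ({t \<in> new_times. in_short_run t} \<union> {1..4 * a} \<union> Z)) \<union> (R1 \<union> R2) \<union> (type1 \<union> type2 \<union> type3)"
  proof
    fix t assume t: "t \<in> before_bad"
    then have t1: "t \<in> {1..T}" unfolding before_bad_def by simp
    consider "t \<in> new_times" | "t \<in> partner_times" | "t \<in> excess_times" using t1 unfolding excess_times_def by blast
    then show "t \<in> (excess_times \<union> ({t \<in> new_times. in_short_run t} \<union> {1..4 * a} \<union> Z)) \<union> (R1 \<union> R2) \<union> (type1 \<union> type2 \<union> type3)"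
    proof cases
      case 1
      then show ?thesis using before_bad_new[OF t] unfolding Z_def by blast
    next
      case 2
      then have "t \<in> R1 \<union> R2 \<union> rich_partners" using t unfolding R1_def R2_def rich_partners_def by blast
      then show ?thesis unfolding type2_def by blast
    qed blast
  qed
  have "card before_bad \<le> card ((excess_times \<union> ({t \<in> new_times. in_short_run t} \<union> {1..4 * a} \<union> Z)) \<union> (R1 \<union> R2) \<union> (type1 \<union> type2 \<union> type3))"
    by (rule card_mono[OF _ sub]) (use fin in simp)
  also have "\<dots> \<le> card (excess_times \<union> ({t \<in> new_times. in_short_run t} \<union> {1..4 * a} \<union> Z)) + card (R1 \<union> R2) + card (type1 \<union> type2 \<union> type3)"
    by (rule card_Un3_le)
  also have "card (R1 \<union> R2) \<le> card R1 + card R2" by (rule card_Un_le)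
  also have "card (type1 \<union> type2 \<union> type3) \<le> card type1 + card type2 + card type3" by (rule card_Un3_le)
  also have "card (excess_times \<union> ({t \<in> new_times. in_short_run t} \<union> {1..4 * a} \<union> Z)) \<le> card excess_times + card ({t \<in> new_times. in_short_run t} \<union> {1..4 * a} \<union> Z)"
    by (rule card_Un_le)
  also have "card ({t \<in> new_times. in_short_run t} \<union> {1..4 * a} \<union> Z) \<le> card {t \<in> new_times. in_short_run t} + card {1..4 * a} + card Z"
    by (rule card_Un3_le)
  finally have tot: "card before_bad \<le> card excess_times + (card {t \<in> new_times. in_short_run t} + card {1..4 * a} + card Z) + (card R1 + card R2) + (card type1 + card type2 + card type3)"
    by simp
  have cZ: "card Z \<le> card long_run_ends * (4 * a)" unfolding Z_def by (rule card_UN_bound) auto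
  have cZ': "card Z' \<le> card run_starts * (4 * a + 1)" unfolding Z'_def by (rule card_UN_bound) auto
  have cR1: "card R1 \<le> card poor_new"
  proof (rule card_inj_on_le[of first_traversal])
    show "inj_on first_traversal R1" by (rule inj_on_subset[OF first_traversal_inj]) (auto simp: R1_def)
    show "first_traversal ` R1 \<subseteq> poor_new"
    proof
      fix k assume "k \<in> first_traversal ` R1"
      then obtain t where t: "t \<in> partner_times" "\<not> rich (first_traversal t)" "k = first_traversal t" unfolding R1_def by auto
      then show "k \<in> poor_new" using first_traversal[OF t(1)] unfolding poor_new_def by simp
    qed
  qed simp
  have "card R2 \<le> card (Z \<union> Z')"
  proof (rule card_inj_on_le[of first_traversal])
    show "inj_on first_traversal R2" by (rule inj_on_subset[OF first_traversal_inj]) (auto simp: R2_def)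
    show "first_traversal ` R2 \<subseteq> Z \<union> Z'"
    proof
      fix k assume "k \<in> first_traversal ` R2"
      then obtain t where t: "t \<in> before_bad" "t \<in> partner_times" "rich (first_traversal t)" "\<not> rich (\<theta> t)" "k = first_traversal t" unfolding R2_def by auto
      then show "k \<in> Z \<union> Z'" using strand_not_rich[OF t(1-4)] unfolding Z_def Z'_def by simp
    qed
  qed (use fin in simp)
  then have cR2: "card R2 \<le> card Z + card Z'" using card_Un_le[of Z Z'] by linarith
  define g where "g = card G"
  define sg where "sg = a * g"
  have LE: "card long_run_ends * (4 * a) \<le> 4 * sg" using mult_right_mono[OF max, of "4 * a"] unfolding sg_def g_def by simp
  have run_starts: "card run_starts \<le> g + 1" using card_run_starts max unfolding g_def by simp
  have SL4: "card run_starts * (4 * a) \<le> 4 * sg + 4 * a" using mult_right_mono[OF run_starts, of "4 * a"] unfolding sg_def by (simp add: algebra_simps)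
  have SL5: "card run_starts * (4 * a + 1) \<le> 4 * sg + 4 * a + g + 1" using SL4 run_starts by (simp add: algebra_simps)
  have ga: "g \<le> sg" unfolding sg_def using a by simp
  have t1: "card type1 \<le> 16 * sg + g" using card_type1[OF G] unfolding sg_def g_def by (simp add: algebra_simps)
  have t2: "card type2 \<le> 128 * sg + 8 * g" using card_type2[OF G] unfolding sg_def g_def by (simp add: algebra_simps)
  have c1: "card {1..4 * a} = 4 * a" by simp
  have "4 * a * card P - 8 * a \<le> card before_bad" using card_before_bad[OF P] by (simp add: algebra_simps)
  then have "4 * a * card P \<le> card before_bad + 8 * a" by simp
  have "206 * a * card G = 206 * sg" unfolding sg_def g_def by simp
  have b0: "4 * a * card P \<le> card before_bad + 8 * a" by fact
  have e2: "206 * a * card G = 206 * sg" by fact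
  have b1: "card poor_new \<le> card {t \<in> new_times. in_short_run t} + 4 * sg + 12 * a" using card_poor_new SL4 by linarith
  have b2: "card poor_times \<le> card excess_times + 2 * card {t \<in> new_times. in_short_run t} + 8 * sg + 24 * a + g + 1" using card_poor_times b1 run_starts by linarith
  have b3: "card type3 \<le> 4 * card excess_times + 8 * card {t \<in> new_times. in_short_run t} + 32 * sg + 96 * a + 4 * g + 4" using card_type3 b2 by linarith
  have b4: "card Z \<le> 4 * sg" using cZ LE by linarith
  have b5: "card R2 \<le> 8 * sg + 4 * a + g + 1" using cR2 b4 cZ' SL5 by linarith
  have "card before_bad \<le> 5 * card excess_times + 10 * card {t \<in> new_times. in_short_run t} + 192 * sg + 116 * a + 14 * g + 5"
    using tot b1 b3 b4 b5 t1 t2 cR1 c1 by linarith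
  then show ?thesis unfolding e2 using b0 ga a by linarith
qed

text \<open>The costs of both segmentations are added. Together they save \<open>a * card G\<close>,
  the times in short runs and the excess times, while \<open>trichotomy\<close> bounds
  \<open>a * card P\<close> by the same three quantities. In \<open>2 * a * (q1 + q2)\<close> the
  coefficient of \<open>a * card G\<close> becomes 519, the largest of the three, whence 520; one of
  the two segmentations satisfies half of the combined bound.\<close>

theorem segmentation:
  "\<exists>q B. segs E S (12 * a) w T q B \<and> B \<le> T \<and> 520 * B + 2 * a * q \<le> 260 * (T + card odd_edges + a)"
proof -
  obtain P where P: "pieces P" using pieces_exist by blast
  from max_separated obtain G where Gall: "finite G \<and> (\<forall>x\<in>G. good x) \<and> separated G \<and>
      (\<forall>x. good x \<longrightarrow> (\<exists>y\<in>G. x < y + 4 * a \<and> y < x + 4 * a)) \<and>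
      (\<forall>H. (\<forall>x\<in>H. good x) \<and> separated H \<longrightarrow> card H \<le> card G)" by (rule exE)
  have G1: "finite G" using Gall by (elim conjE)
  have G2': "\<forall>x\<in>G. good x" using Gall by (elim conjE)
  have G3: "separated G" using Gall by (elim conjE)
  have G4': "\<forall>x. good x \<longrightarrow> (\<exists>y\<in>G. x < y + 4 * a \<and> y < x + 4 * a)" using Gall by (elim conjE)
  have G2: "good x" if "x \<in> G" for x using bspec[OF G2' that] .
  have G4: "\<exists>y\<in>G. x < y + 4 * a \<and> y < x + 4 * a" if "good x" for x using G4'[rule_format, OF that] .
  have "\<forall>H. (\<forall>x\<in>H. good x) \<and> separated H \<longrightarrow> card H \<le> card G" using Gall by (elim conjE)
  then have "(\<forall>x\<in>long_run_ends. good x) \<and> separated long_run_ends \<longrightarrow> card long_run_ends \<le> card G" by (rule spec)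
  moreover have "\<forall>x\<in>long_run_ends. good x" by (intro ballI) (rule long_run_ends_good)
  ultimately have "card long_run_ends \<le> card G" using long_run_ends_separated by simp
  note tri = trichotomy[OF P G1 G4 this]
  obtain q1 B1 where 1: "segs E S (12 * a) w T q1 B1" "q1 \<le> 2 * card P + 2 * card G + 1" "B1 + a * card G \<le> card new_times"
  proof -
    have "\<exists>q B. segs E S (12 * a) w T q B \<and> q \<le> 2 * card P + 2 * card G + 1 \<and> B + a * card G \<le> card new_times"
    proof (rule segs_good[OF P G1 G2])
      show "x + 4 * a \<le> y" if "x \<in> G" "y \<in> G" "x < y" for x y
        using G3 that unfolding separated_def by simp
    qed
    then show ?thesis using that by (elim exE conjE)
  qed
  obtain q2 B2 where 2: "segs E S (12 * a) w T q2 B2" "q2 \<le> 3 * card P + 1" "B2 \<le> card {t \<in> new_times. \<not> in_short_run t}"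
    using segs_short[OF P] by (elim exE conjE)
  have "card {t \<in> new_times. in_short_run t} + card {t \<in> new_times. \<not> in_short_run t} = card new_times"
  proof -
    have "card ({t \<in> new_times. in_short_run t} \<union> {t \<in> new_times. \<not> in_short_run t}) = card {t \<in> new_times. in_short_run t} + card {t \<in> new_times. \<not> in_short_run t}"
      by (rule card_Un_disjoint) auto
    moreover have "{t \<in> new_times. in_short_run t} \<union> {t \<in> new_times. \<not> in_short_run t} = new_times" by auto
    ultimately show ?thesis by simp
  qed
  then have B2: "B2 + card {t \<in> new_times. in_short_run t} \<le> card new_times" using 2(3) by linarith
  have "new_times \<subseteq> {1..T}" unfolding new_times_def by auto
  then have nT: "card new_times \<le> T" using card_mono[of "{1..T}" new_times] by simp
  define p where "p = a * card P"
  define g where "g = a * card G"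
  have aq1: "a * q1 \<le> 2 * p + 2 * g + a" using mult_le_mono2[OF 1(2), of a] unfolding p_def g_def by (simp add: algebra_simps)
  have aq2: "a * q2 \<le> 3 * p + a" using mult_le_mono2[OF 2(2), of a] unfolding p_def by (simp add: algebra_simps)
  have tri': "4 * p \<le> 5 * card excess_times + 10 * card {t \<in> new_times. in_short_run t} + 206 * g + 129 * a"
    using tri unfolding p_def g_def by (simp add: algebra_simps)
  define Qs where "Qs = card {t \<in> new_times. in_short_run t}"
  have s1: "B1 + B2 + g + Qs + card excess_times \<le> T + card odd_edges"
    using B2 1(3) card_excess_times unfolding g_def Qs_def by linarith
  define r1 where "r1 = a * q1"
  define r2 where "r2 = a * q2"
  have s2: "2 * r1 + 2 * r2 \<le> 10 * p + 4 * g + 4 * a" using aq1 aq2 unfolding r1_def[symmetric] r2_def[symmetric] by linarith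
  have s3: "20 * p \<le> 25 * card excess_times + 50 * Qs + 1030 * g + 645 * a" using tri' unfolding Qs_def by linarith
  have "520 * B1 + 520 * B2 + 2 * r1 + 2 * r2 \<le> 520 * T + 520 * card odd_edges + 520 * a"
    using s1 s2 s3 by linarith
  then have "520 * B1 + 2 * r1 \<le> 260 * (T + card odd_edges + a) \<or> 520 * B2 + 2 * r2 \<le> 260 * (T + card odd_edges + a)"
    unfolding distrib_left by linarith
  then have "520 * B1 + 2 * (a * q1) \<le> 260 * (T + card odd_edges + a) \<or> 520 * B2 + 2 * (a * q2) \<le> 260 * (T + card odd_edges + a)"
    unfolding r1_def r2_def .
  then show ?thesis
  proof
    assume "520 * B1 + 2 * (a * q1) \<le> 260 * (T + card odd_edges + a)"
    moreover have "B1 \<le> T" using 1(3) nT by linarith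
    moreover have "2 * (a * q1) = 2 * a * q1" by simp
    ultimately show ?thesis using 1(1) by (intro exI[of _ q1] exI[of _ B1] conjI) simp_all
  next
    assume "520 * B2 + 2 * (a * q2) \<le> 260 * (T + card odd_edges + a)"
    moreover have "B2 \<le> T" using B2 nT by linarith
    moreover have "2 * (a * q2) = 2 * a * q2" by simp
    ultimately show ?thesis using 2(1) by (intro exI[of _ q2] exI[of _ B2] conjI) simp_all
  qed
qed

end

section \<open>Counting nonbacktracking walks\<close>

lemma nbwalk_take: "nbwalk E w T \<Longrightarrow> s \<le> T \<Longrightarrow> nbwalk E w s"
  unfolding nbwalk_def by auto

lemma nbwalk_shift: "nbwalk E w T \<Longrightarrow> s + t \<le> T \<Longrightarrow> nbwalk E (\<lambda>i. w (s + i)) t"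
  unfolding nbwalk_def by auto

lemma nbwalk_cong: "(\<And>i. i \<le> T \<Longrightarrow> w i = w' i) \<Longrightarrow> nbwalk E w T \<longleftrightarrow> nbwalk E w' T"
  unfolding nbwalk_def by auto

lemma nbwalk_mono: "nbwalk E w T \<Longrightarrow> (\<And>t. t < T \<Longrightarrow> {w t, w (Suc t)} \<in> E') \<Longrightarrow> nbwalk E' w T"
  unfolding nbwalk_def by auto

lemma short_cycle_graph_cycle:
  assumes "v \<in> short_cycle_verts E l"
  shows "\<exists>p. graph_cycle E (cycle_edges p) \<and> v \<in> set p \<and> length p \<le> l"
proof -
  obtain p where p: "distinct p" "3 \<le> length p" "length p \<le> l" "v \<in> set p"
    "\<forall>i<length p. {p ! i, p ! (Suc i mod length p)} \<in> E"
    using assms unfolding short_cycle_verts_def mem_Collect_eq by (elim exE conjE)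
  have "cycle_edges p \<subseteq> E" unfolding cycle_edges_def using p(5) by auto
  then have "graph_cycle E (cycle_edges p)" unfolding graph_cycle_def using p by (intro exI[of _ p]) simp
  then show ?thesis using p by (intro exI[of _ p]) simp
qed

lemma Union_cycle_edges: "\<Union>(cycle_edges p) = set p" if "p \<noteq> []"
proof
  have "Suc i mod length p < length p" for i using that by simp
  then show "\<Union>(cycle_edges p) \<subseteq> set p" unfolding cycle_edges_def using nth_mem by auto
  show "set p \<subseteq> \<Union>(cycle_edges p)"
  proof
    fix v assume "v \<in> set p"
    then obtain i where i: "i < length p" "v = p ! i" by (auto simp: in_set_conv_nth)
    then have "{p ! i, p ! (Suc i mod length p)} \<in> cycle_edges p" unfolding cycle_edges_def by blast
    then show "v \<in> \<Union>(cycle_edges p)" using i by blast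
  qed
qed

section \<open>Nonbacktracking walks in graphs with at most one cycle\<close>

lemma acyclic_nbwalk_inj:
  assumes ac: "\<And>C. \<not> graph_cycle E C" and loop_free: "\<forall>v. {v} \<notin> E" and nb: "nbwalk E p k" and ij: "i < j" "j \<le> k"
  shows "p i \<noteq> p j"
proof
  assume "p i = p j"
  then obtain v where "v \<in> short_cycle_verts E (j - i)"
    using nbwalk_repeat_short_cycle[OF nb loop_free ij, of "j - i"] by blast
  then show False using short_cycle_graph_cycle ac by blast
qed

text \<open>If the first steps differ, then \<open>p\<close> reversed and followed by
  \<open>q\<close> is nonbacktracking with equal ends, which a forest does not admit. If they agree,
  they are removed.\<close>

lemma acyclic_nbwalk_unique:
  assumes ac: "\<And>C. \<not> graph_cycle E C" and loop_free: "\<forall>v. {v} \<notin> E"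
  shows "nbwalk E p k \<Longrightarrow> nbwalk E q l \<Longrightarrow> p 0 = q 0 \<Longrightarrow> p k = q l \<Longrightarrow> k = l \<and> (\<forall>i\<le>k. p i = q i)"
proof (induction k arbitrary: l p q)
  case 0
  have "l = 0"
  proof (rule ccontr)
    assume "l \<noteq> 0"
    then have "q 0 \<noteq> q l" by (intro acyclic_nbwalk_inj[OF ac loop_free 0(2)]) auto
    then show False using 0 by simp
  qed
  then show ?case using 0 by simp
next
  case (Suc k)
  have "l \<noteq> 0"
  proof
    assume "l = 0"
    moreover have "p 0 \<noteq> p (Suc k)" by (intro acyclic_nbwalk_inj[OF ac loop_free Suc(2)]) auto
    ultimately show False using Suc.prems by simp
  qed
  then obtain l' where l: "l = Suc l'" by (cases l) auto
  show ?case
  proof (cases "p 1 = q 1")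
    case True
    have "k = l' \<and> (\<forall>i\<le>k. p (1 + i) = q (1 + i))"
      by (rule Suc.IH) (use Suc.prems l True nbwalk_shift[of E p "Suc k" 1 k] nbwalk_shift[of E q l 1 l'] in auto)
    then show ?thesis using Suc.prems(3) l by (auto simp: le_Suc_eq) (metis One_nat_def Suc_pred le_Suc_eq not_gr_zero plus_1_eq_Suc Suc_le_mono)
  next
    case False
    define h where "h i = (if i \<le> Suc k then p (Suc k - i) else q (i - Suc k))" for i
    have "nbwalk E h (Suc k + l)"
      unfolding nbwalk_def
    proof (intro conjI allI impI)
      fix t assume t: "t < Suc k + l"
      show "{h t, h (Suc t)} \<in> E"
      proof (cases "t < Suc k")
        case True
        then have "{p (Suc k - Suc t), p (Suc (Suc k - Suc t))} \<in> E" using Suc.prems(1) unfolding nbwalk_def by auto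
        moreover have "Suc (Suc k - Suc t) = Suc k - t" using True by simp
        ultimately show ?thesis unfolding h_def using True by (simp add: insert_commute)
      next
        case False
        then have "{q (t - Suc k), q (Suc (t - Suc k))} \<in> E" using Suc.prems(2) t unfolding nbwalk_def by auto
        moreover have "Suc (t - Suc k) = Suc t - Suc k" using False by simp
        moreover have "h t = q (t - Suc k)" unfolding h_def using False Suc.prems(3) by (cases "t = Suc k") auto
        moreover have "h (Suc t) = q (Suc t - Suc k)" unfolding h_def using False by simp
        ultimately show ?thesis by simp
      qed
    next
      fix t assume t: "Suc (Suc t) \<le> Suc k + l"
      consider "Suc (Suc t) \<le> Suc k" | "t = k" | "Suc k \<le> t" by linarith
      then show "h (Suc (Suc t)) \<noteq> h t"
      proof cases
        case 1
        then have "p (Suc (Suc (Suc k - Suc (Suc t)))) \<noteq> p (Suc k - Suc (Suc t))" using Suc.prems(1) unfolding nbwalk_def by auto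
        moreover have "Suc (Suc (Suc k - Suc (Suc t))) = Suc k - t" using 1 by simp
        ultimately show ?thesis unfolding h_def using 1 by auto
      next
        case 2
        then show ?thesis unfolding h_def using False by auto
      next
        case 3
        then have "q (Suc (Suc (t - Suc k))) \<noteq> q (t - Suc k)" using Suc.prems(2) t unfolding nbwalk_def by auto
        moreover have "Suc (Suc (t - Suc k)) = Suc (Suc t) - Suc k" using 3 by simp
        moreover have "h t = q (t - Suc k)" unfolding h_def using 3 Suc.prems(3) by (cases "t = Suc k") auto
        moreover have "h (Suc (Suc t)) = q (Suc (Suc t) - Suc k)" unfolding h_def using 3 by simp
        ultimately show ?thesis by simp
      qed
    qed
    then have "h 0 \<noteq> h (Suc k + l)" by (rule acyclic_nbwalk_inj[OF ac loop_free]) (use l in auto)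
    then show ?thesis unfolding h_def using Suc.prems l by auto
  qed
qed

text \<open>Lists represent each walk exactly once, unlike functions whose values beyond
  \<open>k\<close> are arbitrary, so that walks can be counted.\<close>

definition walk_lists :: "edge set \<Rightarrow> nat \<Rightarrow> nat list set" where
  "walk_lists E k = {p. length p = Suc k \<and> nbwalk E ((!) p) k}"

lemma walk_lists_drop: "p \<in> walk_lists E k \<Longrightarrow> i \<le> k \<Longrightarrow> drop i p \<in> walk_lists E (k - i)"
proof -
  assume p: "p \<in> walk_lists E k" and i: "i \<le> k"
  then have len: "length p = Suc k" unfolding walk_lists_def by simp
  have "nbwalk E (\<lambda>t. p ! (i + t)) (k - i)"
    using p i nbwalk_shift[of E "(!) p" k i "k - i"] unfolding walk_lists_def by simp
  then have "nbwalk E ((!) (drop i p)) (k - i)"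
    using nbwalk_cong[of "k - i" "(!) (drop i p)" "\<lambda>t. p ! (i + t)" E] len i by simp
  then show ?thesis unfolding walk_lists_def using len i by simp
qed

lemma card_le_1I: "(\<And>p q. p \<in> A \<Longrightarrow> q \<in> A \<Longrightarrow> p = q) \<Longrightarrow> card A \<le> 1"
proof (cases "A = {}")
  case False
  assume u: "\<And>p q. p \<in> A \<Longrightarrow> q \<in> A \<Longrightarrow> p = q"
  from False obtain p where "p \<in> A" by blast
  then have "A = {p}" using u by blast
  then show ?thesis by simp
qed simp

text \<open>In a graph with at most one cycle, deleting an edge \<open>e\<close> of that cycle leaves a forest, and a
  nonbacktracking walk always traverses \<open>e\<close> in the same direction.\<close>

locale one_cycle =
  fixes E :: "edge set" and e :: edge
  assumes ac: "\<And>C. \<not> graph_cycle (E - {e}) C" and loop_free: "\<forall>v. {v} \<notin> E" and finE: "finite (\<Union>E)"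
begin

definition through :: "nat \<Rightarrow> nat \<Rightarrow> nat \<Rightarrow> nat \<Rightarrow> nat list set" where
  "through u v z k = {p \<in> walk_lists E k. 1 \<le> k \<and> p ! 0 = u \<and> p ! 1 = v \<and> p ! k = z}"

lemma finite_walk_lists: "finite {p \<in> walk_lists E k. p ! 0 = x}"
proof (rule finite_subset)
  show "{p \<in> walk_lists E k. p ! 0 = x} \<subseteq> {p. set p \<subseteq> insert x (\<Union>E) \<and> length p = Suc k}"
  proof
    fix p assume p: "p \<in> {p \<in> walk_lists E k. p ! 0 = x}"
    have "p ! i \<in> insert x (\<Union>E)" if "i \<le> k" for i
    proof (cases i)
      case (Suc j)
      then have "{p ! j, p ! Suc j} \<in> E" using p that unfolding walk_lists_def nbwalk_def by auto
      then show ?thesis using Suc by blast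
    qed (use p in simp)
    moreover have len: "length p = Suc k" using p unfolding walk_lists_def by simp
    ultimately have "set p \<subseteq> insert x (\<Union>E)"
      by (metis in_set_conv_nth less_Suc_eq_le subsetI)
    then show "p \<in> {p. set p \<subseteq> insert x (\<Union>E) \<and> length p = Suc k}" using len by simp
  qed
  show "finite {p. set p \<subseteq> insert x (\<Union>E) \<and> length p = Suc k}"
    using finite_lists_length_eq[of "insert x (\<Union>E)" "Suc k"] finE by simp
qed

lemma loop_free': "\<forall>v. {v} \<notin> E - {e}" using loop_free by blast

lemma prefix_unique:
  assumes p: "p \<in> walk_lists E k" "q \<in> walk_lists E k'" "p ! a = q ! a'" "a \<le> i" "i \<le> k" "a' \<le> j" "j \<le> k'" "p ! i = q ! j"
    and np: "\<And>t. a \<le> t \<Longrightarrow> t < i \<Longrightarrow> {p ! t, p ! Suc t} \<noteq> e" and nq: "\<And>t. a' \<le> t \<Longrightarrow> t < j \<Longrightarrow> {q ! t, q ! Suc t} \<noteq> e"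
  shows "i - a = j - a' \<and> (\<forall>t\<le>i - a. p ! (a + t) = q ! (a' + t))"
proof (rule acyclic_nbwalk_unique[OF ac loop_free'])
  have 1: "nbwalk E (\<lambda>t. p ! (a + t)) (i - a)" using p(1) unfolding walk_lists_def
    by (intro nbwalk_shift[of E "(!) p" k]) (use p in auto)
  show "nbwalk (E - {e}) (\<lambda>t. p ! (a + t)) (i - a)"
    by (rule nbwalk_mono[OF 1]) (use 1 np in \<open>auto simp: nbwalk_def\<close>)
  have 2: "nbwalk E (\<lambda>t. q ! (a' + t)) (j - a')" using p(2) unfolding walk_lists_def
    by (intro nbwalk_shift[of E "(!) q" k']) (use p in auto)
  show "nbwalk (E - {e}) (\<lambda>t. q ! (a' + t)) (j - a')"
    by (rule nbwalk_mono[OF 2]) (use 2 nq in \<open>auto simp: nbwalk_def\<close>)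
qed (use p in auto)

text \<open>After its first step, a walk that never uses \<open>e\<close> again lies in a forest and
  is determined by \<open>z\<close>. For the others the part up to the next passage is determined,
  with a common length \<open>m \<ge> 1\<close>; removing it leaves a walk of the same kind of
  length \<open>k - m\<close>. This gives at most \<open>1 + (k - m)\<close> walks.\<close>

lemma card_through:
  assumes e: "e = {u, v}"
  shows "card (through u v z k) \<le> k"
proof (induction k rule: less_induct)
  case (less k)
  have fin: "finite (through u v z k)"
    by (rule finite_subset[OF _ finite_walk_lists[of k u]]) (auto simp: through_def)
  define A where "A = {p \<in> through u v z k. \<forall>t. 1 \<le> t \<and> t < k \<longrightarrow> {p ! t, p ! Suc t} \<noteq> e}"
  define B where "B = through u v z k - A"
  have ext: "p = q" if "p \<in> walk_lists E k" "q \<in> walk_lists E k" "\<And>i. i \<le> k \<Longrightarrow> p ! i = q ! i" for p q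
    by (rule nth_equalityI) (use that in \<open>auto simp: walk_lists_def\<close>)
  have A1: "card A \<le> 1"
  proof -
    have "p = q" if p: "p \<in> A" "q \<in> A" for p q
    proof (rule ext)
      have th: "p \<in> walk_lists E k" "q \<in> walk_lists E k" "1 \<le> k" "p ! 0 = q ! 0" "p ! 1 = q ! 1" "p ! k = q ! k"
        using p unfolding A_def through_def by auto
      then show "p \<in> walk_lists E k" "q \<in> walk_lists E k" by auto
      have np: "{p ! t, p ! Suc t} \<noteq> e" "{q ! t, q ! Suc t} \<noteq> e" if "1 \<le> t" "t < k" for t
        using p that unfolding A_def by simp_all
      have "k - 1 = k - 1 \<and> (\<forall>t\<le>k - 1. p ! (1 + t) = q ! (1 + t))"
        by (rule prefix_unique[OF th(1,2,5,3) order_refl th(3) order_refl th(6) np(1) np(2)])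
      then show "p ! i = q ! i" if "i \<le> k" for i
        using that th(4) by (cases i) auto
    qed
    then show ?thesis by (intro card_le_1I)
  qed
  have cB: "card B \<le> k - 1"
  proof (cases "B = {}")
    case False
    define j where "j p = (LEAST t. 1 \<le> t \<and> t < k \<and> {p ! t, p ! Suc t} = e)" for p
    have j: "1 \<le> j p" "j p < k" "p ! j p = u" "p ! Suc (j p) = v" "\<And>t. 1 \<le> t \<Longrightarrow> t < j p \<Longrightarrow> {p ! t, p ! Suc t} \<noteq> e"
      "p \<in> walk_lists E k" "p ! 0 = u" "p ! 1 = v" if p: "p \<in> B" for p
    proof -
      have pB: "p \<in> through u v z k" "\<exists>t. 1 \<le> t \<and> t < k \<and> {p ! t, p ! Suc t} = e" using p unfolding B_def A_def by auto
      then have J: "1 \<le> j p \<and> j p < k \<and> {p ! j p, p ! Suc (j p)} = e" unfolding j_def by (elim LeastI_ex)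
      have L: "{p ! t, p ! Suc t} \<noteq> e" if "1 \<le> t" "t < j p" for t
        using not_less_Least[of t "\<lambda>t. 1 \<le> t \<and> t < k \<and> {p ! t, p ! Suc t} = e"] that J unfolding j_def[symmetric] by simp
      have th: "p \<in> walk_lists E k" "p ! 0 = u" "p ! 1 = v" using pB(1) unfolding through_def by auto
      have "{p ! 0, p ! Suc 0} \<in> E" using th(1) J unfolding walk_lists_def nbwalk_def by simp
      then have "{u, v} \<in> E" using th(2,3) by simp
      then have uv: "u \<noteq> v" using loop_free by (metis insert_absorb2)
      \<comment> \<open>Passing \<open>e\<close> in the opposite direction would first require a
        return to \<open>v\<close> inside the forest. This is possible only with no step in between,
        and then the passage is a backtracking step.\<close>
      have "p ! j p \<noteq> v"
      proof
        assume pv: "p ! j p = v"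
        have "j p - 1 = 1 - 1 \<and> (\<forall>t\<le>j p - 1. p ! (1 + t) = p ! (1 + t))"
        proof (rule prefix_unique[OF th(1) th(1) refl])
          show "1 \<le> j p" "j p \<le> k" "1 \<le> (1::nat)" "1 \<le> k" using J by auto
          show "p ! j p = p ! 1" using pv th(3) by simp
          show "{p ! t, p ! Suc t} \<noteq> e" if "1 \<le> t" "t < j p" for t by (rule L[OF that])
          show "{p ! t, p ! Suc t} \<noteq> e" if "1 \<le> t" "t < 1" for t using that by simp
        qed
        then have j1: "j p = 1" using J by linarith
        have "{p ! j p, p ! Suc (j p)} = {u, v}" using J e by simp
        then have "p ! Suc (Suc 0) = u" using j1 pv uv by (simp add: doubleton_eq_iff)
        moreover have "p ! Suc (Suc 0) \<noteq> p ! 0" using th(1) J j1 unfolding walk_lists_def nbwalk_def by simp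
        ultimately show False using th by simp
      qed
      then show "1 \<le> j p" "j p < k" "p ! j p = u" "p ! Suc (j p) = v" "\<And>t. 1 \<le> t \<Longrightarrow> t < j p \<Longrightarrow> {p ! t, p ! Suc t} \<noteq> e"
        "p \<in> walk_lists E k" "p ! 0 = u" "p ! 1 = v"
      proof -
        assume pv: "p ! j p \<noteq> v"
        have "{p ! j p, p ! Suc (j p)} = {u, v}" using J e by simp
        then have "p ! j p = u \<and> p ! Suc (j p) = v" using pv by (simp add: doubleton_eq_iff)
        then show "p ! j p = u" "p ! Suc (j p) = v" by simp_all
        show "{p ! t, p ! Suc t} \<noteq> e" if "1 \<le> t" "t < j p" for t by (rule L[OF that])
      qed (use J th in simp_all)
    qed
    have same: "j p - 1 = j q - 1 \<and> (\<forall>t\<le>j p - 1. p ! (1 + t) = q ! (1 + t))" if pB: "p \<in> B" "q \<in> B" for p q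
    proof (rule prefix_unique[OF j(6)[OF pB(1)] j(6)[OF pB(2)]])
      show "p ! 1 = q ! 1" "p ! j p = q ! j q" using j(3,8)[OF pB(1)] j(3,8)[OF pB(2)] by simp_all
      show "1 \<le> j p" "1 \<le> j q" "j p \<le> k" "j q \<le> k" using j(1,2)[OF pB(1)] j(1,2)[OF pB(2)] by simp_all
    qed (use j(5)[OF pB(1)] j(5)[OF pB(2)] in simp_all)
    obtain p0 where p0: "p0 \<in> B" using False by blast
    define m where "m = j p0"
    have m: "j p = m" if "p \<in> B" for p
      using same[OF that p0] j(1)[OF that] j(1)[OF p0] unfolding m_def by auto
    have "card B \<le> card (through u v z (k - m))"
    proof (rule card_inj_on_le[of "drop m"])
      show "inj_on (drop m) B"
      proof (rule inj_onI)
        fix p q assume pq: "p \<in> B" "q \<in> B" "drop m p = drop m q"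
        show "p = q"
        proof (rule ext)
          fix i assume i: "i \<le> k"
          show "p ! i = q ! i"
          proof (cases "i < m")
            case True
            then show ?thesis
            proof (cases i)
              case 0 then show ?thesis using j(7) pq by simp
            next
              case (Suc t)
              then have "p ! (1 + t) = q ! (1 + t)" using same[OF pq(1,2)] m[OF pq(1)] True by auto
              then show ?thesis using Suc by simp
            qed
          next
            case False
            then have "drop m p ! (i - m) = p ! i" "drop m q ! (i - m) = q ! i"
              using i j(6)[OF pq(1)] j(6)[OF pq(2)] unfolding walk_lists_def by auto
            then show ?thesis using pq(3) by simp
          qed
        qed (use j pq in auto)
      qed
      show "drop m ` B \<subseteq> through u v z (k - m)"
      proof
        fix r assume "r \<in> drop m ` B"
        then obtain p where p: "p \<in> B" "r = drop m p" by blast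
        have len: "length p = Suc k" using j(6)[OF p(1)] unfolding walk_lists_def by simp
        have "r \<in> walk_lists E (k - m)" unfolding p(2) by (rule walk_lists_drop[OF j(6)[OF p(1)]]) (use j(2)[OF p(1)] m[OF p(1)] in simp)
        moreover have "p ! k = z" using p(1) unfolding B_def through_def by simp
        ultimately show "r \<in> through u v z (k - m)" unfolding through_def p(2)
          using j[OF p(1)] m[OF p(1)] len by auto
      qed
      show "finite (through u v z (k - m))"
        by (rule finite_subset[OF _ finite_walk_lists[of "k - m" u]]) (auto simp: through_def)
    qed
    also have "\<dots> \<le> k - m" by (rule less.IH) (use j[OF p0] m_def in auto)
    finally show ?thesis using j(1)[OF p0] unfolding m_def by linarith
  qed simp
  show ?case
  proof (cases "k = 0")
    case True
    then show ?thesis unfolding through_def by simp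
  next
    case False
    have "through u v z k = A \<union> B" unfolding A_def B_def by auto
    then have "card (through u v z k) \<le> card A + card B" using card_Un_le by metis
    then show ?thesis using A1 cB False by linarith
  qed
qed

text \<open>At most one walk avoids \<open>e\<close>. The others are sorted by the time
  \<open>i\<close> and the direction of the first passage: what precedes it is determined in the
  forest, and \<open>card_through\<close> bounds the rest by \<open>k\<close>.\<close>

lemma card_walk_lists_between:
  "card {p \<in> walk_lists E k. p ! 0 = x \<and> p ! k = z} \<le> 1 + 2 * k * k"
proof -
  let ?W = "{p \<in> walk_lists E k. p ! 0 = x \<and> p ! k = z}"
  have fin: "finite ?W" by (rule finite_subset[OF _ finite_walk_lists[of k x]]) auto
  define A where "A = {p \<in> ?W. \<forall>t<k. {p ! t, p ! Suc t} \<noteq> e}"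
  define D where "D i u v = {p \<in> ?W. p ! i = u \<and> p ! Suc i = v \<and> (\<forall>t<i. {p ! t, p ! Suc t} \<noteq> e)}" for i u v
  have ext: "p = q" if "p \<in> walk_lists E k" "q \<in> walk_lists E k" "\<And>i. i \<le> k \<Longrightarrow> p ! i = q ! i" for p q
    by (rule nth_equalityI) (use that in \<open>auto simp: walk_lists_def\<close>)
  have A1: "card A \<le> 1"
  proof -
    have "p = q" if p: "p \<in> A" "q \<in> A" for p q
    proof (rule ext)
      have th: "p \<in> walk_lists E k" "q \<in> walk_lists E k" "p ! 0 = q ! 0" "p ! k = q ! k"
        using p unfolding A_def by auto
      then show "p \<in> walk_lists E k" "q \<in> walk_lists E k" by auto
      have "k - 0 = k - 0 \<and> (\<forall>t\<le>k - 0. p ! (0 + t) = q ! (0 + t))"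
        by (rule prefix_unique[of p k q k]) (use th p in \<open>auto simp: A_def\<close>)
      then show "p ! i = q ! i" if "i \<le> k" for i
        using that by auto
    qed
    then show ?thesis by (intro card_le_1I)
  qed
  have D1: "card (D i u v) \<le> k" if i: "i < k" and uv: "e = {u, v}" for i u v
  proof -
    have "card (D i u v) \<le> card (through u v z (k - i))"
    proof (rule card_inj_on_le[of "drop i"])
      show "inj_on (drop i) (D i u v)"
      proof (rule inj_onI)
        fix p q assume pq: "p \<in> D i u v" "q \<in> D i u v" "drop i p = drop i q"
        have th: "p \<in> walk_lists E k" "q \<in> walk_lists E k" "p ! 0 = q ! 0" "p ! i = q ! i" using pq unfolding D_def by auto
        have same: "i - 0 = i - 0 \<and> (\<forall>t\<le>i - 0. p ! (0 + t) = q ! (0 + t))"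
          by (rule prefix_unique[of p k q k]) (use th i pq in \<open>auto simp: D_def\<close>)
        show "p = q"
        proof (rule ext[OF th(1,2)])
          fix t assume t: "t \<le> k"
          show "p ! t = q ! t"
          proof (cases "t < i")
            case True then show ?thesis using same by simp
          next
            case False
            then have "drop i p ! (t - i) = p ! t" "drop i q ! (t - i) = q ! t"
              using t th unfolding walk_lists_def by auto
            then show ?thesis using pq(3) by simp
          qed
        qed
      qed
      show "drop i ` D i u v \<subseteq> through u v z (k - i)"
      proof
        fix r assume "r \<in> drop i ` D i u v"
        then obtain p where p: "p \<in> D i u v" "r = drop i p" by blast
        have pl: "p \<in> walk_lists E k" "length p = Suc k" using p(1) unfolding D_def walk_lists_def by auto
        have "r \<in> walk_lists E (k - i)" unfolding p(2) by (rule walk_lists_drop[OF pl(1)]) (use i in simp)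
        then show "r \<in> through u v z (k - i)" unfolding through_def p(2)
          using p(1) i pl(2) unfolding D_def by auto
      qed
      show "finite (through u v z (k - i))"
        by (rule finite_subset[OF _ finite_walk_lists[of "k - i" u]]) (auto simp: through_def)
    qed
    also have "\<dots> \<le> k" using card_through[OF uv, of z "k - i"] by simp
    finally show ?thesis .
  qed
  show ?thesis
  proof (cases "\<exists>u v. e = {u, v}")
    case False
    then have "?W = A" unfolding A_def by auto
    then show ?thesis using A1 by simp
  next
    case True
    then obtain u v where uv: "e = {u, v}" by blast
    then have vu: "e = {v, u}" by auto
    have "?W \<subseteq> A \<union> (\<Union>i\<in>{..<k}. D i u v) \<union> (\<Union>i\<in>{..<k}. D i v u)"
    proof
      fix p assume p: "p \<in> ?W"
      show "p \<in> A \<union> (\<Union>i\<in>{..<k}. D i u v) \<union> (\<Union>i\<in>{..<k}. D i v u)"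
      proof (cases "p \<in> A")
        case False
        then have ex: "\<exists>t. t < k \<and> {p ! t, p ! Suc t} = e" using p unfolding A_def by auto
        define i where "i = (LEAST t. t < k \<and> {p ! t, p ! Suc t} = e)"
        have i: "i < k \<and> {p ! i, p ! Suc i} = e" unfolding i_def by (rule LeastI_ex[OF ex])
        have "{p ! t, p ! Suc t} \<noteq> e" if "t < i" for t
          using not_less_Least[of t "\<lambda>t. t < k \<and> {p ! t, p ! Suc t} = e"] that i unfolding i_def by auto
        moreover have "p ! i = u \<and> p ! Suc i = v \<or> p ! i = v \<and> p ! Suc i = u"
          using i uv by (simp add: doubleton_eq_iff)
        ultimately have "p \<in> D i u v \<or> p \<in> D i v u" unfolding D_def using p by simp
        moreover have "i \<in> {..<k}" using i by simp
        ultimately show ?thesis by blast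
      qed simp
    qed
    moreover have "finite A" unfolding A_def by (rule finite_subset[OF _ fin]) blast
    moreover have "finite (D i u' v')" for i u' v' unfolding D_def by (rule finite_subset[OF _ fin]) blast
    ultimately have "card ?W \<le> card (A \<union> (\<Union>i\<in>{..<k}. D i u v) \<union> (\<Union>i\<in>{..<k}. D i v u))"
      by (intro card_mono finite_UnI finite_UN_I finite_lessThan)
    also have "\<dots> \<le> card A + card (\<Union>i\<in>{..<k}. D i u v) + card (\<Union>i\<in>{..<k}. D i v u)" by (rule card_Un3_le)
    finally have c: "card ?W \<le> card A + card (\<Union>i\<in>{..<k}. D i u v) + card (\<Union>i\<in>{..<k}. D i v u)" .
    have "card (\<Union>i\<in>{..<k}. D i u v) \<le> (\<Sum>i\<in>{..<k}. card (D i u v))" by (rule card_UN_le) simp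
    also have "\<dots> \<le> (\<Sum>i\<in>{..<k}. k)" by (rule sum_mono) (use D1 uv in auto)
    finally have c1: "card (\<Union>i\<in>{..<k}. D i u v) \<le> k * k" by simp
    have "card (\<Union>i\<in>{..<k}. D i v u) \<le> (\<Sum>i\<in>{..<k}. card (D i v u))" by (rule card_UN_le) simp
    also have "\<dots> \<le> (\<Sum>i\<in>{..<k}. k)" by (rule sum_mono) (use D1 vu in auto)
    finally have c2: "card (\<Union>i\<in>{..<k}. D i v u) \<le> k * k" by simp
    show ?thesis using c A1 c1 c2 by simp
  qed
qed

end

lemma seg_cong:
  assumes "seg E S L w s t c" "\<And>i. i \<le> t \<Longrightarrow> w i = w' i"
  shows "seg E S L w' s t c"
proof -
  have st: "s < t" using assms(1) unfolding seg_def by simp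
  have "repeats w' s t" if "repeats w s t"
    using that unfolding repeats_def
  proof
    assume "\<exists>j<s. \<forall>i\<le>t - s. w (s + i) = w (j + i)"
    then obtain j where j: "j < s" "\<forall>i\<le>t - s. w (s + i) = w (j + i)" by auto
    have "w' (s + i) = w' (j + i)" if "i \<le> t - s" for i
      using j that st assms(2)[of "s + i"] assms(2)[of "j + i"] by simp
    then show "(\<exists>j<s. \<forall>i\<le>t - s. w' (s + i) = w' (j + i)) \<or> (\<exists>j\<le>s. t - s \<le> j \<and> (\<forall>i\<le>t - s. w' (s + i) = w' (j - i)))"
      using j(1) by (intro disjI1 exI[of _ j]) simp
  next
    assume "\<exists>j\<le>s. t - s \<le> j \<and> (\<forall>i\<le>t - s. w (s + i) = w (j - i))"
    then obtain j where j: "j \<le> s" "t - s \<le> j" "\<forall>i\<le>t - s. w (s + i) = w (j - i)" by auto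
    have "w' (s + i) = w' (j - i)" if "i \<le> t - s" for i
      using j that st assms(2)[of "s + i"] assms(2)[of "j - i"] by simp
    then show "(\<exists>j<s. \<forall>i\<le>t - s. w' (s + i) = w' (j + i)) \<or> (\<exists>j\<le>s. t - s \<le> j \<and> (\<forall>i\<le>t - s. w' (s + i) = w' (j - i)))"
      using j(1,2) by (intro disjI2 exI[of _ j]) simp
  qed
  moreover have "w ` {..s} = w' ` {..s}" using st assms(2) by (intro image_cong) auto
  moreover have "w t = w' t" using assms(2) by simp
  ultimately show ?thesis using assms(1) unfolding seg_def by auto
qed

text \<open>Segmentability up to \<open>t\<close> only sees the walk up to \<open>t\<close>. This
  allows the last segment of a list to be removed and the prefix to be treated as a walk of its
  own.\<close>

lemma segs_cong: "segs E S L w t q B \<Longrightarrow> (\<And>i. i \<le> t \<Longrightarrow> w i = w' i) \<Longrightarrow> segs E S L w' t q B"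
proof (induction rule: segs.induct)
  case segs_0
  then show ?case by (intro segs.segs_0)
next
  case (segs_Suc s q B t c)
  have "s < t" using segs_Suc.hyps(2) unfolding seg_def by simp
  then have "segs E S L w' s q B" by (intro segs_Suc.IH) (use segs_Suc.prems in simp)
  moreover have "seg E S L w' s t c" by (rule seg_cong[OF segs_Suc.hyps(2)]) (use segs_Suc.prems in simp)
  ultimately show ?case by (rule segs.segs_Suc)
qed

lemma segs_zero: "segs E S L w t 0 B \<Longrightarrow> t = 0 \<and> B = 0"
  by (auto elim: segs.cases)

lemma segs_SucE:
  assumes "segs E S L w t (Suc q) B"
  obtains s c B' where "segs E S L w s q B'" "seg E S L w s t c" "B = B' + c"
  using assms by (auto elim: segs.cases)

lemma dist_le_ball:
  assumes "dist_le E k x y" "real k \<le> R"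
  shows "y \<in> graph_ball E x R"
proof -
  obtain j where j: "j \<le> k" "(x, y) \<in> adj_rel E ^^ j" using assms(1) unfolding dist_le_def by blast
  have "graph_dist E x y \<le> j" unfolding graph_dist_def by (rule Least_le) (rule j(2))
  moreover have "(x, y) \<in> (adj_rel E)\<^sup>*" using j(2) relpow_imp_rtrancl by blast
  ultimately show ?thesis unfolding graph_ball_def using j(1) assms(2) by simp
qed

text \<open>A shortest walk cannot backtrack. Balls can therefore be counted by nonbacktracking
  walks, with growth \<open>d - 1\<close> rather than \<open>d\<close>.\<close>

lemma dist_le_nbwalk:
  assumes "dist_le E c y z"
  shows "\<exists>j\<le>c. \<exists>p\<in>walk_lists E j. p ! 0 = y \<and> p ! j = z"
proof -
  define m where "m = (LEAST k. (y, z) \<in> adj_rel E ^^ k)"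
  obtain j where j: "j \<le> c" "(y, z) \<in> adj_rel E ^^ j" using assms unfolding dist_le_def by blast
  have m: "(y, z) \<in> adj_rel E ^^ m" unfolding m_def by (rule LeastI[of _ j]) (rule j(2))
  have mj: "m \<le> j" unfolding m_def by (rule Least_le) (rule j(2))
  obtain f where f: "f 0 = y" "f m = z" "\<forall>i<m. (f i, f (Suc i)) \<in> adj_rel E"
    using m unfolding relpow_fun_conv by auto
  have fe: "{f i, f (Suc i)} \<in> E" if "i < m" for i using f(3) that unfolding adj_rel_def by simp
  have nb: "f (Suc (Suc t)) \<noteq> f t" if t: "Suc (Suc t) \<le> m" for t
  proof
    assume eq: "f (Suc (Suc t)) = f t"
    have "(f 0, f t) \<in> adj_rel E ^^ (t - 0)" by (rule path_relpow) (use fe t in auto)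
    moreover have "(f (Suc (Suc t)), f m) \<in> adj_rel E ^^ (m - Suc (Suc t))" by (rule path_relpow) (use fe t in auto)
    ultimately have "(y, z) \<in> adj_rel E ^^ (t + (m - Suc (Suc t)))"
      unfolding relpow_add using f(1,2) eq by auto
    then have "m \<le> t + (m - Suc (Suc t))" unfolding m_def by (rule Least_le)
    then show False using t by simp
  qed
  have nth: "map f [0..<Suc m] ! i = f i" if "i \<le> m" for i using that by (simp del: upt_Suc)
  have "nbwalk E f m" unfolding nbwalk_def using fe nb by simp
  then have "nbwalk E ((!) (map f [0..<Suc m])) m" using nbwalk_cong[of m "(!) (map f [0..<Suc m])" f E] nth by blast
  then have "map f [0..<Suc m] \<in> walk_lists E m" unfolding walk_lists_def by simp
  moreover have "map f [0..<Suc m] ! 0 = y" "map f [0..<Suc m] ! m = z" using nth f by simp_all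
  ultimately show ?thesis using mj j(1) by (intro exI[of _ m] conjI bexI[of _ "map f [0..<Suc m]"]) simp_all
qed

section \<open>Walks and balls in regular bicycle-free graphs\<close>

locale regular =
  fixes n :: nat and E :: "edge set" and d :: nat
  assumes sg: "simple_graph n E" and rg: "regular_graph n E d" and d: "2 \<le> d"
begin

lemma edge_lt: "{u, v} \<in> E \<Longrightarrow> u < n \<and> v < n \<and> u \<noteq> v"
proof -
  assume "{u, v} \<in> E"
  then have "\<exists>a b. a < n \<and> b < n \<and> a \<noteq> b \<and> {u, v} = {a, b}" using sg unfolding simple_graph_def by (rule_tac bspec)
  then obtain a b where "a < n" "b < n" "a \<noteq> b" "{u, v} = {a, b}" by (elim exE conjE)
  then show ?thesis by (auto simp: doubleton_eq_iff)
qed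

lemma loop_free: "\<forall>v. {v} \<notin> E" using edge_lt by (metis insert_absorb2)

lemma finite_vertices: "finite (\<Union>E)"
proof (rule finite_subset)
  show "\<Union>E \<subseteq> {..<n}" using sg unfolding simple_graph_def by fastforce
qed simp

lemma neighbors: "x < n \<Longrightarrow> finite {v. {x, v} \<in> E} \<and> card {v. {x, v} \<in> E} = d"
proof
  show "finite {v. {x, v} \<in> E}" by (rule finite_subset[of _ "{..<n}"]) (use edge_lt in auto)
  show "x < n \<Longrightarrow> card {v. {x, v} \<in> E} = d" using rg unfolding regular_graph_def by simp
qed

definition walks_from :: "nat \<Rightarrow> nat \<Rightarrow> nat list set" where "walks_from x k = {p \<in> walk_lists E k. p ! 0 = x}"

lemma walk_lt:
  assumes "p \<in> walk_lists E k" "p ! 0 < n" "i \<le> k"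
  shows "p ! i < n"
proof (cases i)
  case (Suc j)
  then have "{p ! j, p ! Suc j} \<in> E" using assms unfolding walk_lists_def nbwalk_def by simp
  then show ?thesis using edge_lt Suc by simp
qed (use assms in simp)

lemma finite_walks: "finite {p \<in> walk_lists E k. p ! 0 < n}"
proof (rule finite_subset)
  show "{p \<in> walk_lists E k. p ! 0 < n} \<subseteq> {p. set p \<subseteq> {..<n} \<and> length p = Suc k}"
  proof
    fix p assume p: "p \<in> {p \<in> walk_lists E k. p ! 0 < n}"
    then have len: "length p = Suc k" unfolding walk_lists_def by simp
    have "p ! i < n" if "i < length p" for i using walk_lt[of p k i] p len that by simp
    then have "set p \<subseteq> {..<n}" by (auto simp: in_set_conv_nth)
    then show "p \<in> {p. set p \<subseteq> {..<n} \<and> length p = Suc k}" using len by simp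
  qed
  show "finite {p. set p \<subseteq> {..<n} \<and> length p = Suc k}" by (rule finite_lists_length_eq) simp
qed

lemma finite_walks_from: "x < n \<Longrightarrow> finite (walks_from x k)"
  by (rule finite_subset[OF _ finite_walks[of k]]) (auto simp: walks_from_def)

lemma walk_lists_snoc:
  "q \<in> walk_lists E (Suc k) \<longleftrightarrow> (\<exists>p v. q = p @ [v] \<and> p \<in> walk_lists E k \<and> {p ! k, v} \<in> E \<and> (\<forall>j. k = Suc j \<longrightarrow> v \<noteq> p ! j))"
proof
  assume q: "q \<in> walk_lists E (Suc k)"
  then have len: "length q = Suc (Suc k)" unfolding walk_lists_def by simp
  define p where "p = butlast q"
  define v where "v = last q"
  have qp: "q = p @ [v]" unfolding p_def v_def using len by (metis append_butlast_last_id list.size(3) nat.simps(3))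
  have lp: "length p = Suc k" unfolding p_def using len by simp
  have nth: "q ! i = p ! i" if "i \<le> k" for i using qp lp that by (simp add: nth_append)
  have qv: "q ! Suc k = v" using qp lp by (metis nth_append_length)
  have nq: "nbwalk E ((!) q) (Suc k)" using q unfolding walk_lists_def by simp
  then have "nbwalk E ((!) q) k" by (rule nbwalk_take) simp
  then have "nbwalk E ((!) p) k" using nbwalk_cong[of k "(!) q" "(!) p" E] nth by simp
  then have "p \<in> walk_lists E k" unfolding walk_lists_def using lp by simp
  moreover have "{p ! k, v} \<in> E" using nq nth[of k] qv unfolding nbwalk_def by auto
  moreover have "v \<noteq> p ! j" if "k = Suc j" for j using nq nth[of j] qv that unfolding nbwalk_def by auto
  ultimately show "\<exists>p v. q = p @ [v] \<and> p \<in> walk_lists E k \<and> {p ! k, v} \<in> E \<and> (\<forall>j. k = Suc j \<longrightarrow> v \<noteq> p ! j)"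
    using qp by (intro exI[of _ p] exI[of _ v]) simp
next
  assume "\<exists>p v. q = p @ [v] \<and> p \<in> walk_lists E k \<and> {p ! k, v} \<in> E \<and> (\<forall>j. k = Suc j \<longrightarrow> v \<noteq> p ! j)"
  then obtain p v where p: "q = p @ [v]" "p \<in> walk_lists E k" "{p ! k, v} \<in> E" "\<forall>j. k = Suc j \<longrightarrow> v \<noteq> p ! j" by (elim exE conjE)
  have lp: "length p = Suc k" "nbwalk E ((!) p) k" using p(2) unfolding walk_lists_def by simp_all
  have nth: "q ! i = p ! i" if "i \<le> k" for i using p(1) lp that by (simp add: nth_append)
  have qv: "q ! Suc k = v" using p(1) lp(1) by (metis nth_append_length)
  have "nbwalk E ((!) q) (Suc k)"
    unfolding nbwalk_def
  proof (intro conjI allI impI)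
    fix t assume "t < Suc k"
    then show "{q ! t, q ! Suc t} \<in> E"
      using nth[of t] nth[of "Suc t"] qv p(3) lp(2) unfolding nbwalk_def by (cases "t = k") auto
  next
    fix t assume t: "Suc (Suc t) \<le> Suc k"
    show "q ! Suc (Suc t) \<noteq> q ! t"
    proof (cases "Suc t = k")
      case True
      then show ?thesis using nth[of t] qv p(4) by auto
    next
      case False
      then show ?thesis using t nth[of t] nth[of "Suc (Suc t)"] lp(2) unfolding nbwalk_def by auto
    qed
  qed
  then show "q \<in> walk_lists E (Suc k)" unfolding walk_lists_def using p(1) lp by simp
qed

definition next_vertices :: "nat \<Rightarrow> nat list \<Rightarrow> nat set" where
  "next_vertices k p = {v. {p ! k, v} \<in> E \<and> (\<forall>j. k = Suc j \<longrightarrow> v \<noteq> p ! j)}"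

lemma walks_from_Suc: "walks_from x (Suc k) = (\<Union>p\<in>walks_from x k. (\<lambda>v. p @ [v]) ` next_vertices k p)"
proof -
  have nz: "(p @ [v]) ! 0 = p ! 0" if "p \<in> walk_lists E k" for p v
    using that unfolding walk_lists_def by (auto simp: nth_append)
  show ?thesis
  proof (intro equalityI subsetI)
    fix q assume q: "q \<in> walks_from x (Suc k)"
    then obtain p v where p: "q = p @ [v]" "p \<in> walk_lists E k" "{p ! k, v} \<in> E" "\<forall>j. k = Suc j \<longrightarrow> v \<noteq> p ! j"
      unfolding walks_from_def walk_lists_snoc mem_Collect_eq by (elim exE conjE)
    have "p ! 0 = x" using q nz[OF p(2)] p(1) unfolding walks_from_def by simp
    then have "p \<in> walks_from x k" "v \<in> next_vertices k p" using p unfolding walks_from_def next_vertices_def by simp_all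
    then show "q \<in> (\<Union>p\<in>walks_from x k. (\<lambda>v. p @ [v]) ` next_vertices k p)" using p(1) by blast
  next
    fix q assume "q \<in> (\<Union>p\<in>walks_from x k. (\<lambda>v. p @ [v]) ` next_vertices k p)"
    then obtain p v where p: "p \<in> walks_from x k" "v \<in> next_vertices k p" "q = p @ [v]" by blast
    then have "q \<in> walk_lists E (Suc k)" unfolding walk_lists_snoc walks_from_def next_vertices_def by (intro exI[of _ p] exI[of _ v]) simp
    moreover have "q ! 0 = x" using p nz unfolding walks_from_def by simp
    ultimately show "q \<in> walks_from x (Suc k)" unfolding walks_from_def by simp
  qed
qed

lemma next_vertices_card:
  assumes "p \<in> walks_from x k" "x < n"
  shows "finite (next_vertices k p)" "card (next_vertices k p) = (if k = 0 then d else d - 1)"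
proof -
  have pk: "p ! k < n" using walk_lt[of p k k] assms unfolding walks_from_def by simp
  note N = neighbors[OF pk]
  show "finite (next_vertices k p)" unfolding next_vertices_def by (rule finite_subset[OF _ conjunct1[OF N]]) auto
  show "card (next_vertices k p) = (if k = 0 then d else d - 1)"
  proof (cases k)
    case 0
    then show ?thesis unfolding next_vertices_def using N by simp
  next
    case (Suc j)
    have "{p ! j, p ! k} \<in> E" using assms Suc unfolding walks_from_def walk_lists_def nbwalk_def by simp
    then have "p ! j \<in> {v. {p ! k, v} \<in> E}" by (simp add: insert_commute)
    moreover have "next_vertices k p = {v. {p ! k, v} \<in> E} - {p ! j}" unfolding next_vertices_def using Suc by auto
    ultimately show ?thesis using N Suc by simp
  qed
qed

lemma card_walks_from: "x < n \<Longrightarrow> card (walks_from x k) \<le> d * (d - 1) ^ (k - 1)"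
proof (induction k)
  case 0
  have "card (walks_from x 0) \<le> 1"
  proof (rule card_le_1I)
    fix p q assume "p \<in> walks_from x 0" "q \<in> walks_from x 0"
    then show "p = q" unfolding walks_from_def walk_lists_def by (intro nth_equalityI) auto
  qed
  then show ?case using d by simp
next
  case (Suc k)
  show ?case
  proof (cases k)
    case 0
    have "card (walks_from x (Suc 0)) \<le> card (walks_from x 0) * d" unfolding walks_from_Suc
    proof (rule card_UN_bound[OF finite_walks_from[OF Suc(2)]])
      fix p assume "p \<in> walks_from x 0"
      then show "card ((\<lambda>v. p @ [v]) ` next_vertices 0 p) \<le> d"
        using card_image_le[OF next_vertices_card(1)[of p x 0], of "\<lambda>v. p @ [v]"] next_vertices_card(2)[of p x 0] Suc(2) by simp
    qed
    moreover have "card (walks_from x 0) \<le> 1"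
    proof (rule card_le_1I)
      fix p q assume "p \<in> walks_from x 0" "q \<in> walks_from x 0"
      then show "p = q" unfolding walks_from_def walk_lists_def by (intro nth_equalityI) auto
    qed
    ultimately have "card (walks_from x (Suc 0)) \<le> 1 * d" by (meson le_trans mult_le_mono1)
    then show ?thesis using 0 by simp
  next
    case (Suc j)
    have "card (walks_from x (Suc k)) \<le> card (walks_from x k) * (d - 1)" unfolding walks_from_Suc
    proof (rule card_UN_bound[OF finite_walks_from[OF Suc.prems]])
      fix p assume "p \<in> walks_from x k"
      then show "card ((\<lambda>v. p @ [v]) ` next_vertices k p) \<le> d - 1"
        using card_image_le[OF next_vertices_card(1)[of p x k], of "\<lambda>v. p @ [v]"] next_vertices_card(2)[of p x k] Suc.prems Suc by simp
    qed
    also have "\<dots> \<le> (d * (d - 1) ^ (k - 1)) * (d - 1)" using Suc.IH[OF Suc.prems] by (rule mult_le_mono1)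
    finally show ?thesis using Suc by (simp add: ac_simps)
  qed
qed

lemma card_walks_from': "x < n \<Longrightarrow> k \<le> c \<Longrightarrow> card (walks_from x k) \<le> d * (d - 1) ^ c"
proof -
  assume x: "x < n" and k: "k \<le> c"
  have "(d - 1) ^ (k - 1) \<le> (d - 1) ^ c" by (rule power_increasing) (use d k in auto)
  then show ?thesis using card_walks_from[OF x, of k] by (meson le_trans mult_le_mono2)
qed

lemma card_dist_le: "y < n \<Longrightarrow> finite {z. dist_le E c y z} \<and> card {z. dist_le E c y z} \<le> (c + 1) * (d * (d - 1) ^ c)"
proof -
  assume y: "y < n"
  have sub: "{z. dist_le E c y z} \<subseteq> (\<Union>j\<in>{..c}. (\<lambda>p. p ! j) ` walks_from y j)"
  proof
    fix z assume "z \<in> {z. dist_le E c y z}"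
    then obtain j p where "j \<le> c" "p \<in> walk_lists E j" "p ! 0 = y" "p ! j = z" using dist_le_nbwalk[of E c y z] by auto
    then show "z \<in> (\<Union>j\<in>{..c}. (\<lambda>p. p ! j) ` walks_from y j)" unfolding walks_from_def by auto
  qed
  have fin: "finite (\<Union>j\<in>{..c}. (\<lambda>p. p ! j) ` walks_from y j)" using finite_walks_from[OF y] by simp
  have "card {z. dist_le E c y z} \<le> card (\<Union>j\<in>{..c}. (\<lambda>p. p ! j) ` walks_from y j)" by (rule card_mono[OF fin sub])
  also have "\<dots> \<le> card {..c} * (d * (d - 1) ^ c)"
  proof (rule card_UN_bound)
    fix j assume "j \<in> {..c}"
    then show "card ((\<lambda>p. p ! j) ` walks_from y j) \<le> d * (d - 1) ^ c"
      using card_image_le[OF finite_walks_from[OF y, of j], of "\<lambda>p. p ! j"] card_walks_from'[OF y, of j c] by simp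
  qed simp
  finally show ?thesis using finite_subset[OF sub fin] by simp
qed

context
  fixes R :: real
  assumes bf: "bicycle_free n E R"
begin

abbreviation "ball_edges x \<equiv> induced_edges E (graph_ball E x R)"

lemma one_cycle_ball: "x < n \<Longrightarrow> \<exists>e. one_cycle (ball_edges x) e"
proof -
  assume x: "x < n"
  have u: "C = D" if "graph_cycle (ball_edges x) C" "graph_cycle (ball_edges x) D" for C D
    using bf x that unfolding bicycle_free_def by simp
  have gm: "graph_cycle (ball_edges x) C" if "graph_cycle (ball_edges x - {e}) C" for C e
    using that unfolding graph_cycle_def by blast
  have sub: "ball_edges x \<subseteq> E" unfolding induced_edges_def by blast
  have base: "\<forall>v. {v} \<notin> ball_edges x" "finite (\<Union>(ball_edges x))" using loop_free sub finite_subset[OF Union_mono[OF sub] finite_vertices] by auto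
  show ?thesis
  proof (cases "\<exists>C. graph_cycle (ball_edges x) C")
    case True
    then obtain C where C: "graph_cycle (ball_edges x) C" by blast
    then obtain p where p: "3 \<le> length p" "C = cycle_edges p" unfolding graph_cycle_def by blast
    have "{p ! 0, p ! (Suc 0 mod length p)} \<in> C" unfolding p(2) cycle_edges_def using p(1) by (intro CollectI exI[of _ 0]) auto
    then obtain e where e: "e \<in> C" by blast
    have "\<not> graph_cycle (ball_edges x - {e}) D" for D
    proof
      assume D: "graph_cycle (ball_edges x - {e}) D"
      then have "D = C" using u[OF gm[OF D] C] by simp
      moreover have "e \<notin> D" using D unfolding graph_cycle_def by blast
      ultimately show False using e by simp
    qed
    then show ?thesis using base by (intro exI[of _ e] one_cycle.intro)
  next
    case False
    then have "\<not> graph_cycle (ball_edges x - {{}}) D" for D using gm by blast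
    \<comment> \<open>The ball is already a forest; the empty set is a dummy for the deleted
      edge.\<close>
    then show ?thesis using base by (intro exI[of _ "{}"] one_cycle.intro)
  qed
qed

lemma card_between:
  assumes x: "x < n" and k: "real k \<le> R"
  shows "card {p \<in> walks_from x k. p ! k = z} \<le> 1 + 2 * k * k"
proof -
  obtain e where "one_cycle (ball_edges x) e" using one_cycle_ball[OF x] by blast
  then interpret oc: one_cycle "ball_edges x" e .
  have "{p \<in> walks_from x k. p ! k = z} \<subseteq> {p \<in> walk_lists (ball_edges x) k. p ! 0 = x \<and> p ! k = z}"
  proof
    fix p assume p: "p \<in> {p \<in> walks_from x k. p ! k = z}"
    then have nb: "nbwalk E ((!) p) k" "p ! 0 = x" unfolding walks_from_def walk_lists_def by simp_all
    have ball: "p ! i \<in> graph_ball E x R" if "i \<le> k" for i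
    proof -
      have "dist_le E (i - 0) (p ! 0) (p ! i)" by (rule dist_le_path) (use nb that in \<open>auto simp: nbwalk_def\<close>)
      then show ?thesis using dist_le_ball[of E i x "p ! i" R] nb(2) that k by simp
    qed
    have "nbwalk (ball_edges x) ((!) p) k"
    proof (rule nbwalk_mono[OF nb(1)])
      fix t assume t: "t < k"
      have "{p ! t, p ! Suc t} \<in> E" using nb(1) t unfolding nbwalk_def by simp
      then show "{p ! t, p ! Suc t} \<in> ball_edges x" unfolding induced_edges_def using ball[of t] ball[of "Suc t"] t by simp
    qed
    then show "p \<in> {p \<in> walk_lists (ball_edges x) k. p ! 0 = x \<and> p ! k = z}" using p unfolding walks_from_def walk_lists_def by simp
  qed
  then have "card {p \<in> walks_from x k. p ! k = z} \<le> card {p \<in> walk_lists (ball_edges x) k. p ! 0 = x \<and> p ! k = z}"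
    by (rule card_mono[rotated]) (rule finite_subset[OF _ oc.finite_walk_lists[of k x]], auto)
  then show ?thesis using oc.card_walk_lists_between[of k x z] by linarith
qed

text \<open>A cycle of length at most \<open>l\<close> through a vertex at distance at most
  \<open>k\<close> lies in the ball of radius \<open>k + l\<close>. That ball contains only one
  cycle, so all these vertices lie on it.\<close>

lemma card_near_cycle:
  assumes x: "x < n" and k: "real (k + l) \<le> R"
  shows "finite {y \<in> short_cycle_verts E l. dist_le E k x y} \<and> card {y \<in> short_cycle_verts E l. dist_le E k x y} \<le> l"
proof (cases "{y \<in> short_cycle_verts E l. dist_le E k x y} = {}")
  case False
  have cyc: "\<exists>p. graph_cycle (ball_edges x) (cycle_edges p) \<and> y \<in> set p \<and> length p \<le> l \<and> p \<noteq> []"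
    if y: "y \<in> short_cycle_verts E l" "dist_le E k x y" for y
  proof -
    obtain p where p: "distinct p" "3 \<le> length p" "length p \<le> l" "y \<in> set p"
      "\<forall>i<length p. {p ! i, p ! (Suc i mod length p)} \<in> E"
      using y(1) unfolding short_cycle_verts_def mem_Collect_eq by (elim exE conjE)
    obtain i where i: "i < length p" "y = p ! i" using p(4) by (auto simp: in_set_conv_nth)
    have e: "{p ! t, p ! Suc t} \<in> E" if "Suc t < length p" for t using p(5)[rule_format, of t] that by simp
    have dp: "dist_le E (j' - j) (p ! j) (p ! j')" if "j \<le> j'" "j' < length p" for j j'
      by (rule dist_le_path) (use e that in auto)
    have "dist_le E l y (p ! j)" if j: "j < length p" for j
    proof (cases "i \<le> j")
      case True
      show ?thesis unfolding i(2) by (rule dist_le_mono[OF dp[OF True j]]) (use p(3) j in simp)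
    next
      case False
      then have "dist_le E (i - j) (p ! j) (p ! i)" using dp[of j i] i by simp
      then have "dist_le E (i - j) (p ! i) (p ! j)" by (rule dist_le_sym)
      then show ?thesis unfolding i(2) by (rule dist_le_mono) (use p(3) i(1) in simp)
    qed
    then have ball: "p ! j \<in> graph_ball E x R" if "j < length p" for j
      using dist_le_ball[OF dist_le_trans[OF y(2)] k] that by simp
    have "cycle_edges p \<subseteq> ball_edges x"
    proof
      fix f assume "f \<in> cycle_edges p"
      then obtain j where j: "j < length p" "f = {p ! j, p ! (Suc j mod length p)}" unfolding cycle_edges_def by auto
      have "Suc j mod length p < length p" using j(1) by (intro mod_less_divisor) linarith
      then show "f \<in> ball_edges x" unfolding induced_edges_def using j p(5) ball by simp
    qed
    then have "graph_cycle (ball_edges x) (cycle_edges p)" unfolding graph_cycle_def using p by (intro exI[of _ p]) simp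
    moreover have "p \<noteq> []" using p(2) by auto
    ultimately show ?thesis using p by (intro exI[of _ p]) simp
  qed
  from False obtain y0 where y0: "y0 \<in> short_cycle_verts E l" "dist_le E k x y0" by blast
  obtain p0 where p0: "graph_cycle (ball_edges x) (cycle_edges p0)" "length p0 \<le> l" "p0 \<noteq> []" using cyc[OF y0] by (elim exE conjE)
  have sub: "{y \<in> short_cycle_verts E l. dist_le E k x y} \<subseteq> set p0"
  proof
    fix y assume "y \<in> {y \<in> short_cycle_verts E l. dist_le E k x y}"
    then have "y \<in> short_cycle_verts E l" "dist_le E k x y" by simp_all
    from cyc[OF this] obtain p where p: "graph_cycle (ball_edges x) (cycle_edges p)" "y \<in> set p" "p \<noteq> []" by (elim exE conjE)
    have "cycle_edges p = cycle_edges p0" using bf x p(1) p0(1) unfolding bicycle_free_def by simp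
    then have "set p = set p0" using Union_cycle_edges[OF p(3)] Union_cycle_edges[OF p0(3)] by simp
    then show "y \<in> set p0" using p(2) by simp
  qed
  have "card {y \<in> short_cycle_verts E l. dist_le E k x y} \<le> card (set p0)" by (rule card_mono[OF _ sub]) simp
  then show ?thesis using card_length[of p0] p0(2) finite_subset[OF sub] by simp
next
  case True
  show ?thesis unfolding True by simp
qed

end
end

text \<open>The radius covers a short segment (\<open>L\<close> steps), the route from its endpoint
  to a vertex on a short cycle (\<open>L\<close> steps) and that cycle (\<open>l\<close>
  vertices).\<close>

locale regular_bicycle_free = regular +
  fixes R :: real and L l T :: nat
  assumes bf: "bicycle_free n E R" and R: "real (2 * L + l) \<le> R"
begin

abbreviation "S \<equiv> short_cycle_verts E l"

text \<open>
  The summands account for the three kinds of segment: free, repeated, and short with known endpoint.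
\<close>

definition ext_factor :: nat where "ext_factor = d + (2 * T + 1) + (T + 1 + l) * ((L + 1) * d) * (1 + 2 * L * L)"

definition extensions :: "nat list \<Rightarrow> nat \<Rightarrow> nat \<Rightarrow> nat \<Rightarrow> nat list set" where
  "extensions p0 s t c = {p \<in> walk_lists E t. take (Suc s) p = p0 \<and> seg E S L ((!) p) s t c}"

lemma take_eq_nth: "take (Suc s) p = p0 \<Longrightarrow> i \<le> s \<Longrightarrow> p ! i = p0 ! i"
  using nth_take[of i "Suc s" p] by auto

lemma walk_list_eqI: "p \<in> walk_lists E t \<Longrightarrow> q \<in> walk_lists E t \<Longrightarrow> (\<And>i. i \<le> t \<Longrightarrow> p ! i = q ! i) \<Longrightarrow> p = q"
  unfolding walk_lists_def by (rule nth_equalityI) auto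

lemma S_lt: "y \<in> S \<Longrightarrow> y < n"
proof -
  assume "y \<in> S"
  then obtain p where p: "y \<in> set p" "\<forall>i<length p. {p ! i, p ! (Suc i mod length p)} \<in> E"
    unfolding short_cycle_verts_def mem_Collect_eq by (elim exE conjE)
  then obtain i where "i < length p" "y = p ! i" by (auto simp: in_set_conv_nth)
  then show ?thesis using p(2) edge_lt by auto
qed

lemma card_extensions:
  assumes p0: "p0 \<in> walk_lists E s" "p0 ! 0 < n" and st: "s < t" "t \<le> T"
  shows "card (extensions p0 s t c) \<le> ext_factor * (d - 1) ^ c"
proof -
  define x where "x = p0 ! s"
  have x: "x < n" unfolding x_def by (rule walk_lt[OF p0]) simp
  define XN where "XN = {p \<in> extensions p0 s t c. c = t - s}"
  define XU where "XU j = {p \<in> extensions p0 s t c. \<forall>i\<le>t - s. p ! (s + i) = p ! (j + i)}" for j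
  define XD where "XD j = {p \<in> extensions p0 s t c. \<forall>i\<le>t - s. p ! (s + i) = p ! (j - i)}" for j
  define A where "A = {y \<in> S. dist_le E (2 * L) x y}"
  define Z where "Z = (\<Union>y\<in>set p0 \<union> A. {z. dist_le E c y z})"
  define XE where "XE = {p \<in> extensions p0 s t c. t - s \<le> L \<and> c \<le> L \<and> p ! t \<in> Z}"
  have X: "p \<in> walk_lists E t" "length p = Suc t" "\<And>i. i \<le> s \<Longrightarrow> p ! i = p0 ! i" if "p \<in> extensions p0 s t c" for p
    using that take_eq_nth[of s p p0] unfolding extensions_def walk_lists_def by simp_all
  have finX: "finite (extensions p0 s t c)"
  proof (rule finite_subset[OF _ finite_walks[of t]])
    show "extensions p0 s t c \<subseteq> {p \<in> walk_lists E t. p ! 0 < n}"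
    proof
      fix p assume "p \<in> extensions p0 s t c"
      then show "p \<in> {p \<in> walk_lists E t. p ! 0 < n}" using X(1)[of p] X(3)[of p 0] p0(2) by simp
    qed
  qed
  have dropinj: "inj_on (drop s) (extensions p0 s t c)"
  proof (rule inj_onI)
    fix p q assume pq: "p \<in> extensions p0 s t c" "q \<in> extensions p0 s t c" "drop s p = drop s q"
    have "take (Suc s) p = take (Suc s) q" using pq(1,2) unfolding extensions_def by simp
    then have "take s (take (Suc s) p) = take s (take (Suc s) q)" by simp
    then have "take s p = take s q" by simp
    then have "take s p @ drop s p = take s q @ drop s q" using pq(3) by simp
    then show "p = q" by simp
  qed
  have dropNBW: "drop s p \<in> walks_from x (t - s)" "drop s p ! (t - s) = p ! t" if "p \<in> extensions p0 s t c" for p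
  proof -
    have "drop s p \<in> walk_lists E (t - s)" by (rule walk_lists_drop[OF X(1)[OF that]]) (use st in simp)
    then show "drop s p \<in> walks_from x (t - s)" unfolding walks_from_def x_def using X[OF that] st by simp
    show "drop s p ! (t - s) = p ! t" using X(2)[OF that] st by simp
  qed
  have cN: "card XN \<le> d * (d - 1) ^ c"
  proof (cases "c = t - s")
    case True
    have "card XN \<le> card (walks_from x (t - s))"
    proof (rule card_inj_on_le[of "drop s"])
      show "inj_on (drop s) XN" by (rule inj_on_subset[OF dropinj]) (simp add: XN_def)
      show "drop s ` XN \<subseteq> walks_from x (t - s)"
      proof
        fix q assume "q \<in> drop s ` XN"
        then obtain p where "p \<in> extensions p0 s t c" "q = drop s p" unfolding XN_def by auto
        then show "q \<in> walks_from x (t - s)" using dropNBW(1) by simp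
      qed
    qed (rule finite_walks_from[OF x])
    also have "\<dots> \<le> d * (d - 1) ^ c" by (rule card_walks_from'[OF x]) (use True in simp)
    finally show ?thesis .
  next
    case False
    then show ?thesis unfolding XN_def by simp
  qed
  have cU: "card (XU j) \<le> 1" if j: "j < s" for j
  proof (rule card_le_1I)
    fix p q assume p: "p \<in> XU j" "q \<in> XU j"
    then have pX: "p \<in> extensions p0 s t c" "q \<in> extensions p0 s t c" unfolding XU_def by simp_all
    \<comment> \<open>Strong induction is needed because the repeated stretch may run into the new
      one: \<open>j + (i - s)\<close> can exceed \<open>s\<close>, but it is always smaller than
      \<open>i\<close>.\<close>
    have "p ! i = q ! i" if "i \<le> t" for i
      using that
    proof (induction i rule: less_induct)
      case (less i)
      show ?case
      proof (cases "i \<le> s")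
        case True
        then show ?thesis using X(3)[OF pX(1)] X(3)[OF pX(2)] by simp
      next
        case False
        have "p ! (s + (i - s)) = p ! (j + (i - s))" "q ! (s + (i - s)) = q ! (j + (i - s))"
          using p less.prems unfolding XU_def by auto
        moreover have "p ! (j + (i - s)) = q ! (j + (i - s))" by (rule less.IH) (use j False less.prems in auto)
        ultimately show ?thesis using False by simp
      qed
    qed
    then show "p = q" by (rule walk_list_eqI[OF X(1)[OF pX(1)] X(1)[OF pX(2)]])
  qed
  have cD: "card (XD j) \<le> 1" if j: "j \<le> s" for j
  proof (rule card_le_1I)
    fix p q assume p: "p \<in> XD j" "q \<in> XD j"
    then have pX: "p \<in> extensions p0 s t c" "q \<in> extensions p0 s t c" unfolding XD_def by simp_all
    have "p ! i = q ! i" if i: "i \<le> t" for i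
    proof (cases "i \<le> s")
      case True
      then show ?thesis using X(3)[OF pX(1)] X(3)[OF pX(2)] by simp
    next
      case False
      have "p ! (s + (i - s)) = p ! (j - (i - s))" "q ! (s + (i - s)) = q ! (j - (i - s))"
        using p i unfolding XD_def by auto
      moreover have "p ! (j - (i - s)) = q ! (j - (i - s))"
        using X(3)[OF pX(1), of "j - (i - s)"] X(3)[OF pX(2), of "j - (i - s)"] j by simp
      ultimately show ?thesis using False by simp
    qed
    then show "p = q" by (rule walk_list_eqI[OF X(1)[OF pX(1)] X(1)[OF pX(2)]])
  qed
  have cE: "card XE \<le> (T + 1 + l) * ((L + 1) * d) * (1 + 2 * L * L) * (d - 1) ^ c"
  proof (cases "t - s \<le> L \<and> c \<le> L")
    case True
    have lt: "y < n" if "y \<in> set p0 \<union> A" for y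
    proof -
      have "y < n" if "y \<in> set p0"
      proof -
        obtain i where "i < length p0" "y = p0 ! i" using \<open>y \<in> set p0\<close> by (auto simp: in_set_conv_nth)
        then show ?thesis using walk_lt[OF p0, of i] p0(1) unfolding walk_lists_def by simp
      qed
      then show ?thesis using that S_lt unfolding A_def by auto
    qed
    have fA: "finite A \<and> card A \<le> l" unfolding A_def by (rule card_near_cycle[OF bf x R])
    have "card (set p0 \<union> A) \<le> card (set p0) + card A" by (rule card_Un_le)
    also have "card (set p0) \<le> Suc s" using card_length[of p0] p0(1) unfolding walk_lists_def by simp
    finally have cA: "card (set p0 \<union> A) \<le> T + 1 + l" using fA st by simp
    have finZ: "finite Z" unfolding Z_def using fA card_dist_le[OF lt] by simp
    have "card Z \<le> card (set p0 \<union> A) * ((c + 1) * (d * (d - 1) ^ c))"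
      unfolding Z_def by (rule card_UN_bound) (use fA card_dist_le[OF lt] in simp_all)
    also have "\<dots> \<le> (T + 1 + l) * ((L + 1) * (d * (d - 1) ^ c))"
      by (intro mult_le_mono cA order_refl) (use True in simp)
    finally have cZ: "card Z \<le> (T + 1 + l) * ((L + 1) * (d * (d - 1) ^ c))" .
    have kR: "real (t - s) \<le> R"
    proof -
      have "real (t - s) \<le> real (2 * L + l)" using True by simp
      then show ?thesis using R by linarith
    qed
    have "card XE \<le> card (\<Union>z\<in>Z. {q \<in> walks_from x (t - s). q ! (t - s) = z})"
    proof (rule card_inj_on_le[of "drop s"])
      show "inj_on (drop s) XE" by (rule inj_on_subset[OF dropinj]) (auto simp: XE_def)
      show "drop s ` XE \<subseteq> (\<Union>z\<in>Z. {q \<in> walks_from x (t - s). q ! (t - s) = z})"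
      proof
        fix q assume "q \<in> drop s ` XE"
        then obtain p where p: "p \<in> XE" "q = drop s p" by blast
        then have "p \<in> extensions p0 s t c" "p ! t \<in> Z" unfolding XE_def by simp_all
        then have "q \<in> {q \<in> walks_from x (t - s). q ! (t - s) = p ! t}" using dropNBW p(2) by simp
        then show "q \<in> (\<Union>z\<in>Z. {q \<in> walks_from x (t - s). q ! (t - s) = z})" using \<open>p ! t \<in> Z\<close> by (rule UN_I[rotated])
      qed
      show "finite (\<Union>z\<in>Z. {q \<in> walks_from x (t - s). q ! (t - s) = z})" using finZ finite_walks_from[OF x] by simp
    qed
    also have "\<dots> \<le> card Z * (1 + 2 * L * L)"
    proof (rule card_UN_bound[OF finZ])
      fix z
      have "card {q \<in> walks_from x (t - s). q ! (t - s) = z} \<le> 1 + 2 * (t - s) * (t - s)" by (rule card_between[OF bf x kR])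
      also have "\<dots> \<le> 1 + 2 * L * L" using True by (intro add_mono mult_le_mono order_refl) simp_all
      finally show "card {q \<in> walks_from x (t - s). q ! (t - s) = z} \<le> 1 + 2 * L * L" .
    qed
    also have "\<dots> \<le> (T + 1 + l) * ((L + 1) * (d * (d - 1) ^ c)) * (1 + 2 * L * L)" using cZ by (rule mult_le_mono1)
    also have "\<dots> = (T + 1 + l) * ((L + 1) * d) * (1 + 2 * L * L) * (d - 1) ^ c"
      by (simp only: mult.assoc mult.commute mult.left_commute)
    finally show ?thesis .
  next
    case False
    then have "XE = {}" unfolding XE_def by auto
    then show ?thesis by simp
  qed
  have sub: "extensions p0 s t c \<subseteq> XN \<union> ((\<Union>j\<in>{..<s}. XU j) \<union> (\<Union>j\<in>{..s}. XD j)) \<union> XE"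
  proof
    fix p assume p: "p \<in> extensions p0 s t c"
    have sg: "seg E S L ((!) p) s t c" using p unfolding extensions_def by simp
    then have "c = t - s \<or> c = 0 \<and> repeats ((!) p) s t \<or> t - s \<le> L \<and> c \<le> L \<and> near E ((!) p ` {..s} \<union> S) c (p ! t)"
      unfolding seg_def by (rule conjunct2)
    then show "p \<in> XN \<union> ((\<Union>j\<in>{..<s}. XU j) \<union> (\<Union>j\<in>{..s}. XD j)) \<union> XE"
    proof (elim disjE conjE)
      assume "c = t - s"
      then show ?thesis using p unfolding XN_def by simp
    next
      assume "repeats ((!) p) s t"
      then show ?thesis unfolding repeats_def
      proof
        assume "\<exists>j<s. \<forall>i\<le>t - s. p ! (s + i) = p ! (j + i)"
        then obtain j where j: "j < s" "\<forall>i\<le>t - s. p ! (s + i) = p ! (j + i)" by (elim exE conjE)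
        then have "p \<in> XU j" using p unfolding XU_def by simp
        then have "p \<in> (\<Union>j\<in>{..<s}. XU j)" using j(1) by (intro UN_I[of j]) simp_all
        then show ?thesis by simp
      next
        assume "\<exists>j\<le>s. t - s \<le> j \<and> (\<forall>i\<le>t - s. p ! (s + i) = p ! (j - i))"
        then obtain j where j: "j \<le> s" "\<forall>i\<le>t - s. p ! (s + i) = p ! (j - i)" by (elim exE conjE)
        then have "p \<in> XD j" using p unfolding XD_def by simp
        then have "p \<in> (\<Union>j\<in>{..s}. XD j)" using j(1) by (intro UN_I[of j]) simp_all
        then show ?thesis by simp
      qed
    next
      assume 3: "t - s \<le> L" "c \<le> L" "near E ((!) p ` {..s} \<union> S) c (p ! t)"
      obtain y where y: "y \<in> (!) p ` {..s} \<union> S" "dist_le E c y (p ! t)" using 3(3) unfolding near_def by blast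
      \<comment> \<open>A short segment that ends near a vertex of \<open>S\<close> starts within
        \<open>2 * L\<close> of it, so of all vertices on short cycles only the at most
        \<open>l\<close> ones in \<open>A\<close> matter.\<close>
      have "y \<in> set p0 \<union> A"
      proof (cases "y \<in> S")
        case True
        have "nbwalk E ((!) p) t" using X(1)[OF p] unfolding walk_lists_def by simp
        then have "dist_le E (t - s) (p ! s) (p ! t)" by (intro dist_le_path) (use st in \<open>auto simp: nbwalk_def\<close>)
        then have "dist_le E (t - s) x (p ! t)" unfolding x_def using X(3)[OF p, of s] by simp
        then have "dist_le E (t - s + c) x y" by (rule dist_le_trans[OF _ dist_le_sym[OF y(2)]])
        then have "dist_le E (2 * L) x y" by (rule dist_le_mono) (use 3 in simp)
        then show ?thesis unfolding A_def using True by simp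
      next
        case False
        then obtain i where i: "i \<le> s" "y = p ! i" using y(1) by auto
        then have "y = p0 ! i" "i < length p0" using X(3)[OF p] p0(1) unfolding walk_lists_def by simp_all
        then show ?thesis by simp
      qed
      then have "p ! t \<in> Z" unfolding Z_def using y(2) by blast
      then show ?thesis using p 3 unfolding XE_def by simp
    qed
  qed
  have fins: "finite XN" "finite XE" "\<And>j. finite (XU j)" "\<And>j. finite (XD j)"
    unfolding XN_def XE_def XU_def XD_def using finX by simp_all
  have "card (extensions p0 s t c) \<le> card (XN \<union> ((\<Union>j\<in>{..<s}. XU j) \<union> (\<Union>j\<in>{..s}. XD j)) \<union> XE)"
    by (rule card_mono[OF _ sub]) (use fins in simp)
  also have "\<dots> \<le> card XN + card ((\<Union>j\<in>{..<s}. XU j) \<union> (\<Union>j\<in>{..s}. XD j)) + card XE" by (rule card_Un3_le)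
  finally have tot: "card (extensions p0 s t c) \<le> card XN + card ((\<Union>j\<in>{..<s}. XU j) \<union> (\<Union>j\<in>{..s}. XD j)) + card XE" .
  have "card (\<Union>j\<in>{..<s}. XU j) \<le> card {..<s} * 1" by (rule card_UN_bound) (use cU in simp_all)
  moreover have "card (\<Union>j\<in>{..s}. XD j) \<le> card {..s} * 1" by (rule card_UN_bound) (use cD in simp_all)
  ultimately have c2: "card ((\<Union>j\<in>{..<s}. XU j) \<union> (\<Union>j\<in>{..s}. XD j)) \<le> 2 * T + 1"
    using card_Un_le[of "\<Union>j\<in>{..<s}. XU j" "\<Union>j\<in>{..s}. XD j"] st by simp
  have "1 \<le> (d - 1) ^ c" using d by simp
  then have "(2 * T + 1) * 1 \<le> (2 * T + 1) * (d - 1) ^ c" by (rule mult_le_mono2)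
  then have "card (extensions p0 s t c) \<le> d * (d - 1) ^ c + (2 * T + 1) * (d - 1) ^ c + (T + 1 + l) * ((L + 1) * d) * (1 + 2 * L * L) * (d - 1) ^ c"
    by (intro order_trans[OF tot] add_mono cN cE order_trans[OF c2]) simp
  also have "\<dots> = ext_factor * (d - 1) ^ c" unfolding ext_factor_def by (simp only: distrib_right)
  finally show ?thesis .
qed

definition segmented_walks :: "nat \<Rightarrow> nat \<Rightarrow> nat \<Rightarrow> nat list set" where
  "segmented_walks q B t = {p \<in> walk_lists E t. p ! 0 < n \<and> segs E S L ((!) p) t q B}"

lemma finite_segmented_walks: "finite (segmented_walks q B t)"
  by (rule finite_subset[OF _ finite_walks[of t]]) (auto simp: segmented_walks_def)

text \<open>Removing the last segment leaves at most \<open>T + 1\<close> choices for its start,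
  \<open>T + 1\<close> for its cost \<open>c\<close>, and \<open>ext_factor * (d - 1) ^ c\<close>
  for its course.\<close>

lemma card_segmented_walks:
  "t \<le> T \<Longrightarrow> B \<le> T \<Longrightarrow> card (segmented_walks q B t) \<le> n * ((T + 1) * (T + 1) * ext_factor) ^ q * (d - 1) ^ B"
proof (induction q arbitrary: B t)
  case 0
  have "card (segmented_walks 0 B t) \<le> card {..<n} * 1" if "t = 0" "B = 0"
  proof -
    have "card (segmented_walks 0 B t) \<le> card {..<n}"
    proof (rule card_inj_on_le[of "\<lambda>p. p ! 0"])
      show "inj_on (\<lambda>p. p ! 0) (segmented_walks 0 B t)"
        by (rule inj_onI, rule walk_list_eqI[of _ t]) (use that in \<open>auto simp: segmented_walks_def\<close>)
    qed (auto simp: segmented_walks_def)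
    then show ?thesis by simp
  qed
  moreover have "segmented_walks 0 B t = {}" if nz: "\<not> (t = 0 \<and> B = 0)"
  proof -
    have "p \<notin> segmented_walks 0 B t" for p
    proof
      assume "p \<in> segmented_walks 0 B t"
      then have "segs E S L ((!) p) t 0 B" unfolding segmented_walks_def by simp
      then show False using segs_zero nz by blast
    qed
    then show ?thesis by blast
  qed
  ultimately show ?case by (cases "t = 0 \<and> B = 0") auto
next
  case (Suc q)
  let ?P = "(T + 1) * (T + 1) * ext_factor"
  have sub: "segmented_walks (Suc q) B t \<subseteq> (\<Union>s\<in>{..<t}. \<Union>c\<in>{..B}. \<Union>p0\<in>segmented_walks q (B - c) s. extensions p0 s t c)"
  proof
    fix p assume p: "p \<in> segmented_walks (Suc q) B t"
    then have pl: "p \<in> walk_lists E t" "p ! 0 < n" "segs E S L ((!) p) t (Suc q) B" unfolding segmented_walks_def by simp_all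
    obtain s c B' where s: "segs E S L ((!) p) s q B'" "seg E S L ((!) p) s t c" "B = B' + c" by (rule segs_SucE[OF pl(3)])
    have st: "s < t" using s(2) unfolding seg_def by simp
    define p0 where "p0 = take (Suc s) p"
    have len: "length p = Suc t" "nbwalk E ((!) p) t" using pl(1) unfolding walk_lists_def by simp_all
    have nth: "p ! i = p0 ! i" if "i \<le> s" for i using that unfolding p0_def by simp
    have "nbwalk E ((!) p) s" by (rule nbwalk_take[OF len(2)]) (use st in simp)
    then have "nbwalk E ((!) p0) s" using nbwalk_cong[of s "(!) p" "(!) p0" E] nth by simp
    then have "p0 \<in> walk_lists E s" unfolding walk_lists_def p0_def using len(1) st by simp
    moreover have "segs E S L ((!) p0) s q B'" by (rule segs_cong[OF s(1)]) (rule nth)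
    moreover have "p0 ! 0 < n" using nth[of 0] pl(2) by simp
    ultimately have "p0 \<in> segmented_walks q (B - c) s" unfolding segmented_walks_def using s(3) by simp
    moreover have "p \<in> extensions p0 s t c" unfolding extensions_def using pl(1) s(2) p0_def by simp
    moreover have "s \<in> {..<t}" "c \<in> {..B}" using st s(3) by simp_all
    ultimately show "p \<in> (\<Union>s\<in>{..<t}. \<Union>c\<in>{..B}. \<Union>p0\<in>segmented_walks q (B - c) s. extensions p0 s t c)" by (intro UN_I)
  qed
  have finX: "finite (extensions p0 s t c)" if "p0 ! 0 < n" "p0 \<in> walk_lists E s" for p0 s c
  proof (rule finite_subset[OF _ finite_walks[of t]])
    show "extensions p0 s t c \<subseteq> {p \<in> walk_lists E t. p ! 0 < n}"
    proof
      fix p assume p: "p \<in> extensions p0 s t c"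
      then have "p ! 0 = p0 ! 0" using take_eq_nth[of s p p0 0] unfolding extensions_def by simp
      then show "p \<in> {p \<in> walk_lists E t. p ! 0 < n}" using p that(1) unfolding extensions_def by simp
    qed
  qed
  let ?M = "n * ?P ^ q * ext_factor * (d - 1) ^ B"
  have one: "card (\<Union>p0\<in>segmented_walks q (B - c) s. extensions p0 s t c) \<le> ?M" if sc: "s < t" "c \<le> B" for s c
  proof -
    have "card (\<Union>p0\<in>segmented_walks q (B - c) s. extensions p0 s t c) \<le> card (segmented_walks q (B - c) s) * (ext_factor * (d - 1) ^ c)"
    proof (rule card_UN_bound[OF finite_segmented_walks])
      fix p0 assume "p0 \<in> segmented_walks q (B - c) s"
      then have "p0 \<in> walk_lists E s" "p0 ! 0 < n" unfolding segmented_walks_def by simp_all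
      then show "card (extensions p0 s t c) \<le> ext_factor * (d - 1) ^ c" using sc(1) Suc.prems(1) by (rule card_extensions)
    qed
    also have "\<dots> \<le> (n * ?P ^ q * (d - 1) ^ (B - c)) * (ext_factor * (d - 1) ^ c)"
      by (rule mult_le_mono1) (rule Suc.IH, use sc Suc.prems in auto)
    also have "\<dots> = n * ?P ^ q * ext_factor * ((d - 1) ^ (B - c) * (d - 1) ^ c)"
      by (simp only: mult.assoc mult.commute mult.left_commute)
    also have "(d - 1) ^ (B - c) * (d - 1) ^ c = (d - 1) ^ (B - c + c)" by (rule power_add[symmetric])
    also have "B - c + c = B" using sc by simp
    finally show ?thesis .
  qed
  have "finite (\<Union>s\<in>{..<t}. \<Union>c\<in>{..B}. \<Union>p0\<in>segmented_walks q (B - c) s. extensions p0 s t c)"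
    by (intro finite_UN_I finite_lessThan finite_atMost finite_segmented_walks finX) (auto simp: segmented_walks_def)
  then have "card (segmented_walks (Suc q) B t) \<le> card (\<Union>s\<in>{..<t}. \<Union>c\<in>{..B}. \<Union>p0\<in>segmented_walks q (B - c) s. extensions p0 s t c)"
    by (rule card_mono[OF _ sub])
  also have "\<dots> \<le> card {..<t} * (card {..B} * ?M)"
  proof (rule card_UN_bound)
    fix s assume s: "s \<in> {..<t}"
    show "card (\<Union>c\<in>{..B}. \<Union>p0\<in>segmented_walks q (B - c) s. extensions p0 s t c) \<le> card {..B} * ?M"
    proof (rule card_UN_bound)
      fix c assume "c \<in> {..B}"
      then show "card (\<Union>p0\<in>segmented_walks q (B - c) s. extensions p0 s t c) \<le> ?M" using one[of s c] s by simp
    qed simp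
  qed simp
  also have "\<dots> \<le> (T + 1) * ((T + 1) * ?M)"
  proof (rule mult_le_mono)
    show "card {..<t} \<le> T + 1" using Suc.prems(1) by simp
    show "card {..B} * ?M \<le> (T + 1) * ?M" by (rule mult_le_mono1) (use Suc.prems(2) in simp)
  qed
  also have "\<dots> = n * (?P ^ q * ?P) * (d - 1) ^ B"
    by (simp only: mult.assoc mult.commute mult.left_commute)
  also have "?P ^ q * ?P = ?P ^ Suc q" by (rule power_Suc2[symmetric])
  finally show ?case .
qed

end

section \<open>Pairs of walks with few odd edges\<close>

definition ecount :: "(nat \<Rightarrow> nat) \<Rightarrow> nat \<Rightarrow> edge \<Rightarrow> nat" where
  "ecount w k e = (\<Sum>t<k. of_bool ({w t, w (Suc t)} = e))"

lemma ecount_card: "ecount w k e = card {t \<in> {1..k}. {w (t - 1), w t} = e}"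
proof -
  have "ecount w k e = card {t \<in> {..<k}. {w t, w (Suc t)} = e}"
    unfolding ecount_def by (simp add: of_bool_def sum.If_cases Int_def)
  also have "\<dots> = card (Suc ` {t \<in> {..<k}. {w t, w (Suc t)} = e})" by (rule card_image[symmetric]) simp
  also have "Suc ` {t \<in> {..<k}. {w t, w (Suc t)} = e} = {t \<in> {1..k}. {w (t - 1), w t} = e}"
  proof (intro equalityI subsetI)
    fix t assume "t \<in> {t \<in> {1..k}. {w (t - 1), w t} = e}"
    then have "t = Suc (t - 1)" "t - 1 < k" "{w (t - 1), w (Suc (t - 1))} = e" by auto
    then show "t \<in> Suc ` {t \<in> {..<k}. {w t, w (Suc t)} = e}" by (intro image_eqI[of _ _ "t - 1"]) simp_all
  qed auto
  finally show ?thesis .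
qed

lemma ecount_cong: "(\<And>i. i \<le> k \<Longrightarrow> w i = w' i) \<Longrightarrow> ecount w k e = ecount w' k e"
  unfolding ecount_def by (intro sum.cong) auto

lemma ecount_split: "m \<le> k \<Longrightarrow> ecount w k e = ecount w m e + ecount (\<lambda>i. w (m + i)) (k - m) e"
proof -
  assume "m \<le> k"
  then obtain j where k: "k = m + j" using le_Suc_ex by blast
  show ?thesis unfolding k ecount_def by (induction j) (simp_all add: add.assoc)
qed

lemma ecount_rev: "ecount (\<lambda>i. w (m - i)) m e = ecount w m e"
proof -
  have "ecount (\<lambda>i. w (m - i)) m e = (\<Sum>t<m. (\<lambda>t. of_bool ({w t, w (Suc t)} = e)) (m - Suc t))"
    unfolding ecount_def
  proof (rule sum.cong)
    fix t assume "t \<in> {..<m}"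
    then have "Suc (m - Suc t) = m - t" by simp
    then show "of_bool ({w (m - t), w (m - Suc t)} = e) = (of_bool ({w (m - Suc t), w (Suc (m - Suc t))} = e) :: nat)"
      by (simp add: insert_commute)
  qed simp
  also have "\<dots> = ecount w m e" unfolding ecount_def by (rule sum.nat_diff_reindex)
  finally show ?thesis .
qed

text \<open>The last assumption says that all choices connected with one cut amount to at most
  \<open>(d - 1) ^ h\<close>, and \<open>260 * h \<le> a\<close> is the exchange rate between cuts
  and free steps in \<open>segmentation\<close>. The radius is
  \<open>2 * (12 * a) + 10 * a\<close>.\<close>

locale count_bound = regular +
  fixes R :: real and a m \<Lambda> h :: nat
  assumes bf: "bicycle_free n E R" and R: "real (34 * a) \<le> R" and a: "1 \<le> a"
    and h: "260 * h \<le> a"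
    and P: "(2 * m + 1) * (2 * m + 1) * (d + (2 * (2 * m) + 1) + (2 * m + 1 + 10 * a) * ((12 * a + 1) * d) * (1 + 2 * (12 * a) * (12 * a))) \<le> (d - 1) ^ h"
begin

sublocale rb: regular_bicycle_free n E d R "12 * a" "10 * a" "2 * m"
proof unfold_locales
  show "bicycle_free n E R" by (rule bf)
  show "real (2 * (12 * a) + 10 * a) \<le> R" using R by simp
qed

definition few_odd_walks :: "nat \<Rightarrow> nat list set" where
  "few_odd_walks k = {p \<in> walk_lists E k. p ! 0 < n \<and> card {e. odd (ecount ((!) p) k e)} \<le> \<Lambda>}"

text \<open>Bounds the number of segments: \<open>segmentation\<close> and \<open>1 \<le> a\<close>
  give \<open>2 * q \<le> 260 * (k + \<Lambda> + a)\<close>, and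
  \<open>k \<le> 2 * m\<close>.\<close>

definition Q :: nat where "Q = 130 * (2 * m + \<Lambda> + a)"

text \<open>With \<open>q\<close> cuts and \<open>B\<close> free steps the count is
  \<open>n * (d - 1) ^ (h * q + B)\<close>. Since \<open>520 * (h * q) \<le> 2 * a * q\<close>, the
  inequality of \<open>segmentation\<close> bounds this exponent by
  \<open>(k + \<Lambda> + a) div 2\<close>, whatever \<open>q\<close> and \<open>B\<close>
  are.\<close>

lemma card_few_odd_walks:
  assumes k: "k \<le> 2 * m"
  shows "card (few_odd_walks k) \<le> (Q + 1) * ((k + 1) * (n * (d - 1) ^ ((k + \<Lambda> + a) div 2)))"
proof -
  define J where "J q = {B \<in> {..k}. 520 * B + 2 * a * q \<le> 260 * (k + \<Lambda> + a)}" for q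
  have sub: "few_odd_walks k \<subseteq> (\<Union>q\<in>{..Q}. \<Union>B\<in>J q. rb.segmented_walks q B k)"
  proof
    fix p assume p: "p \<in> few_odd_walks k"
    then have pl: "p \<in> walk_lists E k" "p ! 0 < n" "card {e. odd (ecount ((!) p) k e)} \<le> \<Lambda>" unfolding few_odd_walks_def by simp_all
    interpret w: nb_walk E "(!) p" k a
    proof
      show "nbwalk E ((!) p) k" using pl(1) unfolding walk_lists_def by simp
    qed (use loop_free a in auto)
    have oe: "w.odd_edges = {e. odd (ecount ((!) p) k e)}"
      unfolding w.odd_edges_def w.step_edge_def ecount_card ..
    obtain q B where qB: "segs E w.S (12 * a) ((!) p) k q B" "B \<le> k" "520 * B + 2 * a * q \<le> 260 * (k + card w.odd_edges + a)"
      using w.segmentation by (elim exE conjE)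
    have "260 * (k + card w.odd_edges + a) \<le> 260 * (k + \<Lambda> + a)" using pl(3) unfolding oe by simp
    with qB(3) have le: "520 * B + 2 * a * q \<le> 260 * (k + \<Lambda> + a)" by (rule order_trans)
    have "1 * q \<le> a * q" using a by (rule mult_le_mono1)
    then have "2 * q \<le> 2 * a * q" by simp
    then have "2 * q \<le> 260 * (k + \<Lambda> + a)" using le by linarith
    then have "q \<le> Q" unfolding Q_def using k by simp
    moreover have "B \<in> J q" unfolding J_def using qB(2) le by simp
    moreover have "p \<in> rb.segmented_walks q B k" unfolding rb.segmented_walks_def using pl qB(1) unfolding w.S_def by simp
    ultimately show "p \<in> (\<Union>q\<in>{..Q}. \<Union>B\<in>J q. rb.segmented_walks q B k)" by (intro UN_I) simp_all
  qed
  have finJ: "finite (J q)" for q unfolding J_def by simp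
  have one: "card (rb.segmented_walks q B k) \<le> n * (d - 1) ^ ((k + \<Lambda> + a) div 2)" if B: "B \<in> J q" for q B
  proof -
    have B': "B \<le> k" "520 * B + 2 * a * q \<le> 260 * (k + \<Lambda> + a)" using B unfolding J_def by simp_all
    have PP: "(2 * m + 1) * (2 * m + 1) * rb.ext_factor \<le> (d - 1) ^ h" using P unfolding rb.ext_factor_def .
    have "card (rb.segmented_walks q B k) \<le> n * ((2 * m + 1) * (2 * m + 1) * rb.ext_factor) ^ q * (d - 1) ^ B"
      by (rule rb.card_segmented_walks) (use k B' in simp_all)
    also have "\<dots> \<le> n * ((d - 1) ^ h) ^ q * (d - 1) ^ B"
      by (intro mult_le_mono1 mult_le_mono2 power_mono[OF PP]) simp
    also have "\<dots> = n * (d - 1) ^ (h * q + B)" by (simp only: power_mult power_add mult.assoc)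
    also have "\<dots> \<le> n * (d - 1) ^ ((k + \<Lambda> + a) div 2)"
    proof (rule mult_le_mono2, rule power_increasing)
      have "260 * h * q \<le> a * q" using h by (rule mult_le_mono1)
      then have "520 * (h * q) \<le> 2 * a * q" by simp
      then have "520 * (h * q) + 520 * B \<le> 260 * (k + \<Lambda> + a)" using B'(2) by linarith
      then show "h * q + B \<le> (k + \<Lambda> + a) div 2" by simp
    qed (use d in simp)
    finally show ?thesis .
  qed
  have "finite (\<Union>q\<in>{..Q}. \<Union>B\<in>J q. rb.segmented_walks q B k)"
    by (intro finite_UN_I finite_atMost finJ rb.finite_segmented_walks)
  then have "card (few_odd_walks k) \<le> card (\<Union>q\<in>{..Q}. \<Union>B\<in>J q. rb.segmented_walks q B k)" by (rule card_mono[OF _ sub])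
  also have "\<dots> \<le> card {..Q} * ((k + 1) * (n * (d - 1) ^ ((k + \<Lambda> + a) div 2)))"
  proof (rule card_UN_bound)
    fix q
    have "card (\<Union>B\<in>J q. rb.segmented_walks q B k) \<le> card (J q) * (n * (d - 1) ^ ((k + \<Lambda> + a) div 2))"
      by (rule card_UN_bound[OF finJ one])
    also have "card (J q) \<le> card {..k}" by (rule card_mono) (auto simp: J_def)
    finally show "card (\<Union>B\<in>J q. rb.segmented_walks q B k) \<le> (k + 1) * (n * (d - 1) ^ ((k + \<Lambda> + a) div 2))" by simp
  qed simp
  finally show ?thesis by simp
qed

lemma finite_few_odd_walks: "finite (few_odd_walks k)"
  by (rule finite_subset[OF _ finite_walks[of k]]) (auto simp: few_odd_walks_def)

definition Pairs :: "(nat list \<times> nat list) set" where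
  "Pairs = {(p, q). p \<in> walk_lists E m \<and> q \<in> walk_lists E m \<and> p ! 0 < n \<and> q ! 0 = p ! 0 \<and> p ! m = q ! m \<and>
     card {e. odd (ecount ((!) p) m e + ecount ((!) q) m e)} \<le> \<Lambda>}"

text \<open>
  Pairs of walks that agree from time \<open>k\<close> on and not before: following the first walk up to \<open>k\<close> and
  the second one backwards is then nonbacktracking.
\<close>

definition split_pairs :: "nat \<Rightarrow> (nat list \<times> nat list) set" where
  "split_pairs k = {(p, q) \<in> Pairs. k \<le> m \<and> (\<forall>j. k \<le> j \<and> j \<le> m \<longrightarrow> p ! j = q ! j) \<and> (\<forall>j. k = Suc j \<longrightarrow> p ! j \<noteq> q ! j)}"

definition glue :: "nat \<Rightarrow> nat list \<Rightarrow> nat list \<Rightarrow> nat \<Rightarrow> nat" where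
  "glue k p q t = (if t \<le> k then p ! t else q ! (2 * k - t))"

text \<open>The common tail is traversed by both walks and cancels in the parities, so the glued
  walk of length \<open>2 * k\<close> has the same odd edges as the pair. The pair is recovered from
  the glued walk and the tail, a nonbacktracking walk of length \<open>m - k\<close> from the
  meeting vertex.\<close>

lemma card_split_pairs:
  assumes k: "k \<le> m"
  shows "card (split_pairs k) \<le> card (few_odd_walks (2 * k)) * (d * (d - 1) ^ (m - k))"
proof -
  define W where "W p q = map (glue k p q) [0..<Suc (2 * k)]" for p q
  have Wn: "W p q ! t = glue k p q t" if "t \<le> 2 * k" for p q t unfolding W_def using that by (simp del: upt_Suc)
  have PID: "p \<in> walk_lists E m" "q \<in> walk_lists E m" "p ! 0 < n" "q ! 0 = p ! 0" "\<And>j. k \<le> j \<Longrightarrow> j \<le> m \<Longrightarrow> p ! j = q ! j"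
    "\<And>j. k = Suc j \<Longrightarrow> p ! j \<noteq> q ! j" "card {e. odd (ecount ((!) p) m e + ecount ((!) q) m e)} \<le> \<Lambda>"
    if "(p, q) \<in> split_pairs k" for p q
    using that unfolding split_pairs_def Pairs_def by simp_all
  have glueq: "glue k p q t = q ! (2 * k - t)" if "(p, q) \<in> split_pairs k" "k \<le> t" for p q t
    using PID(5)[OF that(1), of k] that(2) k unfolding glue_def by (cases "t = k") auto
  have WNT: "W p q \<in> few_odd_walks (2 * k)" if pq: "(p, q) \<in> split_pairs k" for p q
  proof -
    have nbp: "nbwalk E ((!) p) m" and nbq: "nbwalk E ((!) q) m" using PID(1,2)[OF pq] unfolding walk_lists_def by simp_all
    have "nbwalk E (glue k p q) (2 * k)"
      unfolding nbwalk_def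
    proof (intro conjI allI impI)
      fix t assume t: "t < 2 * k"
      show "{glue k p q t, glue k p q (Suc t)} \<in> E"
      proof (cases "t < k")
        case True
        then show ?thesis using nbp k unfolding glue_def nbwalk_def by simp
      next
        case False
        define u where "u = 2 * k - Suc t"
        have u: "2 * k - t = Suc u" "u < m" using t False k unfolding u_def by auto
        have "{q ! u, q ! Suc u} \<in> E" using nbq u(2) unfolding nbwalk_def by simp
        then show ?thesis using glueq[OF pq, of t] glueq[OF pq, of "Suc t"] False u(1)
          unfolding u_def[symmetric] by (simp add: insert_commute)
      qed
    next
      fix t assume t: "Suc (Suc t) \<le> 2 * k"
      consider "Suc (Suc t) \<le> k" | "k = Suc t" | "k \<le> t" by linarith
      then show "glue k p q (Suc (Suc t)) \<noteq> glue k p q t"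
      proof cases
        case 1
        then show ?thesis using nbp k unfolding glue_def nbwalk_def by simp
      next
        case 2
        have "glue k p q (Suc (Suc t)) = q ! t" unfolding glue_def using 2 by simp
        moreover have "glue k p q t = p ! t" unfolding glue_def using 2 by simp
        ultimately show ?thesis using PID(6)[OF pq 2] by simp
      next
        case 3
        define u where "u = 2 * k - Suc (Suc t)"
        have u: "2 * k - t = Suc (Suc u)" "Suc (Suc u) \<le> m" using t 3 k unfolding u_def by auto
        have "q ! Suc (Suc u) \<noteq> q ! u" using nbq u(2) unfolding nbwalk_def by simp
        then show ?thesis using glueq[OF pq, of t] glueq[OF pq, of "Suc (Suc t)"] 3 u(1)
          unfolding u_def[symmetric] by simp
      qed
    qed
    then have "nbwalk E ((!) (W p q)) (2 * k)"
      using nbwalk_cong[of "2 * k" "(!) (W p q)" "glue k p q" E] Wn by simp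
    then have Wl: "W p q \<in> walk_lists E (2 * k)" unfolding walk_lists_def W_def by simp
    have cnt: "even (ecount ((!) (W p q)) (2 * k) e) \<longleftrightarrow> even (ecount ((!) p) m e + ecount ((!) q) m e)" for e
    proof -
      have "ecount ((!) (W p q)) (2 * k) e = ecount (glue k p q) (2 * k) e" by (rule ecount_cong) (rule Wn)
      also have "\<dots> = ecount (glue k p q) k e + ecount (\<lambda>i. glue k p q (k + i)) (2 * k - k) e" by (rule ecount_split) simp
      also have "ecount (glue k p q) k e = ecount ((!) p) k e" by (rule ecount_cong) (simp add: glue_def)
      also have "ecount (\<lambda>i. glue k p q (k + i)) (2 * k - k) e = ecount (\<lambda>i. q ! (k - i)) k e"
      proof -
        have "ecount (\<lambda>i. glue k p q (k + i)) k e = ecount (\<lambda>i. q ! (k - i)) k e"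
          by (rule ecount_cong) (use glueq[OF pq] in \<open>simp add: algebra_simps\<close>)
        then show ?thesis by simp
      qed
      also have "ecount (\<lambda>i. q ! (k - i)) k e = ecount ((!) q) k e" by (rule ecount_rev)
      finally have 1: "ecount ((!) (W p q)) (2 * k) e = ecount ((!) p) k e + ecount ((!) q) k e" .
      have 2: "ecount ((!) p) m e = ecount ((!) p) k e + ecount (\<lambda>i. p ! (k + i)) (m - k) e" by (rule ecount_split[OF k])
      have 3: "ecount ((!) q) m e = ecount ((!) q) k e + ecount (\<lambda>i. q ! (k + i)) (m - k) e" by (rule ecount_split[OF k])
      have 4: "ecount (\<lambda>i. p ! (k + i)) (m - k) e = ecount (\<lambda>i. q ! (k + i)) (m - k) e"
        by (rule ecount_cong) (use PID(5)[OF pq] k in simp)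
      show ?thesis unfolding 1 2 3 4 by (simp only: even_add) argo
    qed
    have "{e. odd (ecount ((!) (W p q)) (2 * k) e)} = {e. odd (ecount ((!) p) m e + ecount ((!) q) m e)}"
      using cnt by simp
    then have "card {e. odd (ecount ((!) (W p q)) (2 * k) e)} \<le> \<Lambda>" using PID(7)[OF pq] by simp
    moreover have "W p q ! 0 < n" using Wn[of 0 p q] PID(3)[OF pq] unfolding glue_def by simp
    ultimately show ?thesis unfolding few_odd_walks_def using Wl by simp
  qed
  have Dr: "drop k p \<in> walks_from (W p q ! k) (m - k)" if pq: "(p, q) \<in> split_pairs k" for p q
  proof -
    have "drop k p \<in> walk_lists E (m - k)" by (rule walk_lists_drop[OF PID(1)[OF pq] k])
    moreover have "W p q ! k = p ! k" using Wn[of k p q] unfolding glue_def by simp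
    moreover have "length p = Suc m" using PID(1)[OF pq] unfolding walk_lists_def by simp
    ultimately show ?thesis unfolding walks_from_def using k by simp
  qed
  have lt: "w ! k < n" if "w \<in> few_odd_walks (2 * k)" for w
    using that walk_lt[of w "2 * k" k] unfolding few_odd_walks_def by simp
  define U where "U = (\<Union>w\<in>few_odd_walks (2 * k). Pair w ` walks_from (w ! k) (m - k))"
  have finU: "finite U" unfolding U_def using finite_few_odd_walks finite_walks_from[OF lt] by simp
  have "card (split_pairs k) \<le> card U"
  proof (rule card_inj_on_le[of "\<lambda>(p, q). (W p q, drop k p)"])
    show "inj_on (\<lambda>(p, q). (W p q, drop k p)) (split_pairs k)"
    proof (rule inj_onI, clarify)
      fix p q p' q' assume A: "(p, q) \<in> split_pairs k" "(p', q') \<in> split_pairs k" and e: "W p q = W p' q'" "drop k p = drop k p'"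
      have len: "length p = Suc m" "length p' = Suc m" using PID(1)[OF A(1)] PID(1)[OF A(2)] unfolding walk_lists_def by simp_all
      have g: "glue k p q t = glue k p' q' t" if "t \<le> 2 * k" for t
        using Wn[OF that, of p q] Wn[OF that, of p' q'] e(1) by simp
      have pp: "p ! t = p' ! t" if "t \<le> m" for t
      proof (cases "t \<le> k")
        case True
        then show ?thesis using g[of t] unfolding glue_def by simp
      next
        case False
        then have "drop k p ! (t - k) = p ! t" "drop k p' ! (t - k) = p' ! t" using len that by simp_all
        then show ?thesis using e(2) by simp
      qed
      have qq: "q ! t = q' ! t" if "t \<le> m" for t
      proof (cases "k \<le> t")
        case True
        then show ?thesis using PID(5)[OF A(1), of t] PID(5)[OF A(2), of t] pp[OF that] that by simp
      next
        case False
        then show ?thesis using g[of "2 * k - t"] glueq[OF A(1), of "2 * k - t"] glueq[OF A(2), of "2 * k - t"] by simp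
      qed
      show "p = p' \<and> q = q'"
        using rb.walk_list_eqI[OF PID(1)[OF A(1)] PID(1)[OF A(2)] pp] rb.walk_list_eqI[OF PID(2)[OF A(1)] PID(2)[OF A(2)] qq] by simp
    qed
    show "(\<lambda>(p, q). (W p q, drop k p)) ` split_pairs k \<subseteq> U"
    proof
      fix y assume "y \<in> (\<lambda>(p, q). (W p q, drop k p)) ` split_pairs k"
      then obtain p q where pq: "(p, q) \<in> split_pairs k" "y = (W p q, drop k p)" by auto
      then have "y \<in> Pair (W p q) ` walks_from (W p q ! k) (m - k)" using Dr by simp
      then show "y \<in> U" unfolding U_def using WNT[OF pq(1)] by (rule UN_I[rotated])
    qed
  qed (rule finU)
  also have "card U \<le> card (few_odd_walks (2 * k)) * (d * (d - 1) ^ (m - k))"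
    unfolding U_def
  proof (rule card_UN_bound[OF finite_few_odd_walks])
    fix w assume "w \<in> few_odd_walks (2 * k)"
    note l = lt[OF this]
    have "card (Pair w ` walks_from (w ! k) (m - k)) \<le> card (walks_from (w ! k) (m - k))" by (rule card_image_le[OF finite_walks_from[OF l]])
    also have "\<dots> \<le> d * (d - 1) ^ (m - k)" by (rule card_walks_from'[OF l order_refl])
    finally show "card (Pair w ` walks_from (w ! k) (m - k)) \<le> d * (d - 1) ^ (m - k)" .
  qed
  finally show ?thesis .
qed

lemma Pairs_subset: "Pairs \<subseteq> (\<Union>k\<in>{..m}. split_pairs k)"
proof
  fix y assume y: "y \<in> Pairs"
  obtain p q where pq: "y = (p, q)" by (cases y)
  have pm: "p ! m = q ! m" using y unfolding pq Pairs_def by simp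
  define k where "k = (LEAST k. \<forall>j. k \<le> j \<and> j \<le> m \<longrightarrow> p ! j = q ! j)"
  have "\<forall>j. m \<le> j \<and> j \<le> m \<longrightarrow> p ! j = q ! j" using pm by auto
  then have first_traversal: "\<forall>j. k \<le> j \<and> j \<le> m \<longrightarrow> p ! j = q ! j" "k \<le> m" unfolding k_def by (rule LeastI, rule Least_le)
  have "p ! j \<noteq> q ! j" if j: "k = Suc j" for j
  proof
    assume e: "p ! j = q ! j"
    have "\<forall>i. j \<le> i \<and> i \<le> m \<longrightarrow> p ! i = q ! i"
    proof (intro allI impI)
      fix i assume "j \<le> i \<and> i \<le> m"
      then show "p ! i = q ! i" using e first_traversal(1) j by (cases "i = j") auto
    qed
    then have "k \<le> j" unfolding k_def by (rule Least_le)
    then show False using j by simp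
  qed
  then have "y \<in> split_pairs k" unfolding split_pairs_def using y first_traversal pq by auto
  then show "y \<in> (\<Union>k\<in>{..m}. split_pairs k)" using first_traversal(2) by (intro UN_I[of k]) simp_all
qed

theorem card_Pairs:
  "card Pairs \<le> (m + 1) * ((Q + 1) * ((2 * m + 1) * (n * d * (d - 1) ^ (m + (\<Lambda> + a) div 2))))"
proof -
  have fin: "finite Pairs"
  proof (rule finite_subset)
    show "Pairs \<subseteq> {p \<in> walk_lists E m. p ! 0 < n} \<times> {p \<in> walk_lists E m. p ! 0 < n}" unfolding Pairs_def by auto
  qed (use finite_walks in simp)
  have finPI: "finite (split_pairs k)" for k by (rule finite_subset[OF _ fin]) (auto simp: split_pairs_def)
  have "card Pairs \<le> card (\<Union>k\<in>{..m}. split_pairs k)" by (rule card_mono[OF _ Pairs_subset]) (use finPI in simp)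
  also have "\<dots> \<le> card {..m} * ((Q + 1) * ((2 * m + 1) * (n * d * (d - 1) ^ (m + (\<Lambda> + a) div 2))))"
  proof (rule card_UN_bound)
    fix k assume "k \<in> {..m}"
    then have k: "k \<le> m" by simp
    have dv: "(2 * k + \<Lambda> + a) div 2 = k + (\<Lambda> + a) div 2" by simp
    have "card (split_pairs k) \<le> card (few_odd_walks (2 * k)) * (d * (d - 1) ^ (m - k))" by (rule card_split_pairs[OF k])
    also have "\<dots> \<le> ((Q + 1) * ((2 * k + 1) * (n * (d - 1) ^ (k + (\<Lambda> + a) div 2)))) * (d * (d - 1) ^ (m - k))"
      using card_few_odd_walks[of "2 * k"] k unfolding dv by (intro mult_le_mono1) simp
    also have "\<dots> \<le> ((Q + 1) * ((2 * m + 1) * (n * (d - 1) ^ (k + (\<Lambda> + a) div 2)))) * (d * (d - 1) ^ (m - k))"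
      by (rule mult_le_mono1, rule mult_le_mono2, rule mult_le_mono1) (use k in simp)
    also have "\<dots> = (Q + 1) * ((2 * m + 1) * (n * d * ((d - 1) ^ (m - k) * (d - 1) ^ (k + (\<Lambda> + a) div 2))))"
      by (simp only: mult.assoc mult.commute mult.left_commute)
    also have "(d - 1) ^ (m - k) * (d - 1) ^ (k + (\<Lambda> + a) div 2) = (d - 1) ^ (m - k + (k + (\<Lambda> + a) div 2))"
      by (rule power_add[symmetric])
    also have "m - k + (k + (\<Lambda> + a) div 2) = m + (\<Lambda> + a) div 2" using k by simp
    finally show "card (split_pairs k) \<le> (Q + 1) * ((2 * m + 1) * (n * d * (d - 1) ^ (m + (\<Lambda> + a) div 2)))" .
  qed simp
  finally show ?thesis by simp
qed

end

section \<open>Averaging over the solutions\<close>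

lemma of_nat_bit: "(of_nat k :: bit) = of_bool (odd k)"
  by (induction k) simp_all

lemma bit_double: "(x :: bit) + x = 0"
  by (cases x) simp_all

definition bsign :: "bit \<Rightarrow> real" where "bsign b = (if b = 0 then 1 else - 1)"

lemma bsign_add: "bsign (a + b) = bsign a * bsign b"
  by (cases a; cases b) (simp_all add: bsign_def)

lemma bsign_sum: "bsign (\<Sum>i\<in>I. f i) = (\<Prod>i\<in>I. bsign (f i))"
proof (induction I rule: infinite_finite_induct)
  case (insert i I)
  then show ?case by (simp only: sum.insert[OF insert.hyps] prod.insert[OF insert.hyps] bsign_add insert.IH)
qed (simp_all add: bsign_def)

lemma edge_dot_add_left: "edge_dot E (s + t) z = edge_dot E s z + edge_dot E t z"
  unfolding edge_dot_def by (simp only: plus_fun_apply distrib_right sum.distrib)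

lemma edge_dot_add_right: "edge_dot E s (y + z) = edge_dot E s y + edge_dot E s z"
  unfolding edge_dot_def by (simp only: plus_fun_apply distrib_left sum.distrib)

text \<open>Induction on \<open>Z\<close>. If the vector \<open>t\<close> obtained for
  \<open>z\<close> fails on the new \<open>y\<close>, take \<open>t'\<close> for
  \<open>z + y\<close>, which is outside the span of \<open>Z\<close> too: either \<open>t'\<close>
  vanishes on \<open>y\<close> and separates \<open>z\<close>, or \<open>t + t'\<close>
  does.\<close>

lemma separating_vector:
  assumes fE: "finite E" and fZ: "finite Z"
  shows "z \<in> edge_space E \<Longrightarrow> z \<notin> F2_span Z \<Longrightarrow> Z \<subseteq> edge_space E \<Longrightarrow>
    \<exists>t\<in>edge_space E. (\<forall>y\<in>Z. edge_dot E t y = 0) \<and> edge_dot E t z = 1"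
  using fZ
proof (induction Z arbitrary: z rule: finite_induct)
  case empty
  have "z \<noteq> 0" using empty.prems(2) F2.span_zero by metis
  then obtain e where e: "z e \<noteq> 0" by (auto simp: fun_eq_iff)
  then have eE: "e \<in> E" using empty.prems(1) unfolding edge_space_def by auto
  define t where "t = (\<lambda>f. if f = e then 1 else 0 :: bit)"
  have "edge_dot E t z = (\<Sum>f\<in>E. if f = e then z f else 0)"
    unfolding edge_dot_def t_def by (intro sum.cong) auto
  also have "\<dots> = z e" using fE eE by simp
  also have "\<dots> = 1" using e by (cases "z e") simp_all
  finally have "edge_dot E t z = 1" .
  moreover have "t \<in> edge_space E" unfolding edge_space_def t_def using eE by auto
  ultimately show ?case by (intro bexI[of _ t]) simp_all
next
  case (insert y Z)
  have ye: "y \<in> edge_space E" "Z \<subseteq> edge_space E" using insert.prems(3) by simp_all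
  have addE: "s + t \<in> edge_space E" if "s \<in> edge_space E" "t \<in> edge_space E" for s t
    using that unfolding edge_space_def by simp
  have zZ: "z \<notin> F2_span Z" using insert.prems(2) F2.span_mono[of Z "insert y Z"] by blast
  obtain t where t: "t \<in> edge_space E" "\<forall>x\<in>Z. edge_dot E t x = 0" "edge_dot E t z = 1"
    using insert.IH[OF insert.prems(1) zZ ye(2)] by (elim bexE conjE)
  have zyZ: "z + y \<notin> F2_span Z"
  proof
    assume "z + y \<in> F2_span Z"
    then have "z + y \<in> F2_span (insert y Z)" using F2.span_mono[of Z "insert y Z"] by blast
    moreover have "y \<in> F2_span (insert y Z)" by (rule F2.span_base) simp
    ultimately have "(z + y) + y \<in> F2_span (insert y Z)" by (rule F2.span_add)
    moreover have "(z + y) + y = z" by (auto simp: fun_eq_iff add.assoc bit_double)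
    ultimately show False using insert.prems(2) by simp
  qed
  obtain t' where t': "t' \<in> edge_space E" "\<forall>x\<in>Z. edge_dot E t' x = 0" "edge_dot E t' (z + y) = 1"
    using insert.IH[OF addE[OF insert.prems(1) ye(1)] zyZ ye(2)] by (elim bexE conjE)
  have s: "edge_dot E t' z + edge_dot E t' y = 1" using t'(3) unfolding edge_dot_add_right .
  show ?case
  proof (cases "edge_dot E t y")
    case zero
    then show ?thesis using t by (intro bexI[of _ t]) simp_all
  next
    case one
    show ?thesis
    proof (cases "edge_dot E t' y")
      case zero
      then show ?thesis using t' s by (intro bexI[of _ t']) simp_all
    next
      case o: one
      then have "edge_dot E t' z = 0" using s by (cases "edge_dot E t' z") simp_all
      then have "edge_dot E (t + t') z = 1" using t(3) by (simp add: edge_dot_add_left)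
      moreover have "\<forall>x\<in>insert y Z. edge_dot E (t + t') x = 0"
      proof
        fix x assume x: "x \<in> insert y Z"
        have "edge_dot E t x = edge_dot E t' x"
        proof (cases "x = y")
          case True
          then show ?thesis using one o by simp
        next
          case False
          then show ?thesis using x t(2) t'(2) by simp
        qed
        then show "edge_dot E (t + t') x = 0" by (simp only: edge_dot_add_left bit_double)
      qed
      ultimately show ?thesis using addE[OF t(1) t'(1)] by (intro bexI[of _ "t + t'"] conjI)
    qed
  qed
qed

lemma finite_edge_space: "finite E \<Longrightarrow> finite (edge_space E)"
proof -
  assume fE: "finite E"
  have "edge_space E \<subseteq> (\<lambda>A. char_vec A) ` Pow E"
  proof
    fix s assume s: "s \<in> edge_space E"
    have "s = char_vec {e \<in> E. s e \<noteq> 0}"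
    proof
      fix e show "s e = char_vec {e \<in> E. s e \<noteq> 0} e"
        using s unfolding char_vec_def edge_space_def by (cases "s e") auto
    qed
    then show "s \<in> (\<lambda>A. char_vec A) ` Pow E" by (intro image_eqI[of _ _ "{e \<in> E. s e \<noteq> 0}"]) auto
  qed
  then show ?thesis using fE finite_subset by blast
qed

text \<open>Adding a vector that is orthogonal to all cycles of the family but not to
  \<open>z\<close> permutes the solutions and reverses every sign in the sum.\<close>

lemma solutions_orthogonal:
  assumes fE: "finite E" and CE: "\<And>C. C \<in> \<C> \<Longrightarrow> C \<subseteq> E" and z: "z \<in> edge_space E" "z \<notin> cycle_span \<C>"
  shows "(\<Sum>s\<in>solutions E \<C>. bsign (edge_dot E s z)) = 0"
proof -
  have "finite \<C>" by (rule finite_subset[of _ "Pow E"]) (use CE fE in auto)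
  then have fin: "finite (char_vec ` \<C>)" by simp
  have sub: "char_vec ` \<C> \<subseteq> edge_space E"
  proof (rule image_subsetI)
    fix C assume "C \<in> \<C>"
    then show "char_vec C \<in> edge_space E" using CE[of C] by (auto simp: char_vec_def edge_space_def)
  qed
  obtain t where t: "t \<in> edge_space E" "\<forall>y\<in>char_vec ` \<C>. edge_dot E t y = 0" "edge_dot E t z = 1"
    using separating_vector[OF fE fin z(1) z(2)[unfolded cycle_span_def] sub] by (elim bexE conjE)
  have mem: "s + t \<in> solutions E \<C>" if "s \<in> solutions E \<C>" for s
    using that t(1,2) unfolding solutions_def unbalanced_def edge_space_def by (simp add: edge_dot_add_left)
  have inv: "s + t + t = s" for s :: edge_vec by (auto simp: fun_eq_iff add.assoc bit_double)
  have "(\<Sum>s\<in>solutions E \<C>. bsign (edge_dot E s z)) = (\<Sum>s\<in>solutions E \<C>. bsign (edge_dot E (s + t) z))"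
    by (rule sum.reindex_bij_witness[of _ "\<lambda>s. s + t" "\<lambda>s. s + t"]) (use mem inv in auto)
  also have "\<dots> = (\<Sum>s\<in>solutions E \<C>. - bsign (edge_dot E s z))"
    by (rule sum.cong) (simp_all add: edge_dot_add_left bsign_add t(3), simp add: bsign_def)
  finally show ?thesis by (simp add: sum_negf)
qed

lemma weight_le_max:
  assumes "finite E" "z \<in> cycle_span \<C>"
  shows "vec_weight E z \<le> max_weight E \<C>"
proof -
  have "vec_weight E ` cycle_span \<C> \<subseteq> {..card E}"
    unfolding vec_weight_def using assms(1) by (auto intro: card_mono)
  then have "finite (vec_weight E ` cycle_span \<C>)" using finite_subset by blast
  then show ?thesis unfolding max_weight_def using assms(2) by (intro Max_ge) simp_all
qed

section \<open>The nonbacktracking polynomials\<close>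

definition walk_sign :: "(edge \<Rightarrow> real) \<Rightarrow> nat list \<Rightarrow> nat \<Rightarrow> real" where
  "walk_sign \<sigma> p k = (\<Prod>t<k. \<sigma> {p ! t, p ! Suc t})"

locale signed_regular = regular +
  fixes \<sigma> :: "edge \<Rightarrow> real"
  assumes pm1: "\<And>e. \<sigma> e = 1 \<or> \<sigma> e = - 1"
begin

abbreviation wsign where "wsign \<equiv> walk_sign \<sigma>"

lemma wsign_snoc: "length p = Suc k \<Longrightarrow> wsign (p @ [v]) (Suc k) = wsign p k * \<sigma> {p ! k, v}"
  unfolding walk_sign_def by (simp add: nth_append)

text \<open>
  Applied to an eigenfunction, the signed sums over nonbacktracking walks satisfy the recursion of
  the polynomials \<open>nbpoly\<close> below.
\<close>

definition nbsum :: "(nat \<Rightarrow> real) \<Rightarrow> nat \<Rightarrow> nat \<Rightarrow> real" where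
  "nbsum x k u = (\<Sum>p\<in>walks_from u k. wsign p k * x (p ! k))"

lemma walks_from_length: "p \<in> walks_from u k \<Longrightarrow> length p = Suc k"
  unfolding walks_from_def walk_lists_def by simp

lemma nbsum_Suc:
  assumes u: "u < n"
  shows "nbsum x (Suc k) u = (\<Sum>p\<in>walks_from u k. wsign p k * (\<Sum>v\<in>next_vertices k p. \<sigma> {p ! k, v} * x v))"
proof -
  have ex: "finite (next_vertices k p)" if "p \<in> walks_from u k" for p using next_vertices_card(1)[OF that u] .
  have "nbsum x (Suc k) u = (\<Sum>p\<in>walks_from u k. \<Sum>r\<in>(\<lambda>v. p @ [v]) ` next_vertices k p. wsign r (Suc k) * x (r ! Suc k))"
    unfolding nbsum_def walks_from_Suc
    by (rule sum.UNION_disjoint) (use finite_walks_from[OF u] ex in auto)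
  also have "\<dots> = (\<Sum>p\<in>walks_from u k. wsign p k * (\<Sum>v\<in>next_vertices k p. \<sigma> {p ! k, v} * x v))"
  proof (rule sum.cong[OF refl])
    fix p assume p: "p \<in> walks_from u k"
    have l: "length p = Suc k" using walks_from_length[OF p] .
    have "(\<Sum>r\<in>(\<lambda>v. p @ [v]) ` next_vertices k p. wsign r (Suc k) * x (r ! Suc k))
        = (\<Sum>v\<in>next_vertices k p. wsign (p @ [v]) (Suc k) * x ((p @ [v]) ! Suc k))"
      by (subst sum.reindex) (auto simp: inj_on_def)
    also have "\<dots> = (\<Sum>v\<in>next_vertices k p. wsign p k * (\<sigma> {p ! k, v} * x v))"
      using l by (intro sum.cong) (simp_all add: wsign_snoc nth_append)
    finally show "(\<Sum>r\<in>(\<lambda>v. p @ [v]) ` next_vertices k p. wsign r (Suc k) * x (r ! Suc k))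
        = wsign p k * (\<Sum>v\<in>next_vertices k p. \<sigma> {p ! k, v} * x v)" by (simp only: sum_distrib_left)
  qed
  finally show ?thesis .
qed

definition eigenfunction :: "real \<Rightarrow> (nat \<Rightarrow> real) \<Rightarrow> bool" where
  "eigenfunction \<mu> x \<longleftrightarrow> (\<forall>u<n. (\<Sum>v | {u, v} \<in> E. \<sigma> {u, v} * x v) = \<mu> * x u)"

lemma nbsum_0: "u < n \<Longrightarrow> nbsum x 0 u = x u"
proof -
  assume u: "u < n"
  have "walks_from u 0 = {[u]}" unfolding walks_from_def walk_lists_def nbwalk_def by (auto simp: length_Suc_conv)
  then show ?thesis unfolding nbsum_def walk_sign_def by simp
qed

lemma nbsum_1: "eigenfunction \<mu> x \<Longrightarrow> u < n \<Longrightarrow> nbsum x 1 u = \<mu> * x u"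
proof -
  assume e: "eigenfunction \<mu> x" and u: "u < n"
  have "walks_from u 0 = {[u]}" unfolding walks_from_def walk_lists_def nbwalk_def by (auto simp: length_Suc_conv)
  moreover have "next_vertices 0 [u] = {v. {u, v} \<in> E}" unfolding next_vertices_def by simp
  ultimately show ?thesis using nbsum_Suc[OF u, of x 0] e u unfolding eigenfunction_def walk_sign_def by simp
qed

text \<open>Summing over all neighbours of the last vertex gives the factor \<open>\<mu>\<close>.
  The backtracking step has to be subtracted; it cancels the sign of the last edge and leaves a walk
  one step shorter, which arises once for each of its extensions.\<close>

lemma nbsum_rec:
  assumes e: "eigenfunction \<mu> x" and u: "u < n"
  shows "nbsum x (Suc (Suc k)) u = \<mu> * nbsum x (Suc k) u - (if k = 0 then real d else real (d - 1)) * nbsum x k u"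
proof -
  have ext: "(\<Sum>v\<in>next_vertices (Suc k) p. \<sigma> {p ! Suc k, v} * x v) = \<mu> * x (p ! Suc k) - \<sigma> {p ! k, p ! Suc k} * x (p ! k)"
    if p: "p \<in> walks_from u (Suc k)" for p
  proof -
    have pk: "p \<in> walk_lists E (Suc k)" "p ! 0 = u" using p unfolding walks_from_def by simp_all
    have w: "p ! Suc k < n" using walk_lt[OF pk(1), of "Suc k"] pk(2) u by simp
    have step_edge: "{p ! k, p ! Suc k} \<in> E" using pk(1) unfolding walk_lists_def nbwalk_def by auto
    have f: "finite {v. {p ! Suc k, v} \<in> E}" using neighbors[OF w] by simp
    have ex: "next_vertices (Suc k) p = {v. {p ! Suc k, v} \<in> E} - {p ! k}" unfolding next_vertices_def by auto
    have "p ! k \<in> {v. {p ! Suc k, v} \<in> E}" using step_edge by (simp add: insert_commute)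
    note sum.remove[OF f this, of "\<lambda>v. \<sigma> {p ! Suc k, v} * x v"]
    moreover have "(\<Sum>v | {p ! Suc k, v} \<in> E. \<sigma> {p ! Suc k, v} * x v) = \<mu> * x (p ! Suc k)"
      using e w unfolding eigenfunction_def by simp
    moreover have "{p ! Suc k, p ! k} = {p ! k, p ! Suc k}" by (rule insert_commute)
    ultimately show ?thesis unfolding ex by simp
  qed
  have "nbsum x (Suc (Suc k)) u = (\<Sum>p\<in>walks_from u (Suc k). \<mu> * (wsign p (Suc k) * x (p ! Suc k)) - wsign p (Suc k) * \<sigma> {p ! k, p ! Suc k} * x (p ! k))"
    unfolding nbsum_Suc[OF u]
  proof (rule sum.cong[OF refl])
    fix p assume p: "p \<in> walks_from u (Suc k)"
    show "wsign p (Suc k) * (\<Sum>v\<in>next_vertices (Suc k) p. \<sigma> {p ! Suc k, v} * x v)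
        = \<mu> * (wsign p (Suc k) * x (p ! Suc k)) - wsign p (Suc k) * \<sigma> {p ! k, p ! Suc k} * x (p ! k)"
      unfolding ext[OF p] by (simp add: algebra_simps)
  qed
  also have "\<dots> = \<mu> * nbsum x (Suc k) u - (\<Sum>p\<in>walks_from u (Suc k). wsign p (Suc k) * \<sigma> {p ! k, p ! Suc k} * x (p ! k))"
    unfolding nbsum_def sum_subtractf sum_distrib_left ..
  also have "(\<Sum>p\<in>walks_from u (Suc k). wsign p (Suc k) * \<sigma> {p ! k, p ! Suc k} * x (p ! k))
      = (\<Sum>p\<in>walks_from u (Suc k). wsign p k * x (p ! k))"
  proof (rule sum.cong[OF refl])
    fix p
    have "wsign p (Suc k) * \<sigma> {p ! k, p ! Suc k} = wsign p k * (\<sigma> {p ! k, p ! Suc k} * \<sigma> {p ! k, p ! Suc k})"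
      unfolding walk_sign_def by simp
    also have "\<sigma> {p ! k, p ! Suc k} * \<sigma> {p ! k, p ! Suc k} = 1" using pm1[of "{p ! k, p ! Suc k}"] by auto
    finally show "wsign p (Suc k) * \<sigma> {p ! k, p ! Suc k} * x (p ! k) = wsign p k * x (p ! k)" by simp
  qed
  also have "\<dots> = (\<Sum>p\<in>walks_from u k. \<Sum>v\<in>next_vertices k p. wsign p k * x (p ! k))"
  proof -
    have ex: "finite (next_vertices k p)" if "p \<in> walks_from u k" for p using next_vertices_card(1)[OF that u] .
    have "(\<Sum>p\<in>walks_from u (Suc k). wsign p k * x (p ! k)) = (\<Sum>p\<in>walks_from u k. \<Sum>r\<in>(\<lambda>v. p @ [v]) ` next_vertices k p. wsign r k * x (r ! k))"
      unfolding walks_from_Suc by (rule sum.UNION_disjoint) (use finite_walks_from[OF u] ex in auto)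
    also have "\<dots> = (\<Sum>p\<in>walks_from u k. \<Sum>v\<in>next_vertices k p. wsign p k * x (p ! k))"
    proof (rule sum.cong[OF refl])
      fix p assume p: "p \<in> walks_from u k"
      have l: "length p = Suc k" using walks_from_length[OF p] .
      have "wsign (p @ [v]) k = wsign p k" for v unfolding walk_sign_def using l
        by (intro prod.cong) (simp_all add: nth_append)
      then show "(\<Sum>r\<in>(\<lambda>v. p @ [v]) ` next_vertices k p. wsign r k * x (r ! k)) = (\<Sum>v\<in>next_vertices k p. wsign p k * x (p ! k))"
        using l by (subst sum.reindex) (auto simp: inj_on_def nth_append)
    qed
    finally show ?thesis .
  qed
  also have "\<dots> = (if k = 0 then real d else real (d - 1)) * nbsum x k u"
    unfolding nbsum_def sum_distrib_left
    by (rule sum.cong[OF refl]) (use next_vertices_card(2)[OF _ u] in simp)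
  finally show ?thesis .
qed

end

text \<open>At a vertex of a regular graph a walk of length 0 has \<open>d\<close> extensions and a
  longer one \<open>d - 1\<close>; this is the exceptional coefficient at
  \<open>k = 0\<close>.\<close>

fun nbpoly :: "nat \<Rightarrow> nat \<Rightarrow> real \<Rightarrow> real" where
  "nbpoly d 0 x = 1"
| "nbpoly d (Suc 0) x = x"
| "nbpoly d (Suc (Suc k)) x = x * nbpoly d (Suc k) x - (if k = 0 then real d else real (d - 1)) * nbpoly d k x"

lemma nbpoly_minus: "nbpoly d k (- x) = (- 1) ^ k * nbpoly d k x"
proof (induction d k x rule: nbpoly.induct)
  case (3 d k x)
  then show ?case by (simp only: nbpoly.simps power_Suc) (simp add: algebra_simps)
qed simp_all

text \<open>Up to the factor \<open>(d - 1) powr (k / 2)\<close>, the value is \<open>r ^ k + r powr - k\<close> plus the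
  nonnegative correction \<open>c k\<close>.\<close>

lemma nbpoly_ge:
  assumes d: "2 \<le> d" and r: "1 \<le> r" and k: "1 \<le> k" and x: "x = sqrt (real (d - 1)) * (r + 1 / r)"
  shows "sqrt (real (d - 1)) ^ k * r ^ k \<le> nbpoly d k x"
proof -
  define b where "b = sqrt (real (d - 1))"
  have b: "b > 0" "b * b = real (d - 1)" unfolding b_def using d by simp_all
  define c where "c k = nbpoly d k x / b ^ k - (r ^ k + 1 / r ^ k)" for k
  have q: "nbpoly d k x = b ^ k * (c k + r ^ k + 1 / r ^ k)" for k unfolding c_def using b(1) by simp
  have rp: "r > 0" using r by simp
  have xb: "x = b * (r + 1 / r)" unfolding x b_def ..
  have c1: "c 1 = 0" unfolding c_def using b(1) by (simp add: xb)
  have rd: "real d = b * b + 1" unfolding b(2) using d by (simp add: of_nat_diff)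
  have c2: "c 2 = 1 - 1 / (b * b)"
  proof -
    have "nbpoly d 2 x = x * x - real d" by (simp add: numeral_2_eq_2)
    also have "\<dots> = b ^ 2 * ((1 - 1 / (b * b)) + r ^ 2 + 1 / r ^ 2)"
      unfolding xb rd using b(1) rp by (simp add: field_simps power2_eq_square)
    finally show ?thesis using q[of 2] b(1) by simp
  qed
  have b1: "b * b \<ge> 1" using d unfolding b(2) by simp
  \<comment> \<open>After division by \<open>b ^ k\<close> the recursion has the solution
    \<open>r ^ k + 1 / r ^ k\<close>, so the remainder \<open>c\<close> satisfies it as well. From
    \<open>c 1 = 0 \<le> c 2\<close> and \<open>r + 1 / r \<ge> 2\<close> it follows that
    \<open>c\<close> is nondecreasing, hence nonnegative.\<close>
  have crec: "c (Suc (Suc k)) = (r + 1 / r) * c (Suc k) - c k" if "1 \<le> k" for k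
  proof -
    have bnz: "b ^ Suc (Suc k) \<noteq> 0" using b(1) by simp
    have gen: "(b * y) * (b ^ Suc k * A) - b * b * (b ^ k * B) = b ^ Suc (Suc k) * (y * A - B)" for A B y
      by (simp add: algebra_simps)
    have "nbpoly d (Suc (Suc k)) x = x * nbpoly d (Suc k) x - b * b * nbpoly d k x"
      using that b(2) by simp
    also have "\<dots> = b ^ Suc (Suc k) * ((r + 1 / r) * (c (Suc k) + r ^ Suc k + 1 / r ^ Suc k) - (c k + r ^ k + 1 / r ^ k))"
      unfolding q[of "Suc k"] q[of k] by (rule gen[of "r + 1 / r", folded xb])
    finally have fin: "nbpoly d (Suc (Suc k)) x = b ^ Suc (Suc k) * ((r + 1 / r) * (c (Suc k) + r ^ Suc k + 1 / r ^ Suc k) - (c k + r ^ k + 1 / r ^ k))" .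
    have "b ^ Suc (Suc k) * (c (Suc (Suc k)) + r ^ Suc (Suc k) + 1 / r ^ Suc (Suc k)) = b ^ Suc (Suc k) * ((r + 1 / r) * (c (Suc k) + r ^ Suc k + 1 / r ^ Suc k) - (c k + r ^ k + 1 / r ^ k))"
      by (rule trans[OF q[symmetric] fin])
    then have "c (Suc (Suc k)) + r ^ Suc (Suc k) + 1 / r ^ Suc (Suc k) = (r + 1 / r) * (c (Suc k) + r ^ Suc k + 1 / r ^ Suc k) - (c k + r ^ k + 1 / r ^ k)"
      unfolding mult_left_cancel[OF bnz] .
    moreover have "(r + 1 / r) * (r ^ Suc k + 1 / r ^ Suc k) - (r ^ k + 1 / r ^ k) = r ^ Suc (Suc k) + 1 / r ^ Suc (Suc k)"
      using rp by (simp add: field_simps)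
    ultimately show ?thesis by (simp add: algebra_simps)
  qed
  have r2: "r + 1 / r \<ge> 2"
  proof -
    have "0 \<le> (r - 1) ^ 2" by simp
    then show ?thesis using rp by (simp add: field_simps power2_eq_square)
  qed
  have "0 \<le> c (Suc k) \<and> c (Suc k) \<le> c (Suc (Suc k))" for k
  proof (induction k)
    case 0
    show ?case using c1 c2 b1 by (simp add: numeral_2_eq_2)
  next
    case (Suc k)
    have "2 * c (Suc (Suc k)) \<le> (r + 1 / r) * c (Suc (Suc k))" using Suc r2 by (intro mult_right_mono) auto
    then show ?case using crec[of "Suc k"] Suc by simp
  qed
  then have "0 \<le> c k" using k by (cases k) auto
  then have "r ^ k \<le> c k + r ^ k + 1 / r ^ k" using rp by simp
  then have "b ^ k * r ^ k \<le> b ^ k * (c k + r ^ k + 1 / r ^ k)" using b(1) by (intro mult_left_mono) auto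
  then show ?thesis unfolding q[symmetric] unfolding b_def .
qed

context signed_regular
begin

lemma nbsum_eq: "eigenfunction \<mu> x \<Longrightarrow> u < n \<Longrightarrow> nbsum x k u = nbpoly d k \<mu> * x u"
proof (induction k rule: induct_nat_012)
  case (ge2 k)
  then show ?case by (simp add: nbsum_rec algebra_simps)
qed (simp_all add: nbsum_0 nbsum_1[simplified])

end

section \<open>From signed sums over pairs of walks to the spectral radius\<close>

definition walk_pairs :: "nat \<Rightarrow> edge set \<Rightarrow> nat \<Rightarrow> (nat list \<times> nat list) set" where
  "walk_pairs n E m = {(p, q). p \<in> walk_lists E m \<and> q \<in> walk_lists E m \<and> p ! 0 < n \<and> q ! 0 = p ! 0 \<and> p ! m = q ! m}"

context regular
begin

lemma finite_walk_pairs: "finite (walk_pairs n E m)"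
  by (rule finite_subset[OF _ finite_cartesian_product[OF finite_walks[of m] finite_walks[of m]]])
    (auto simp: walk_pairs_def)

end

context signed_regular
begin

text \<open>The Cauchy-Schwarz bound at each \<open>u\<close> contains the full norm of
  \<open>x\<close>; after summation over \<open>u\<close> this norm appears on both sides and
  cancels. The squared signed counts from \<open>u\<close> to \<open>y\<close> unfold into pairs of
  walks with these ends.\<close>

lemma nbpoly_sq_le:
  assumes e: "eigenfunction \<mu> x" and x: "\<exists>u<n. x u \<noteq> 0"
  shows "(nbpoly d m \<mu>)\<^sup>2 \<le> (\<Sum>(p, q)\<in>walk_pairs n E m. wsign p m * wsign q m)"
proof -
  define N where "N u y = {p \<in> walks_from u m. p ! m = y}" for u y
  define g where "g u y = (\<Sum>p\<in>N u y. wsign p m)" for u y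
  have fN: "finite (N u y)" if "u < n" for u y using finite_walks_from[OF that] unfolding N_def by simp
  have eq: "nbpoly d m \<mu> * x u = (\<Sum>y<n. g u y * x y)" if u: "u < n" for u
  proof -
    have "(\<Sum>y<n. g u y * x y) = (\<Sum>y<n. \<Sum>p\<in>N u y. wsign p m * x (p ! m))"
      unfolding g_def sum_distrib_right N_def by (intro sum.cong) auto
    also have "\<dots> = nbsum x m u" unfolding N_def nbsum_def
      by (rule sum.group[OF finite_walks_from[OF u]]) (use walk_lt[of _ m m] u in \<open>auto simp: walks_from_def\<close>)
    finally show ?thesis using nbsum_eq[OF e u] by simp
  qed
  have sq: "(nbpoly d m \<mu>)\<^sup>2 * (x u)\<^sup>2 \<le> (\<Sum>y<n. (g u y)\<^sup>2) * (\<Sum>y<n. (x y)\<^sup>2)" if u: "u < n" for u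
    using Cauchy_Schwarz_ineq_sum[of "g u" x "{..<n}"] unfolding eq[OF u, symmetric] power_mult_distrib .
  have gg: "(\<Sum>u<n. \<Sum>y<n. (g u y)\<^sup>2) = (\<Sum>(p, q)\<in>walk_pairs n E m. wsign p m * wsign q m)"
  proof -
    have "(g u y)\<^sup>2 = (\<Sum>(p, q)\<in>{r \<in> walk_pairs n E m. (fst r ! 0, fst r ! m) = (u, y)}. wsign p m * wsign q m)"
      if u: "u < n" for u y
    proof -
      have "(g u y)\<^sup>2 = (\<Sum>(p, q)\<in>N u y \<times> N u y. wsign p m * wsign q m)"
        unfolding g_def power2_eq_square sum_product sum.cartesian_product ..
      also have "N u y \<times> N u y = {r \<in> walk_pairs n E m. (fst r ! 0, fst r ! m) = (u, y)}"
        using u unfolding N_def walks_from_def walk_pairs_def by auto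
      finally show ?thesis .
    qed
    then have "(\<Sum>u<n. \<Sum>y<n. (g u y)\<^sup>2) = (\<Sum>u<n. \<Sum>y<n.
        (\<Sum>(p, q)\<in>{r \<in> walk_pairs n E m. (fst r ! 0, fst r ! m) = (u, y)}. wsign p m * wsign q m))"
      by (intro sum.cong) simp_all
    also have "\<dots> = (\<Sum>z\<in>{..<n} \<times> {..<n}.
        (\<Sum>(p, q)\<in>{r \<in> walk_pairs n E m. (fst r ! 0, fst r ! m) = z}. wsign p m * wsign q m))"
      unfolding sum.cartesian_product by (rule sum.cong) auto
    also have "\<dots> = (\<Sum>(p, q)\<in>walk_pairs n E m. wsign p m * wsign q m)"
    proof (rule sum.group[OF finite_walk_pairs])
      show "(\<lambda>r. (fst r ! 0, fst r ! m)) ` walk_pairs n E m \<subseteq> {..<n} \<times> {..<n}"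
        using walk_lt[of _ m m] by (auto simp: walk_pairs_def)
    qed simp
    finally show ?thesis .
  qed
  have "(nbpoly d m \<mu>)\<^sup>2 * (\<Sum>u<n. (x u)\<^sup>2) = (\<Sum>u<n. (nbpoly d m \<mu>)\<^sup>2 * (x u)\<^sup>2)" by (rule sum_distrib_left)
  also have "\<dots> \<le> (\<Sum>u<n. (\<Sum>y<n. (g u y)\<^sup>2) * (\<Sum>y<n. (x y)\<^sup>2))" by (rule sum_mono) (use sq in auto)
  also have "\<dots> = (\<Sum>u<n. \<Sum>y<n. (g u y)\<^sup>2) * (\<Sum>y<n. (x y)\<^sup>2)" by (rule sum_distrib_right[symmetric])
  finally have "(nbpoly d m \<mu>)\<^sup>2 * (\<Sum>u<n. (x u)\<^sup>2) \<le> (\<Sum>u<n. \<Sum>y<n. (g u y)\<^sup>2) * (\<Sum>y<n. (x y)\<^sup>2)" .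
  moreover have "0 < (\<Sum>u<n. (x u)\<^sup>2)"
  proof -
    obtain u where u: "u < n" "x u \<noteq> 0" using x by auto
    show ?thesis by (rule sum_pos2[of _ u]) (use u in simp_all)
  qed
  ultimately show ?thesis unfolding gg by simp
qed

text \<open>The form \<open>S\<close> is invariant under conjugation because the matrix is real and
  symmetric, so \<open>c\<close> is real. Then the real and the imaginary part of an eigenvector
  both satisfy the eigenvalue equation, and one of them is nonzero.\<close>

lemma spectrum_eigenfunction:
  assumes l: "c \<in> spectrum (signed_adjacency n E \<sigma>)"
  shows "\<exists>\<mu> x. c = complex_of_real \<mu> \<and> eigenfunction \<mu> x \<and> (\<exists>u<n. x u \<noteq> 0)"
proof -
  define A where "A = signed_adjacency n E \<sigma>"
  obtain v where v: "v \<in> carrier_vec n" "v \<noteq> 0\<^sub>v n" "A *\<^sub>v v = c \<cdot>\<^sub>v v"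
    using l unfolding spectrum_def eigenvalue_def eigenvector_def A_def signed_adjacency_def by auto
  define s where "s u y = (if {u, y} \<in> E then \<sigma> {u, y} else 0)" for u y
  have ssym: "s u y = s y u" for u y unfolding s_def by (simp add: insert_commute)
  have ev: "(\<Sum>y<n. complex_of_real (s u y) * v $ y) = c * v $ u" if u: "u < n" for u
  proof -
    have "(A *\<^sub>v v) $ u = (\<Sum>y<n. complex_of_real (s u y) * v $ y)"
      using u v(1) unfolding A_def signed_adjacency_def s_def
      by (auto simp: scalar_prod_def lessThan_atLeast0 intro!: sum.cong)
    then show ?thesis using v(1,3) u by simp
  qed
  define S where "S = (\<Sum>u<n. \<Sum>y<n. cnj (v $ u) * (complex_of_real (s u y) * v $ y))"
  define N where "N = (\<Sum>u<n. (cmod (v $ u))\<^sup>2)"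
  obtain u0 where u0: "u0 < n" "v $ u0 \<noteq> 0"
    using v(1,2) by (metis carrier_vecD eq_vecI index_zero_vec)
  have N: "0 < N" unfolding N_def by (rule sum_pos2[of _ u0]) (use u0 in simp_all)
  have "S = (\<Sum>u<n. cnj (v $ u) * (c * v $ u))" unfolding S_def sum_distrib_left[symmetric] by (simp add: ev)
  also have "\<dots> = c * complex_of_real N"
    unfolding N_def of_real_sum sum_distrib_left
    by (rule sum.cong) (simp_all only: complex_norm_square mult.assoc mult.commute mult.left_commute)
  finally have S: "S = c * complex_of_real N" .
  have "cnj S = (\<Sum>u<n. \<Sum>y<n. cnj (v $ y) * (complex_of_real (s y u) * v $ u))"
    unfolding S_def cnj_sum by (intro sum.cong) (simp_all add: ssym mult.commute mult.left_commute)
  also have "\<dots> = S" unfolding S_def by (rule sum.swap)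
  finally have "Im S = 0" using complex_cnj_cancel_iff by (metis Reals_cnj_iff complex_is_Real_iff)
  then have im: "Im c = 0" using N unfolding S by simp
  then have lam: "c = complex_of_real (Re c)" by (simp add: complex_eq_iff)
  have sum_s: "(\<Sum>y | {u, y} \<in> E. \<sigma> {u, y} * f y) = (\<Sum>y<n. s u y * f y)" if "u < n" for u and f :: "nat \<Rightarrow> real"
  proof (rule sum.mono_neutral_cong_left)
    show "{y. {u, y} \<in> E} \<subseteq> {..<n}" using edge_lt by auto
  qed (auto simp: s_def)
  have "eigenfunction (Re c) (\<lambda>u. Re (v $ u))" unfolding eigenfunction_def
  proof (intro allI impI)
    fix u assume u: "u < n"
    have "(\<Sum>y<n. s u y * Re (v $ y)) = Re (\<Sum>y<n. complex_of_real (s u y) * v $ y)" by simp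
    then show "(\<Sum>v' | {u, v'} \<in> E. \<sigma> {u, v'} * Re (v $ v')) = Re c * Re (v $ u)"
      unfolding sum_s[OF u] ev[OF u] using im by simp
  qed
  moreover have "eigenfunction (Re c) (\<lambda>u. Im (v $ u))" unfolding eigenfunction_def
  proof (intro allI impI)
    fix u assume u: "u < n"
    have "(\<Sum>y<n. s u y * Im (v $ y)) = Im (\<Sum>y<n. complex_of_real (s u y) * v $ y)" by simp
    then show "(\<Sum>v' | {u, v'} \<in> E. \<sigma> {u, v'} * Im (v $ v')) = Re c * Im (v $ u)"
      unfolding sum_s[OF u] ev[OF u] using im by simp
  qed
  moreover have "Re (v $ u0) \<noteq> 0 \<or> Im (v $ u0) \<noteq> 0" using u0(2) by (auto simp: complex_eq_iff)
  ultimately show ?thesis using lam u0(1)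
    by (elim disjE) (intro exI[of _ "Re c"] exI conjI; (assumption | blast))+
qed

lemma spectral_radius_eigenfunction:
  assumes "0 < n"
  obtains \<mu> x where "spectral_radius (signed_adjacency n E \<sigma>) = \<bar>\<mu>\<bar>" "eigenfunction \<mu> x" "\<exists>u<n. x u \<noteq> 0"
proof -
  have "signed_adjacency n E \<sigma> \<in> carrier_mat n n" unfolding signed_adjacency_def by simp
  then obtain l where l: "l \<in> spectrum (signed_adjacency n E \<sigma>)" "spectral_radius (signed_adjacency n E \<sigma>) = norm l"
    using spectral_radius_mem_max(1)[OF _ assms] by auto
  from spectrum_eigenfunction[OF l(1)] show ?thesis
  proof (elim exE conjE)
    fix \<mu> x u assume e: "l = complex_of_real \<mu>" "eigenfunction \<mu> x" "u < n" "x u \<noteq> 0"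
    show ?thesis by (rule that[OF _ e(2)]) (use e(3,4) in \<open>auto simp: l(2) e(1)\<close>)
  qed
qed

theorem spectral_radius_le:
  assumes n: "0 < n" and m: "1 \<le> m" and M: "1 \<le> M"
    and F: "(\<Sum>(p, q)\<in>walk_pairs n E m. wsign p m * wsign q m) \<le> M * real (d - 1) ^ m"
  shows "spectral_radius (signed_adjacency n E \<sigma>) \<le> 2 * sqrt (real (d - 1)) * M powr (1 / (2 * real m))"
proof -
  obtain \<mu> x where \<mu>: "spectral_radius (signed_adjacency n E \<sigma>) = \<bar>\<mu>\<bar>" "eigenfunction \<mu> x" "\<exists>u<n. x u \<noteq> 0"
    by (rule spectral_radius_eigenfunction[OF n])
  define b where "b = sqrt (real (d - 1))"
  have b: "b > 0" "b\<^sup>2 = real (d - 1)" unfolding b_def using d by simp_all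
  have M1: "1 \<le> M powr (1 / (2 * real m))" using M by (simp add: ge_one_powr_ge_zero)
  show ?thesis
  proof (cases "\<bar>\<mu>\<bar> \<le> 2 * b")
    case True
    have "2 * b * 1 \<le> 2 * b * M powr (1 / (2 * real m))" using b(1) M1 by (intro mult_left_mono) auto
    then show ?thesis unfolding \<mu>(1) b_def[symmetric] using True by simp
  next
    case False
    define y where "y = \<bar>\<mu>\<bar> / b"
    have y: "2 < y" unfolding y_def using False b(1) by (simp add: field_simps)
    define w where "w = sqrt (y\<^sup>2 - 4)"
    \<comment> \<open>The larger solution of \<open>r + 1 / r = y\<close>, which is real because
      \<open>y > 2\<close>.\<close>
    define r where "r = (y + w) / 2"
    have y4: "0 \<le> y\<^sup>2 - 4" using y power_mono[of 2 y 2] by simp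
    have w: "0 \<le> w" "w\<^sup>2 = y\<^sup>2 - 4" unfolding w_def using y4 by simp_all
    have r1: "1 \<le> r" unfolding r_def using y w(1) by simp
    have "w = 2 * r - y" unfolding r_def by (simp add: field_simps)
    then have "(2 * r - y)\<^sup>2 = y\<^sup>2 - 4" using w(2) by simp
    then have "r * r + 1 = r * y" by (simp add: power2_eq_square algebra_simps)
    then have ry: "y = r + 1 / r" using r1 by (simp add: field_simps)
    have mu: "\<bar>\<mu>\<bar> = b * (r + 1 / r)" unfolding ry[symmetric] y_def using b(1) by simp
    have "b ^ m * r ^ m \<le> nbpoly d m \<bar>\<mu>\<bar>" unfolding b_def
      by (rule nbpoly_ge[OF d r1 m]) (use mu in \<open>simp add: b_def\<close>)
    then have "(b ^ m * r ^ m)\<^sup>2 \<le> (nbpoly d m \<bar>\<mu>\<bar>)\<^sup>2" using b(1) r1 by (intro power_mono) auto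
    also have "(nbpoly d m \<bar>\<mu>\<bar>)\<^sup>2 = (nbpoly d m \<mu>)\<^sup>2"
      by (cases "0 \<le> \<mu>") (simp_all add: nbpoly_minus power_mult_distrib power_even_eq[symmetric] flip: power_mult)
    also have "\<dots> \<le> M * real (d - 1) ^ m" using nbpoly_sq_le[OF \<mu>(2,3), of m] F by linarith
    finally have "real (d - 1) ^ m * r ^ (2 * m) \<le> real (d - 1) ^ m * M"
      unfolding b(2)[symmetric] by (simp add: power_mult_distrib mult.commute flip: power_mult)
    then have "r ^ (2 * m) \<le> M" using b(1,2) d by simp
    moreover have "r powr real (2 * m) = r ^ (2 * m)" by (rule powr_realpow) (use r1 in simp)
    ultimately have "r powr real (2 * m) \<le> M" by simp
    then have "(r powr real (2 * m)) powr (1 / (2 * real m)) \<le> M powr (1 / (2 * real m))"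
      by (intro powr_mono2) simp_all
    then have rM: "r \<le> M powr (1 / (2 * real m))" using m r1 by (simp add: powr_powr)
    have "1 / r \<le> 1" using r1 by simp
    then have "1 / r \<le> r" using r1 by linarith
    then have "\<bar>\<mu>\<bar> \<le> b * (2 * r)" unfolding mu using b(1) by (intro mult_left_mono) auto
    also have "\<dots> \<le> 2 * b * M powr (1 / (2 * real m))" using rM b(1) by simp
    finally show ?thesis unfolding \<mu>(1) b_def .
  qed
qed

text \<open>Evaluate the eigenvalue equation where \<open>x\<close> has largest modulus. This
  settles \<open>d = 2\<close>: powers of \<open>d - 1 = 1\<close> cannot absorb the polynomial
  factors, but there \<open>d = 2 * sqrt (d - 1)\<close>.\<close>

theorem spectral_radius_le_degree:
  assumes n: "0 < n"
  shows "spectral_radius (signed_adjacency n E \<sigma>) \<le> real d"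
proof -
  obtain \<mu> x where \<mu>: "spectral_radius (signed_adjacency n E \<sigma>) = \<bar>\<mu>\<bar>" "eigenfunction \<mu> x" "\<exists>u<n. x u \<noteq> 0"
    by (rule spectral_radius_eigenfunction[OF n])
  define X where "X = Max ((\<lambda>u. \<bar>x u\<bar>) ` {..<n})"
  have X: "\<bar>x v\<bar> \<le> X" if "v < n" for v unfolding X_def using that by (intro Max_ge) auto
  have "X \<in> (\<lambda>u. \<bar>x u\<bar>) ` {..<n}" unfolding X_def using n by (intro Max_in) auto
  then obtain u where u: "u < n" "X = \<bar>x u\<bar>" by auto
  have X0: "0 < X" using \<mu>(3) X by (meson less_le_trans zero_less_abs_iff)
  have "\<bar>\<mu>\<bar> * X = \<bar>\<Sum>v | {u, v} \<in> E. \<sigma> {u, v} * x v\<bar>"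
    using \<mu>(2) u unfolding eigenfunction_def by (simp add: abs_mult)
  also have "\<dots> \<le> (\<Sum>v | {u, v} \<in> E. \<bar>\<sigma> {u, v} * x v\<bar>)" by (rule sum_abs)
  also have "\<dots> \<le> of_nat (card {v. {u, v} \<in> E}) * X"
  proof (rule sum_bounded_above)
    fix v assume "v \<in> {v. {u, v} \<in> E}"
    then have "v < n" using edge_lt[of u v] by simp
    moreover have "\<bar>\<sigma> {u, v}\<bar> = 1" using pm1[of "{u, v}"] by auto
    ultimately show "\<bar>\<sigma> {u, v} * x v\<bar> \<le> X" using X by (simp add: abs_mult)
  qed
  also have "\<dots> = real d * X" using neighbors[OF u(1)] by simp
  finally show ?thesis unfolding \<mu>(1) using X0 by simp
qed

end

lemma sum_ecount:
  fixes s :: "edge \<Rightarrow> 'a::comm_semiring_1"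
  assumes "finite E"
  shows "(\<And>t. t < m \<Longrightarrow> {w t, w (Suc t)} \<in> E) \<Longrightarrow> (\<Sum>e\<in>E. s e * of_nat (ecount w m e)) = (\<Sum>t<m. s {w t, w (Suc t)})"
proof (induction m)
  case 0
  then show ?case by (simp add: ecount_def)
next
  case (Suc m)
  have "(\<Sum>e\<in>E. s e * of_nat (ecount w (Suc m) e)) = (\<Sum>e\<in>E. s e * of_nat (ecount w m e)) + (\<Sum>e\<in>E. if {w m, w (Suc m)} = e then s e else 0)"
    unfolding ecount_def sum.distrib[symmetric] by (rule sum.cong) (simp_all add: distrib_left)
  also have "(\<Sum>e\<in>E. if {w m, w (Suc m)} = e then s e else 0) = s {w m, w (Suc m)}"
    using assms Suc.prems[of m] by simp
  finally show ?case using Suc by simp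
qed

context count_bound
begin

lemma finite_edges: "finite E"
  by (rule finite_subset[of _ "Pow {..<n}"]) (use sg in \<open>auto simp: simple_graph_def\<close>)

lemma signing_average:
  assumes CE: "\<And>C. C \<in> \<C> \<Longrightarrow> C \<subseteq> E" and W: "max_weight E \<C> \<le> \<Lambda>" and con: "consistent E \<C>"
  shows "\<exists>s\<in>solutions E \<C>. (\<Sum>(p, q)\<in>walk_pairs n E m. walk_sign (signing s) p m * walk_sign (signing s) q m) \<le> real (card Pairs)"
proof -
  note fE = finite_edges
  \<comment> \<open>The parity vector of a pair, set to 0 outside \<open>E\<close> so that it
    belongs to \<open>edge_space E\<close>.\<close>
  define z where "z r = (\<lambda>e. of_nat (if e \<in> E then ecount ((!) (fst r)) m e + ecount ((!) (snd r)) m e else 0) :: bit)" for r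
  have zE: "z r \<in> edge_space E" for r unfolding z_def edge_space_def by simp
  have ws: "walk_sign (signing s) p m = bsign (\<Sum>e\<in>E. s e * of_nat (ecount ((!) p) m e))" if p: "p \<in> walk_lists E m" for s p
  proof -
    have "{p ! t, p ! Suc t} \<in> E" if "t < m" for t using p that unfolding walk_lists_def nbwalk_def by auto
    then have 1: "(\<Sum>e\<in>E. s e * of_nat (ecount ((!) p) m e)) = (\<Sum>t<m. s {p ! t, p ! Suc t})" by (rule sum_ecount[OF fE])
    show ?thesis unfolding 1 walk_sign_def bsign_sum by (simp add: signing_def bsign_def)
  qed
  have sgn: "walk_sign (signing s) p m * walk_sign (signing s) q m = bsign (edge_dot E s (z (p, q)))"
    if "(p, q) \<in> walk_pairs n E m" for s p q
  proof -
    have "p \<in> walk_lists E m" "q \<in> walk_lists E m" using that unfolding walk_pairs_def by simp_all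
    note ws[OF this(1)] ws[OF this(2)]
    then have "walk_sign (signing s) p m * walk_sign (signing s) q m
        = bsign ((\<Sum>e\<in>E. s e * of_nat (ecount ((!) p) m e)) + (\<Sum>e\<in>E. s e * of_nat (ecount ((!) q) m e)))"
      by (simp only: bsign_add)
    also have "(\<Sum>e\<in>E. s e * of_nat (ecount ((!) p) m e)) + (\<Sum>e\<in>E. s e * of_nat (ecount ((!) q) m e)) = edge_dot E s (z (p, q))"
      unfolding edge_dot_def z_def sum.distrib[symmetric]
      by (rule sum.cong) (simp_all only: of_nat_add distrib_left fst_conv snd_conv if_True)
    finally show ?thesis .
  qed
  define S where "S = solutions E \<C>"
  have finS: "finite S" unfolding S_def solutions_def using finite_edge_space[OF fE] by simp
  have Sne: "S \<noteq> {}" using con unfolding consistent_def S_def .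
  have pq: "(\<Sum>s\<in>S. bsign (edge_dot E s (z r))) \<le> (if r \<in> Pairs then real (card S) else 0)" if r: "r \<in> walk_pairs n E m" for r
  proof (cases "z r \<in> cycle_span \<C>")
    case True
    have out: "ecount ((!) p) m e = 0" if p: "p \<in> walk_lists E m" and e: "e \<notin> E" for p e
    proof -
      have "{p ! t, p ! Suc t} \<in> E" if "t < m" for t using p that unfolding walk_lists_def nbwalk_def by auto
      then show ?thesis unfolding ecount_def using e by (auto simp: of_bool_def)
    qed
    obtain p q where rpq: "r = (p, q)" by (cases r)
    have l: "p \<in> walk_lists E m" "q \<in> walk_lists E m" using r unfolding walk_pairs_def rpq by simp_all
    have "(e \<in> E \<and> z r e \<noteq> 0) = odd (ecount ((!) p) m e + ecount ((!) q) m e)" for e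
      unfolding z_def rpq of_nat_bit fst_conv snd_conv using out[OF l(1), of e] out[OF l(2), of e]
      by (cases "e \<in> E") simp_all
    then have "{e \<in> E. z r e \<noteq> 0} = {e. odd (ecount ((!) p) m e + ecount ((!) q) m e)}" by (rule Collect_cong)
    then have "card {e. odd (ecount ((!) p) m e + ecount ((!) q) m e)} \<le> \<Lambda>"
      using weight_le_max[OF fE True] W unfolding vec_weight_def by simp
    then have "r \<in> Pairs" using r unfolding Pairs_def walk_pairs_def rpq by simp
    moreover have "(\<Sum>s\<in>S. bsign (edge_dot E s (z r))) \<le> of_nat (card S) * 1"
      by (rule sum_bounded_above) (simp add: bsign_def)
    ultimately show ?thesis by simp
  next
    case False
    then show ?thesis using solutions_orthogonal[OF fE CE zE False] unfolding S_def by simp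
  qed
  have "(\<Sum>s\<in>S. \<Sum>(p, q)\<in>walk_pairs n E m. walk_sign (signing s) p m * walk_sign (signing s) q m)
      = (\<Sum>s\<in>S. \<Sum>r\<in>walk_pairs n E m. bsign (edge_dot E s (z r)))"
    by (intro sum.cong refl) (use sgn in auto)
  also have "\<dots> = (\<Sum>r\<in>walk_pairs n E m. \<Sum>s\<in>S. bsign (edge_dot E s (z r)))" by (rule sum.swap)
  also have "\<dots> \<le> (\<Sum>r\<in>walk_pairs n E m. if r \<in> Pairs then real (card S) else 0)" by (rule sum_mono) (rule pq)
  also have "\<dots> = real (card S) * real (card (walk_pairs n E m \<inter> Pairs))"
    using finite_walk_pairs by (simp add: sum.If_cases)
  also have "walk_pairs n E m \<inter> Pairs = Pairs" unfolding walk_pairs_def Pairs_def by auto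
  finally have le: "(\<Sum>s\<in>S. \<Sum>(p, q)\<in>walk_pairs n E m. walk_sign (signing s) p m * walk_sign (signing s) q m)
      \<le> (\<Sum>s\<in>S. real (card Pairs))" by simp
  show ?thesis
  proof (rule ccontr)
    assume "\<not> ?thesis"
    then have "(\<Sum>s\<in>S. real (card Pairs)) < (\<Sum>s\<in>S. \<Sum>(p, q)\<in>walk_pairs n E m. walk_sign (signing s) p m * walk_sign (signing s) q m)"
      using finS Sne unfolding S_def by (intro sum_strict_mono) auto
    then show False using le by linarith
  qed
qed

theorem unbalancing_signing:
  assumes "\<And>C. C \<in> \<C> \<Longrightarrow> C \<subseteq> E" "max_weight E \<C> \<le> \<Lambda>" "consistent E \<C>" and n: "0 < n" and m: "1 \<le> m"
  shows "\<exists>\<sigma>\<in>solution_family E \<C>. spectral_radius (signed_adjacency n E \<sigma>) \<le> 2 * sqrt (real (d - 1)) *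
    real ((m + 1) * ((Q + 1) * ((2 * m + 1) * (n * d * (d - 1) ^ ((\<Lambda> + a) div 2))))) powr (1 / (2 * real m))"
proof -
  define M where "M = (m + 1) * ((Q + 1) * ((2 * m + 1) * (n * d * (d - 1) ^ ((\<Lambda> + a) div 2))))"
  have "\<exists>s\<in>solutions E \<C>. (\<Sum>(p, q)\<in>walk_pairs n E m. walk_sign (signing s) p m * walk_sign (signing s) q m) \<le> real (card Pairs)"
    by (rule signing_average[OF _ assms(2,3)]) (rule assms(1))
  then obtain s where s: "s \<in> solutions E \<C>"
    "(\<Sum>(p, q)\<in>walk_pairs n E m. walk_sign (signing s) p m * walk_sign (signing s) q m) \<le> real (card Pairs)"
    by (elim bexE)
  interpret signed_regular n E d "signing s" by unfold_locales (simp add: signing_def)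
  have "card Pairs \<le> M * (d - 1) ^ m" using card_Pairs unfolding M_def power_add by (simp only: ac_simps)
  then have "real (card Pairs) \<le> real (M * (d - 1) ^ m)" by (rule of_nat_mono)
  then have F: "(\<Sum>(p, q)\<in>walk_pairs n E m. wsign p m * wsign q m) \<le> real M * real (d - 1) ^ m"
    using s(2) by simp
  have "0 < M" unfolding M_def using n d by simp
  then have "1 \<le> real M" by simp
  from spectral_radius_le[OF n m this F] show ?thesis
    unfolding solution_family_def M_def[symmetric] using s(1) by (intro bexI[of _ "signing s"] imageI)
qed

end

section \<open>Asymptotics\<close>

text \<open>The number of choices per cut is at most \<open>439623 * m ^ 7\<close>, a polynomial of
  degree 7. As \<open>439623 \<le> 2 ^ 19\<close>, \<open>m \<le> 2 ^ g\<close> and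
  \<open>2 \<le> d - 1\<close>, the exponent \<open>h = 19 + 7 * g\<close> suffices, and
  \<open>a = 260 * h\<close>.\<close>

lemma count_boundI:
  assumes "simple_graph n E" "regular_graph n E d" "3 \<le> d" "bicycle_free n E R"
    and a: "a = 260 * (19 + 7 * g)" and R: "real (34 * a) \<le> R"
    and m: "m \<le> 2 ^ g" "a \<le> m" "d \<le> m"
  shows "count_bound n E d R a m (19 + 7 * g)"
proof unfold_locales
  have m1: "1 \<le> m" using m(3) assms(3) by simp
  have "(2 * m + 1 + 10 * a) * ((12 * a + 1) * d) * (1 + 2 * (12 * a) * (12 * a))
      \<le> (13 * m) * ((13 * m) * m) * (289 * (m * m))"
  proof (intro mult_le_mono)
    have "a * a \<le> m * m" using m(2) by (intro mult_le_mono)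
    moreover have "1 \<le> m * m" using m1 by simp
    ultimately have "1 + 288 * (a * a) \<le> 289 * (m * m)" by linarith
    then show "1 + 2 * (12 * a) * (12 * a) \<le> 289 * (m * m)" by simp
  qed (use m m1 in simp_all)
  also have "\<dots> = 48841 * m ^ 5"
  proof -
    have "m ^ 5 = m * m * m * m * m" by (simp add: eval_nat_numeral)
    then show ?thesis by simp
  qed
  finally have 1: "(2 * m + 1 + 10 * a) * ((12 * a + 1) * d) * (1 + 2 * (12 * a) * (12 * a)) \<le> 48841 * m ^ 5" .
  have "m ^ 1 \<le> m ^ 5" using m1 by (intro power_increasing) auto
  then have 2: "d + (2 * (2 * m) + 1) \<le> 6 * m ^ 5" using m(3) m1 by simp
  have "(2 * m + 1) * (2 * m + 1) * (d + (2 * (2 * m) + 1) + (2 * m + 1 + 10 * a) * ((12 * a + 1) * d) * (1 + 2 * (12 * a) * (12 * a)))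
      \<le> (3 * m) * (3 * m) * (6 * m ^ 5 + 48841 * m ^ 5)"
    by (intro mult_le_mono add_mono[OF 2 1]) (use m1 in simp_all)
  also have "\<dots> = 439623 * m ^ 7"
  proof -
    have "m ^ 7 = m * m * m ^ 5" by (simp add: eval_nat_numeral)
    then show ?thesis by simp
  qed
  also have "\<dots> \<le> 2 ^ 19 * (2 ^ g) ^ 7" by (intro mult_le_mono power_mono m(1)) simp_all
  also have "\<dots> = 2 ^ (19 + 7 * g)" by (simp add: power_add power_mult[symmetric] mult.commute)
  also have "\<dots> \<le> (d - 1) ^ (19 + 7 * g)" using assms(3) by (intro power_mono) simp_all
  finally show "(2 * m + 1) * (2 * m + 1) * (d + (2 * (2 * m) + 1) + (2 * m + 1 + 10 * a) * ((12 * a + 1) * d) * (1 + 2 * (12 * a) * (12 * a))) \<le> (d - 1) ^ (19 + 7 * g)" .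
qed (use assms in simp_all)

lemma unbalancing_signing_le:
  assumes G: "simple_graph n E" "regular_graph n E d" "3 \<le> d" "bicycle_free n E R"
    and a: "a = 260 * (19 + 7 * g)" and R: "real (34 * a) \<le> R"
    and m: "m \<le> 2 ^ g" "a \<le> m" "d \<le> m" "\<Lambda> \<le> m"
    and C: "\<And>C. C \<in> \<C> \<Longrightarrow> C \<subseteq> E" "max_weight E \<C> \<le> \<Lambda>" "consistent E \<C>" and n: "0 < n"
  shows "\<exists>\<sigma>\<in>solution_family E \<C>. spectral_radius (signed_adjacency n E \<sigma>) \<le> 2 * sqrt (real (d - 1)) *
    exp ((ln 3126 + 4 * ln (real m) + ln (real n) + real (\<Lambda> + a) * ln (real d)) / (2 * real m))"
proof -
  interpret count_bound n E d R a m \<Lambda> "19 + 7 * g" by (rule count_boundI[OF G a R m(1-3)])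
  have m1: "1 \<le> m" using m(3) G(3) by simp
  define M where "M = (m + 1) * ((Q + 1) * ((2 * m + 1) * (n * d * (d - 1) ^ ((\<Lambda> + a) div 2))))"
  have "\<exists>\<sigma>\<in>solution_family E \<C>. spectral_radius (signed_adjacency n E \<sigma>) \<le> 2 * sqrt (real (d - 1)) * real M powr (1 / (2 * real m))"
    unfolding M_def by (rule unbalancing_signing[OF _ C(2,3) n m1]) (rule C(1))
  then obtain \<sigma> where \<sigma>: "\<sigma> \<in> solution_family E \<C>"
    "spectral_radius (signed_adjacency n E \<sigma>) \<le> 2 * sqrt (real (d - 1)) * real M powr (1 / (2 * real m))"
    by (elim bexE)
  \<comment> \<open>Here \<open>a\<close>, \<open>d\<close> and \<open>\<Lambda>\<close> are
    replaced by \<open>m\<close> in the polynomial factors; \<open>3126 = 2 * 521 * 3\<close>, where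
    521 comes from \<open>Q + 1 \<le> 130 * (4 * m) + 1\<close>.\<close>
  have "M \<le> (2 * m) * ((521 * m) * ((3 * m) * (n * m * d ^ (\<Lambda> + a))))" unfolding M_def
  proof (intro mult_le_mono)
    show "Q + 1 \<le> 521 * m" unfolding Q_def using m m1 by simp
    have "(d - 1) ^ ((\<Lambda> + a) div 2) \<le> d ^ ((\<Lambda> + a) div 2)" by (intro power_mono) simp_all
    also have "\<dots> \<le> d ^ (\<Lambda> + a)" using G(3) by (intro power_increasing) simp_all
    finally show "(d - 1) ^ ((\<Lambda> + a) div 2) \<le> d ^ (\<Lambda> + a)" .
  qed (use m m1 in simp_all)
  also have "\<dots> = 3126 * m ^ 4 * n * d ^ (\<Lambda> + a)"
  proof -
    have "m ^ 4 = m * m * m * m" by (simp add: eval_nat_numeral)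
    then show ?thesis by simp
  qed
  finally have "real M \<le> real (3126 * m ^ 4 * n * d ^ (\<Lambda> + a))" by (rule of_nat_mono)
  also have "\<dots> = exp (ln 3126 + 4 * ln (real m) + ln (real n) + real (\<Lambda> + a) * ln (real d))"
  proof -
    have "exp (4 * ln (real m)) = real m ^ 4" using m1 exp_of_nat_mult[of 4 "ln (real m)"] by simp
    moreover have "exp (real (\<Lambda> + a) * ln (real d)) = real d ^ (\<Lambda> + a)"
      using G(3) exp_of_nat_mult[of "\<Lambda> + a" "ln (real d)"] by simp
    ultimately show ?thesis using n unfolding exp_add by simp
  qed
  finally have "real M powr (1 / (2 * real m)) \<le> exp (ln 3126 + 4 * ln (real m) + ln (real n) + real (\<Lambda> + a) * ln (real d)) powr (1 / (2 * real m))"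
    by (intro powr_mono2) simp_all
  also have "\<dots> = exp ((ln 3126 + 4 * ln (real m) + ln (real n) + real (\<Lambda> + a) * ln (real d)) / (2 * real m))"
    unfolding powr_def by simp
  finally have "2 * sqrt (real (d - 1)) * real M powr (1 / (2 * real m))
      \<le> 2 * sqrt (real (d - 1)) * exp ((ln 3126 + 4 * ln (real m) + ln (real n) + real (\<Lambda> + a) * ln (real d)) / (2 * real m))"
    by (intro mult_left_mono) simp_all
  with \<sigma>(2) show ?thesis by (intro bexI[OF _ \<sigma>(1)]) (rule order_trans)
qed

text \<open>Vertex 0 and its only neighbour form a component. Degree 1 has to be excluded because
  the asserted bound vanishes for it.\<close>

lemma not_connected_1_regular:
  assumes sg: "simple_graph n E" and rg: "regular_graph n E 1" and n: "3 \<le> n"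
  shows "\<not> connected_graph n E"
proof
  assume con: "connected_graph n E"
  have one: "\<exists>v. {u. {x, u} \<in> E} = {v}" if "x < n" for x
    using rg that unfolding regular_graph_def by (simp add: card_1_singleton_iff)
  have lt: "v < n" if "{u, v} \<in> E" for u v
    using sg that unfolding simple_graph_def by (auto simp: doubleton_eq_iff dest!: bspec)
  obtain v where v: "{u. {0, u} \<in> E} = {v}" using one[of 0] n by auto
  have e: "{0, v} \<in> E" using v by auto
  obtain w where w: "{u. {v, u} \<in> E} = {w}" using one[OF lt[OF e]] by auto
  have "0 \<in> {u. {v, u} \<in> E}" using e by (simp add: insert_commute)
  then have w0: "w = 0" using w by simp
  have step: "y \<in> {0, v}" if "(x, y) \<in> adj_rel E" "x \<in> {0, v}" for x y
    using that v w unfolding adj_rel_def w0 by auto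
  have reach: "y \<in> {0, v}" if "(0, y) \<in> (adj_rel E)\<^sup>*" for y
    using that by (induction rule: rtrancl_induct) (use step in auto)
  define z where "z = (if v = 1 then 2 else 1 :: nat)"
  have "(0, z) \<in> (adj_rel E)\<^sup>*" using con n unfolding connected_graph_def z_def by simp
  from reach[OF this] show False unfolding z_def by (auto split: if_splits)
qed

text \<open>A real upper bound for \<open>a = 260 * (19 + 7 * g)\<close>, where \<open>m\<close> is
  \<open>(ln n)\<^sup>2\<close> rounded up and \<open>g\<close> is \<open>log 2 m\<close> rounded
  up; the summands 1 absorb the two roundings.\<close>

definition shortcut_scale :: "nat \<Rightarrow> real" where
  "shortcut_scale n = 260 * (19 + 7 * (log 2 ((ln (real n))\<^sup>2 + 1) + 1))"

text \<open>
  The walks have length about \<open>(ln n)\<^sup>2\<close>, which makes the \<open>n\<close> starting vertices negligible.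
\<close>

definition excess :: "nat \<Rightarrow> nat \<Rightarrow> nat \<Rightarrow> real" where
  "excess \<Lambda> d n = exp ((ln 3126 + 4 * ln ((ln (real n))\<^sup>2 + 1) + ln (real n)) / (2 * (ln (real n))\<^sup>2)
     + (real \<Lambda> + shortcut_scale n) / (2 * (ln (real n))\<^sup>2) * ln (real d)) - 1"

lemma excess_tendsto: "excess \<Lambda> d \<longlonglongrightarrow> 0"
proof -
  have 1: "(\<lambda>n. (ln 3126 + 4 * ln ((ln (real n))\<^sup>2 + 1) + ln (real n)) / (2 * (ln (real n))\<^sup>2)) \<longlonglongrightarrow> 0"
    by real_asymp
  have 2: "(\<lambda>n. 1 / (2 * (ln (real n))\<^sup>2)) \<longlonglongrightarrow> 0" by real_asymp
  have 3: "(\<lambda>n. shortcut_scale n / (2 * (ln (real n))\<^sup>2)) \<longlonglongrightarrow> 0" unfolding shortcut_scale_def by real_asymp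
  have "(\<lambda>n. (real \<Lambda> * (1 / (2 * (ln (real n))\<^sup>2)) + shortcut_scale n / (2 * (ln (real n))\<^sup>2)) * ln (real d))
      \<longlonglongrightarrow> (real \<Lambda> * 0 + 0) * ln (real d)"
    by (intro tendsto_mult tendsto_add tendsto_const 2 3)
  from tendsto_add[OF 1 this] have "(\<lambda>n. (ln 3126 + 4 * ln ((ln (real n))\<^sup>2 + 1) + ln (real n)) / (2 * (ln (real n))\<^sup>2)
     + (real \<Lambda> + shortcut_scale n) / (2 * (ln (real n))\<^sup>2) * ln (real d)) \<longlonglongrightarrow> 0"
    by (simp add: add_divide_distrib)
  from tendsto_diff[OF tendsto_exp[OF this] tendsto_const[of 1]] show ?thesis
    unfolding excess_def[abs_def] by simp
qed

theorem proposition21: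
  shows "\<exists>K::real. K > 0 \<and>
    (\<forall>\<delta>::real. \<forall>L \<Lambda> d :: nat. 0 < \<delta> \<and> \<delta> < 1 \<and> 0 < L \<and> 0 < \<Lambda> \<and> 0 < d \<longrightarrow>
      (\<exists>\<eta> :: nat \<Rightarrow> real. \<eta> \<longlonglongrightarrow> 0 \<and>
        (\<forall>\<^sub>F n in sequentially. \<forall>(E :: edge set) (R :: real) (\<C> :: edge set set).
          simple_graph n E \<and> connected_graph n E \<and> regular_graph n E d \<and>
          R \<ge> K * ln (ln (real n)) / \<delta> \<and> bicycle_free n E R \<and>
          (\<forall>C\<in>\<C>. even_cycle E C \<and> card C \<le> L) \<and> consistent E \<C> \<and>
          max_weight E \<C> \<le> \<Lambda> \<longrightarrow>
          (\<exists>\<sigma>\<in>solution_family E \<C>.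
            spectral_radius (signed_adjacency n E \<sigma>)
              \<le> 2 * sqrt (real d - 1) * (1 + K * \<delta> * ln (1 / \<delta>)) * (1 + \<eta> n)))))"
proof (rule exI[of _ "10 ^ 6"], intro conjI allI impI)
  fix \<delta> :: real and L \<Lambda> d :: nat
  assume "0 < \<delta> \<and> \<delta> < 1 \<and> 0 < L \<and> 0 < \<Lambda> \<and> 0 < d"
  then have \<delta>: "0 < \<delta>" "\<delta> < 1" and d: "0 < d" by simp_all
  have fac: "1 \<le> 1 + 10 ^ 6 * \<delta> * ln (1 / \<delta>)" using \<delta> by (simp add: ln_ge_zero)
  show "\<exists>\<eta>. \<eta> \<longlonglongrightarrow> 0 \<and>
        (\<forall>\<^sub>F n in sequentially. \<forall>(E :: edge set) (R :: real) (\<C> :: edge set set).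
          simple_graph n E \<and> connected_graph n E \<and> regular_graph n E d \<and>
          R \<ge> 10 ^ 6 * ln (ln (real n)) / \<delta> \<and> bicycle_free n E R \<and>
          (\<forall>C\<in>\<C>. even_cycle E C \<and> card C \<le> L) \<and> consistent E \<C> \<and>
          max_weight E \<C> \<le> \<Lambda> \<longrightarrow>
          (\<exists>\<sigma>\<in>solution_family E \<C>.
            spectral_radius (signed_adjacency n E \<sigma>)
              \<le> 2 * sqrt (real d - 1) * (1 + 10 ^ 6 * \<delta> * ln (1 / \<delta>)) * (1 + \<eta> n)))"
  proof (intro exI[of _ "excess \<Lambda> d"] conjI excess_tendsto)
    have big: "\<forall>\<^sub>F n in sequentially. real (max \<Lambda> d) \<le> (ln (real n))\<^sup>2"
    proof -
      have "filterlim (\<lambda>n. (ln (real n))\<^sup>2) at_top sequentially" by real_asymp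
      then show ?thesis unfolding filterlim_at_top by (rule spec)
    qed
    have r1: "\<forall>\<^sub>F n in sequentially. shortcut_scale n \<le> (ln (real n))\<^sup>2" unfolding shortcut_scale_def by real_asymp
    \<comment> \<open>The origin of \<open>10 ^ 6\<close>: with
      \<open>log 2 y \<le> 2 * ln y\<close> the left side is at most
      \<open>34 * 260 * 7 * 4 = 247520\<close> times \<open>ln (ln n)\<close>, up to lower order
      terms.\<close>
    have r2: "\<forall>\<^sub>F n in sequentially. 34 * shortcut_scale n \<le> 10 ^ 6 * ln (ln (real n))"
    proof -
      have log: "log 2 y \<le> 2 * ln y" if "1 \<le> y" for y :: real
      proof -
        have "ln y * 1 \<le> ln y * (2 * ln 2)" using that ln2_ge_two_thirds by (intro mult_left_mono) auto
        then show ?thesis unfolding log_def by (simp add: divide_le_eq)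
      qed
      have "\<forall>\<^sub>F n in sequentially. 34 * (260 * (19 + 7 * (2 * ln ((ln (real n))\<^sup>2 + 1) + 1))) \<le> 10 ^ 6 * ln (ln (real n))"
        by real_asymp
      then show ?thesis
      proof eventually_elim
        case (elim n)
        have "log 2 ((ln (real n))\<^sup>2 + 1) \<le> 2 * ln ((ln (real n))\<^sup>2 + 1)" by (rule log) simp
        then show ?case using elim unfolding shortcut_scale_def by simp
      qed
    qed
    have r3: "\<forall>\<^sub>F n in sequentially. 0 \<le> ln (ln (real n))" by real_asymp
    show "\<forall>\<^sub>F n in sequentially. \<forall>(E :: edge set) (R :: real) (\<C> :: edge set set).
          simple_graph n E \<and> connected_graph n E \<and> regular_graph n E d \<and>
          R \<ge> 10 ^ 6 * ln (ln (real n)) / \<delta> \<and> bicycle_free n E R \<and>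
          (\<forall>C\<in>\<C>. even_cycle E C \<and> card C \<le> L) \<and> consistent E \<C> \<and>
          max_weight E \<C> \<le> \<Lambda> \<longrightarrow>
          (\<exists>\<sigma>\<in>solution_family E \<C>.
            spectral_radius (signed_adjacency n E \<sigma>)
              \<le> 2 * sqrt (real d - 1) * (1 + 10 ^ 6 * \<delta> * ln (1 / \<delta>)) * (1 + excess \<Lambda> d n))"
      using eventually_ge_at_top[of 3] big r1 r2 r3
    proof eventually_elim
      case (elim n)
      define x where "x = (ln (real n))\<^sup>2"
      define m where "m = nat \<lceil>x\<rceil>"
      define g where "g = nat \<lceil>log 2 (real m)\<rceil>"
      define a where "a = 260 * (19 + 7 * g)"
      have x: "1 \<le> x" using elim(2) d unfolding x_def by simp
      have mx: "x \<le> real m" "real m \<le> x + 1" unfolding m_def using x by linarith+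
      have m1: "1 \<le> m" using x mx by simp
      have g0: "0 \<le> log 2 (real m)" using m1 by simp
      have "real m = 2 powr log 2 (real m)" using m1 by simp
      also have "\<dots> \<le> 2 powr real g" unfolding g_def using g0 by (intro powr_mono) linarith+
      also have "\<dots> = real (2 ^ g)" by (simp add: powr_realpow)
      finally have mg: "m \<le> 2 ^ g" by (simp only: of_nat_le_iff)
      have "real g \<le> log 2 (real m) + 1" unfolding g_def using g0 by linarith
      also have "log 2 (real m) \<le> log 2 (x + 1)" using mx m1 x by simp
      finally have ra: "real a \<le> shortcut_scale n" unfolding a_def shortcut_scale_def x_def by simp
      have am: "a \<le> m" using ra elim(3) mx unfolding x_def by linarith
      have dm: "d \<le> m" "\<Lambda> \<le> m" using elim(2) mx unfolding x_def by linarith+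
      have ln_n: "0 \<le> ln (real n)" using elim(1) by simp
      define U where "U = ln 3126 + 4 * ln (real m) + ln (real n) + real (\<Lambda> + a) * ln (real d)"
      have U0: "0 \<le> U" unfolding U_def using m1 ln_n d by simp
      have "U \<le> (ln 3126 + 4 * ln (x + 1) + ln (real n)) + (real \<Lambda> + shortcut_scale n) * ln (real d)"
        unfolding U_def using mx m1 ra d by (intro add_mono mult_right_mono) simp_all
      then have "U / (2 * x) \<le> ((ln 3126 + 4 * ln (x + 1) + ln (real n)) + (real \<Lambda> + shortcut_scale n) * ln (real d)) / (2 * x)"
        using x by (intro divide_right_mono) simp_all
      also have "\<dots> = (ln 3126 + 4 * ln (x + 1) + ln (real n)) / (2 * x) + (real \<Lambda> + shortcut_scale n) / (2 * x) * ln (real d)"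
        unfolding add_divide_distrib[of _ "_ * _"] times_divide_eq_left ..
      finally have Ux: "exp (U / (2 * x)) \<le> 1 + excess \<Lambda> d n"
        unfolding excess_def x_def[symmetric] by simp
      have "U / (2 * real m) \<le> U / (2 * x)" using U0 mx x by (intro divide_left_mono) simp_all
      then have Um: "exp (U / (2 * real m)) \<le> 1 + excess \<Lambda> d n" using Ux by (meson exp_le_cancel_iff order_trans)
      have "1 \<le> exp (U / (2 * x))" using U0 x by simp
      then have ex1: "1 \<le> 1 + excess \<Lambda> d n" using Ux by linarith
      show ?case
      proof (intro allI impI, elim conjE)
        fix E :: "edge set" and R :: real and \<C> :: "edge set set"
        assume sg: "simple_graph n E" and con: "connected_graph n E" and rg: "regular_graph n E d"
          and R: "R \<ge> 10 ^ 6 * ln (ln (real n)) / \<delta>" and bf: "bicycle_free n E R"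
          and CC: "\<forall>C\<in>\<C>. even_cycle E C \<and> card C \<le> L" and cons: "consistent E \<C>" and W: "max_weight E \<C> \<le> \<Lambda>"
        have CE: "C \<subseteq> E" if "C \<in> \<C>" for C using CC that unfolding even_cycle_def graph_cycle_def by auto
        have d1: "d \<noteq> 1" using not_connected_1_regular[OF sg _ elim(1)] con rg by metis
        have rd: "real (d - 1) = real d - 1" using d by (simp add: of_nat_diff)
        have n: "0 < n" using elim(1) by simp
        have main: "\<exists>\<sigma>\<in>solution_family E \<C>. spectral_radius (signed_adjacency n E \<sigma>) \<le> 2 * sqrt (real d - 1) * (1 + excess \<Lambda> d n)"
        proof (cases "d = 2")
          case True
          obtain s where s: "s \<in> solutions E \<C>" using cons unfolding consistent_def by auto
          interpret signed_regular n E d "signing s" by unfold_locales (use sg rg True in \<open>simp_all add: signing_def\<close>)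
          have "spectral_radius (signed_adjacency n E (signing s)) \<le> 2 * sqrt (real d - 1) * (1 + excess \<Lambda> d n)"
            using spectral_radius_le_degree[OF n] ex1 True by simp
          then show ?thesis unfolding solution_family_def using s by (intro bexI[of _ "signing s"] imageI)
        next
          case False
          then have d3: "3 \<le> d" using d d1 by simp
          \<comment> \<open>As \<open>\<delta> < 1\<close>, the assumed radius is at least
            \<open>10 ^ 6 * ln (ln n)\<close>, hence at least \<open>34 * a\<close>.\<close>
          have "10 ^ 6 * ln (ln (real n)) * \<delta> \<le> 10 ^ 6 * ln (ln (real n)) * 1" using elim(5) \<delta> by (intro mult_left_mono) simp_all
          then have "10 ^ 6 * ln (ln (real n)) \<le> 10 ^ 6 * ln (ln (real n)) / \<delta>" using \<delta> by (simp add: le_divide_eq)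
          then have Ra: "real (34 * a) \<le> R" using R elim(4) ra by simp
          have "\<exists>\<sigma>\<in>solution_family E \<C>. spectral_radius (signed_adjacency n E \<sigma>) \<le> 2 * sqrt (real (d - 1)) * exp (U / (2 * real m))"
            unfolding U_def by (rule unbalancing_signing_le[OF sg rg d3 bf a_def Ra mg am dm _ W cons n]) (rule CE)
          then obtain \<sigma> where \<sigma>: "\<sigma> \<in> solution_family E \<C>"
            "spectral_radius (signed_adjacency n E \<sigma>) \<le> 2 * sqrt (real (d - 1)) * exp (U / (2 * real m))"
            by (elim bexE)
          have "2 * sqrt (real (d - 1)) * exp (U / (2 * real m)) \<le> 2 * sqrt (real d - 1) * (1 + excess \<Lambda> d n)"
            unfolding rd using Um d by (intro mult_left_mono) simp_all
          with \<sigma>(2) show ?thesis by (intro bexI[OF _ \<sigma>(1)]) (rule order_trans)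
        qed
        have "2 * sqrt (real d - 1) * 1 \<le> 2 * sqrt (real d - 1) * (1 + 10 ^ 6 * \<delta> * ln (1 / \<delta>))"
          using d by (intro mult_left_mono fac) simp
        then have "2 * sqrt (real d - 1) * (1 + excess \<Lambda> d n)
            \<le> 2 * sqrt (real d - 1) * (1 + 10 ^ 6 * \<delta> * ln (1 / \<delta>)) * (1 + excess \<Lambda> d n)"
          using ex1 by (intro mult_right_mono) simp_all
        then show "\<exists>\<sigma>\<in>solution_family E \<C>. spectral_radius (signed_adjacency n E \<sigma>)
              \<le> 2 * sqrt (real d - 1) * (1 + 10 ^ 6 * \<delta> * ln (1 / \<delta>)) * (1 + excess \<Lambda> d n)"
          using main by (meson order_trans)
      qed
    qed
  qed
qed simp

end
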